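(* Let $R$ be a commutative ring with $1$ which is $\mathbb S$-torsion-free and $\mathbb S$-reduced, with $|R|<2^{\aleph_0}$. Let $K$ be any $\mathbb S$-torsion-free and $\mathbb S$-reduced $R$-module of rank $\kappa<2^{\aleph_0}$ (with $\kappa\ge 1$). Then there is a cotorsion-free $R$-module $G$, of rank $3$ if $\kappa=1$ and of rank $3\kappa+1$ if $2\le\kappa<2^{\aleph_0}$, containing $K$ as a submodule, such that $\mathrm{Hom}_R(G,K)=0$ and $\mathrm{Hom}_R(G,G/K)=\pi R$, where $\pi\colon G\to G/K$, $g\mapsto g+K$, is the canonical epimorphism. In particular, $0\to K\to G\to G/K\to 0$ is a cellular exact sequence.
   Context: $R$ has a distinguished countable multiplicatively closed subset $\mathbb S=\{s_n:n\in\omega\}$; "torsion", "reduced", "pure" refer to $\mathbb S$. $\widehat R$ is the $\mathbb S$-adic completion of $R$, and an $R$-module $M$ is cotorsion-free if $\mathrm{Hom}_R(\widehat R,M)=0$. Rank: if $|M|>|R|$ then $\mathrm{rk}(M)=|M|$; if $|M|\le|R|$, $\mathrm{rk}(M)=\kappa$ means there is a free submodule $E=\bigoplus_{i<\kappa}Re_i\subseteq M$ with $M/E$ $\mathbb S$-torsion (every element annihilated by some $s\in\mathbb S$). $\pi R$ denotes $\{\pi r: r\in R\}$ where $\pi r$ is $\pi$ followed by multiplication by $r$. A cellular exact sequence $0\to K\to G\xrightarrow{\pi} M\to 0$ is a short exact sequence in which $\pi_*\colon\mathrm{Hom}_R(G,G)\to\mathrm{Hom}_R(G,M)$, $\varphi\mapsto\pi\varphi$,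 is an isomorphism. *)

theory Defs
  imports Main "HOL-Library.Countable_Set"
begin

record ('r, 'm) rmod =
  mcarrier :: "'m set"
  madd :: "'m \<Rightarrow> 'm \<Rightarrow> 'm"
  mzero :: "'m"
  msmul :: "'r \<Rightarrow> 'm \<Rightarrow> 'm"

definition is_module :: "('r::comm_ring_1, 'm) rmod \<Rightarrow> bool" where
  "is_module M \<longleftrightarrow>
     mzero M \<in> mcarrier M \<and>
     (\<forall>x\<in>mcarrier M. \<forall>y\<in>mcarrier M. madd M x y \<in> mcarrier M) \<and>
     (\<forall>r. \<forall>x\<in>mcarrier M. msmul M r x \<in> mcarrier M) \<and>
     (\<forall>x\<in>mcarrier M. \<forall>y\<in>mcarrier M. \<forall>z\<in>mcarrier M.
        madd M (madd M x y) z = madd M x (madd M y z)) \<and>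
     (\<forall>x\<in>mcarrier M. \<forall>y\<in>mcarrier M. madd M x y = madd M y x) \<and>
     (\<forall>x\<in>mcarrier M. madd M (mzero M) x = x) \<and>
     (\<forall>x\<in>mcarrier M. \<exists>y\<in>mcarrier M. madd M x y = mzero M) \<and>
     (\<forall>r. \<forall>x\<in>mcarrier M. \<forall>y\<in>mcarrier M.
        msmul M r (madd M x y) = madd M (msmul M r x) (msmul M r y)) \<and>
     (\<forall>r s. \<forall>x\<in>mcarrier M. msmul M (r + s) x = madd M (msmul M r x) (msmul M s x)) \<and>
     (\<forall>r s. \<forall>x\<in>mcarrier M. msmul M (r * s) x = msmul M r (msmul M s x)) \<and>
     (\<forall>x\<in>mcarrier M. msmul M 1 x = x)"

definition ring_mod :: "('r::comm_ring_1, 'r) rmod" where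
  "ring_mod = \<lparr>mcarrier = UNIV, madd = (+), mzero = 0, msmul = (*)\<rparr>"

definition lin_map :: "('r::comm_ring_1, 'm) rmod \<Rightarrow> ('r, 'n) rmod \<Rightarrow> ('m \<Rightarrow> 'n) \<Rightarrow> bool" where
  "lin_map M N f \<longleftrightarrow>
     (\<forall>x\<in>mcarrier M. f x \<in> mcarrier N) \<and>
     (\<forall>x\<in>mcarrier M. \<forall>y\<in>mcarrier M. f (madd M x y) = madd N (f x) (f y)) \<and>
     (\<forall>r. \<forall>x\<in>mcarrier M. f (msmul M r x) = msmul N r (f x))"

definition torsion_free :: "'r::comm_ring_1 set \<Rightarrow> ('r, 'm) rmod \<Rightarrow> bool" where
  "torsion_free S M \<longleftrightarrow>
     (\<forall>s\<in>S. \<forall>x\<in>mcarrier M. msmul M s x = mzero M \<longrightarrow> x = mzero M)"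

definition reduced :: "'r::comm_ring_1 set \<Rightarrow> ('r, 'm) rmod \<Rightarrow> bool" where
  "reduced S M \<longleftrightarrow>
     (\<forall>x\<in>mcarrier M. (\<forall>s\<in>S. \<exists>y\<in>mcarrier M. x = msmul M s y) \<longrightarrow> x = mzero M)"

definition coset :: "('r, 'm) rmod \<Rightarrow> 'm set \<Rightarrow> 'm \<Rightarrow> 'm set" where
  "coset M N x = {madd M x n | n. n \<in> N}"

definition rep :: "'m set \<Rightarrow> 'm" where
  "rep X = (SOME x. x \<in> X)"

definition quot_mod :: "('r, 'm) rmod \<Rightarrow> 'm set \<Rightarrow> ('r, 'm set) rmod" where
  "quot_mod M N =
     \<lparr>mcarrier = coset M N ` mcarrier M,
      madd = (\<lambda>X Y. coset M N (madd M (rep X) (rep Y))),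
      mzero = coset M N (mzero M),
      msmul = (\<lambda>r X. coset M N (msmul M r (rep X)))\<rparr>"

definition quot_map :: "('r, 'm) rmod \<Rightarrow> 'm set \<Rightarrow> 'm \<Rightarrow> 'm set" where
  "quot_map M N = coset M N"

definition sadic_cauchy :: "'r::comm_ring_1 set \<Rightarrow> (nat \<Rightarrow> 'r) \<Rightarrow> bool" where
  "sadic_cauchy S x \<longleftrightarrow> (\<forall>s\<in>S. \<exists>N. \<forall>n\<ge>N. \<forall>m\<ge>N. s dvd (x n - x m))"

definition sadic_null :: "'r::comm_ring_1 set \<Rightarrow> (nat \<Rightarrow> 'r) \<Rightarrow> bool" where
  "sadic_null S x \<longleftrightarrow> (\<forall>s\<in>S. \<exists>N. \<forall>n\<ge>N. s dvd x n)"

definition cauchy_mod :: "'r::comm_ring_1 set \<Rightarrow> ('r, nat \<Rightarrow> 'r) rmod" where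
  "cauchy_mod S =
     \<lparr>mcarrier = {x. sadic_cauchy S x},
      madd = (\<lambda>x y n. x n + y n),
      mzero = (\<lambda>n. 0),
      msmul = (\<lambda>r x n. r * x n)\<rparr>"

definition completion :: "'r::comm_ring_1 set \<Rightarrow> ('r, (nat \<Rightarrow> 'r) set) rmod" where
  "completion S = quot_mod (cauchy_mod S) {x. sadic_null S x}"

definition cotorsion_free :: "'r::comm_ring_1 set \<Rightarrow> ('r, 'm) rmod \<Rightarrow> bool" where
  "cotorsion_free S M \<longleftrightarrow>
     (\<forall>f. lin_map (completion S) M f \<longrightarrow> (\<forall>x\<in>mcarrier (completion S). f x = mzero M))"

fun msum_list :: "('r, 'm) rmod \<Rightarrow> 'm list \<Rightarrow> 'm" where
  "msum_list M [] = mzero M"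
| "msum_list M (x # xs) = madd M x (msum_list M xs)"

definition lin_comb :: "('r, 'm) rmod \<Rightarrow> ('i \<Rightarrow> 'm) \<Rightarrow> ('i \<Rightarrow> 'r) \<Rightarrow> 'i list \<Rightarrow> 'm" where
  "lin_comb M e c is = msum_list M (map (\<lambda>i. msmul M (c i) (e i)) is)"

definition independent :: "('r::comm_ring_1, 'm) rmod \<Rightarrow> ('i \<Rightarrow> 'm) \<Rightarrow> 'i set \<Rightarrow> bool" where
  "independent M e A \<longleftrightarrow>
     (\<forall>i\<in>A. e i \<in> mcarrier M) \<and>
     (\<forall>c is. distinct is \<and> set is \<subseteq> A \<and> lin_comb M e c is = mzero M
        \<longrightarrow> (\<forall>i\<in>set is. c i = 0))"

definition span :: "('r, 'm) rmod \<Rightarrow> ('i \<Rightarrow> 'm) \<Rightarrow> 'i set \<Rightarrow> 'm set" where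
  "span M e A = {lin_comb M e c is | c is. set is \<subseteq> A}"

definition has_rank :: "'r::comm_ring_1 set \<Rightarrow> ('r, 'm) rmod \<Rightarrow> 'i set \<Rightarrow> bool" where
  "has_rank S M A \<longleftrightarrow>
     (if (card_of (UNIV :: 'r set), card_of (mcarrier M)) \<in> ordLess
      then (card_of (mcarrier M), card_of A) \<in> ordIso
      else (\<exists>e. independent M e A \<and>
                 (\<forall>x\<in>mcarrier M. \<exists>s\<in>S. msmul M s x \<in> span M e A)))"

definition short_exact ::
  "('r::comm_ring_1, 'k) rmod \<Rightarrow> ('r, 'g) rmod \<Rightarrow> ('r, 'q) rmod \<Rightarrow> ('k \<Rightarrow> 'g) \<Rightarrow> ('g \<Rightarrow> 'q) \<Rightarrow> bool" where
  "short_exact K G M i p \<longleftrightarrow>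
     lin_map K G i \<and> inj_on i (mcarrier K) \<and> lin_map G M p \<and>
     p ` mcarrier G = mcarrier M \<and>
     {x \<in> mcarrier G. p x = mzero M} = i ` mcarrier K"

definition cellular_exact ::
  "('r::comm_ring_1, 'k) rmod \<Rightarrow> ('r, 'g) rmod \<Rightarrow> ('r, 'q) rmod \<Rightarrow> ('k \<Rightarrow> 'g) \<Rightarrow> ('g \<Rightarrow> 'q) \<Rightarrow> bool" where
  "cellular_exact K G M i p \<longleftrightarrow>
     short_exact K G M i p \<and>
     (\<forall>\<phi> \<psi>. lin_map G G \<phi> \<and> lin_map G G \<psi> \<and> (\<forall>x\<in>mcarrier G. p (\<phi> x) = p (\<psi> x))
        \<longrightarrow> (\<forall>x\<in>mcarrier G. \<phi> x = \<psi> x)) \<and>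
     (\<forall>f. lin_map G M f \<longrightarrow> (\<exists>\<phi>. lin_map G G \<phi> \<and> (\<forall>x\<in>mcarrier G. f x = p (\<phi> x))))"

end

theory Submission
  imports Defs "HOL.Modules" "HOL-Library.Function_Algebras" "HOL-Library.Product_Plus"
begin

text \<open>
  Write \<open>e\<^sub>i\<close> for elements of \<open>K\<close> whose span has torsion cokernel, and choose elements \<open>w\<^sub>j\<close> and \<open>y\<close> of
  the completion of \<open>R\<close>. Let \<open>G\<close> be the pure submodule of the completion of \<open>K \<oplus> R\<close> generated by
  \<open>K\<close>, \<open>u = (0, 1)\<close> and the elements \<open>v\<^sub>j = y e\<^sub>i + w\<^sub>j u\<close>, where every \<open>i\<close> is attached to some \<open>j\<close>
  (to one \<open>j\<close> if the rank is \<open>1\<close>, to two otherwise). Then \<open>G/K\<close> is the pure submodule of the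
  completion of \<open>R\<close> generated by \<open>1\<close> and the \<open>w\<^sub>j\<close>. A homomorphism \<open>\<phi>\<close> from \<open>G\<close> to \<open>K\<close> or to \<open>G/K\<close> is
  continuous, hence \<open>\<phi> v\<^sub>j = y (\<phi> e\<^sub>i) + w\<^sub>j (\<phi> u)\<close>. If \<open>y\<close> satisfies no linear relation over the
  module generated so far, this forces \<open>\<phi> e\<^sub>i = 0\<close>; if one of the \<open>w\<^sub>j\<close> satisfies no quadratic relation
  over the others, it forces \<open>\<phi> u\<close> to be a scalar.

  Such elements exist by counting. The series \<open>\<Sum>i\<in>X. q\<^sub>i\<close>, where \<open>q\<^sub>i\<close> runs through a divisor chain
  cofinal in \<open>S\<close> and \<open>X\<close> through the sets of natural numbers, are \<open>2\<^bsup>\<aleph>\<^sub>0\<^esup>\<close> many candidates, and every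
  non-trivial relation of degree at most two excludes only finitely many of them: the difference of
  two candidates is an element of \<open>S\<close> times a unit modulo any prescribed \<open>q\<^sub>l\<close>, provided that the
  two sets agree up to a large enough number. The same count shows that \<open>G\<close> is cotorsion-free.
\<close>

text \<open>Zero divisors in \<open>R\<close> rule out the usual bound on the number of roots of a
  polynomial; cancelling Vandermonde determinants in differences of the series takes its place.
  Degree two is the right bound: a homomorphism yields \<open>w * \<beta> = z\<close> in which
  \<beta> and z are already linear in the series, and a single index \<open>j0\<close> has to be
  generic to this degree. The homomorphism arguments see K through generators modulo torsion, never
  through a basis. This covers |K| > |R|, where the rank is a cardinal and the \<open>e i\<close>
  simply enumerate K; a basis enters when the rank of G is computed for |K| <= |R|. Maps into K and
  into G/K are both treated as maps into the completion of the sum of K and R, those into G/K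
  through the second coordinate, so one statement about scalars serves both. Two copies of each
  index for rank at least 2 make the \<open>e i\<close>, the \<open>v j\<close> and \<open>u\<close>
  together number 3 kappa + 1. Elements of the completion are handled as sequences and equality as a
  null difference, so lifts of homomorphisms are linear only up to null sequences.\<close>

unbundle cardinal_syntax

section \<open>Cardinal arithmetic below the continuum\<close>

lemma infinite_UNIV_nat_set: "infinite (UNIV :: nat set set)"
  by (simp add: Finite_Set.finite_set)

text \<open>Infinitely many finite sets have a union no larger than their number, so fewer than
  continuum many cannot exhaust the continuum. Every choice of a generic series rests on this
  count.\<close>

lemma exists_avoiding_finite_sets:
  fixes B :: "'d \<Rightarrow> nat set set"
  assumes D: "|D| <o |UNIV :: nat set set|" and fin: "\<And>d. d \<in> D \<Longrightarrow> finite (B d)"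
  shows "\<exists>X. \<forall>d\<in>D. X \<notin> B d"
proof -
  have "(\<Union>d\<in>D. B d) \<noteq> UNIV"
  proof (cases "finite D")
    case True
    then show ?thesis
      using fin infinite_UNIV_nat_set by (metis finite_UN)
  next
    case False
    have "|B d| \<le>o |D|" if "d \<in> D" for d
      using finite_ordLess_infinite[OF card_of_Well_order card_of_Well_order, of "B d" D] fin[OF that] False
      by (simp add: ordLess_imp_ordLeq Field_card_of)
    then have "|\<Union>d\<in>D. B d| \<le>o |D|"
      using card_of_UNION_ordLeq_infinite[OF False, of D B] card_of_mono1[of D D] by simp
    then have "|\<Union>d\<in>D. B d| <o |UNIV :: nat set set|"
      using D ordLeq_ordLess_trans by blast
    then show ?thesis
      using ordLess_irreflexive by force
  qed
  then show ?thesis by auto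
qed

lemma card_of_lists_ordLeq_infinite:
  assumes inf: "infinite C" and le: "|A| \<le>o |C|"
  shows "|lists A| \<le>o |C|"
proof -
  define L where "L n = {xs \<in> lists A. length xs = n}" for n
  have "|L n| \<le>o |C|" for n
  proof (induction n)
    case 0
    have "L 0 = {[]}" by (auto simp: L_def)
    moreover have "C \<noteq> {}" using inf by auto
    ultimately show ?case by (simp add: card_of_singl_ordLeq)
  next
    case (Suc n)
    have "L (Suc n) \<subseteq> (\<lambda>(x, xs). x # xs) ` (A \<times> L n)"
      by (auto simp: L_def length_Suc_conv image_iff)
    then have "|L (Suc n)| \<le>o |A \<times> L n|"
      by (meson card_of_image card_of_mono1 ordLeq_transitive)
    also have "|A \<times> L n| \<le>o |C|"
      using inf le Suc by (intro card_of_Times_ordLeq_infinite_Field) (simp_all add: card_of_card_order_on Field_card_of)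
    finally show ?case .
  qed
  moreover have "lists A = (\<Union>n\<in>UNIV. L n)"
    by (auto simp: L_def)
  moreover have "|UNIV :: nat set| \<le>o |C|"
    using inf infinite_iff_card_of_nat by blast
  ultimately show ?thesis
    using card_of_UNION_ordLeq_infinite[OF inf, of UNIV L] by simp
qed

lemma card_of_Times_ordLess_nat_set:
  assumes A: "|A| <o |UNIV :: nat set set|" and B: "|B| <o |UNIV :: nat set set|"
  shows "|A \<times> B| <o |UNIV :: nat set set|"
proof -
  \<comment> \<open>The summand \<open>nat\<close> makes \<open>Z\<close> infinite even for finite
    \<open>A\<close> and \<open>B\<close>; then \<open>Z\<close> absorbs the product and still lies
    below the continuum.\<close>
  define Z where "Z = A <+> (B <+> (UNIV :: nat set))"
  have "|UNIV :: nat set| <o |UNIV :: nat set set|"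
    using card_of_Pow[of "UNIV :: nat set"] by simp
  then have Z: "|Z| <o |UNIV :: nat set set|"
    unfolding Z_def using A B by (intro card_of_Plus_ordLess_infinite[OF infinite_UNIV_nat_set])
  have "infinite Z" unfolding Z_def by simp
  moreover have "|A| \<le>o |Z|" "|B| \<le>o |Z|"
    unfolding Z_def by (meson card_of_Plus1 card_of_Plus2 ordLeq_transitive)+
  ultimately have "|A \<times> B| \<le>o |Z|"
    by (intro card_of_Times_ordLeq_infinite_Field) (simp_all add: card_of_card_order_on Field_card_of)
  then show ?thesis using Z ordLeq_ordLess_trans by blast
qed

text \<open>Pigeonhole over the finitely many traces on \<open>{..<N}\<close>. Infinitely many roots
  thereby yield distinct ones that first differ at or beyond \<open>N\<close>, where
  \<open>sfac\<close> is divisible enough.\<close>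

lemma finite_prefix_fibres:
  fixes N :: nat
  assumes "infinite (B :: nat set set)"
  shows "\<exists>C. infinite C \<and> C \<subseteq> B \<and> (\<forall>X\<in>C. \<forall>Y\<in>C. X \<inter> {..<N} = Y \<inter> {..<N})"
proof -
  have "finite ((\<lambda>X. X \<inter> {..<N}) ` B)"
    by (rule finite_subset[of _ "Pow {..<N}"]) auto
  then obtain Y where "Y \<in> B" "infinite {X \<in> B. X \<inter> {..<N} = Y \<inter> {..<N}}"
    using pigeonhole_infinite[OF assms] by blast
  then show ?thesis by (intro exI[of _ "{X \<in> B. X \<inter> {..<N} = Y \<inter> {..<N}}"]) auto
qed

section \<open>The adic topology\<close>

locale adic_ring =
  fixes S :: "'r::comm_ring_1 set"
  assumes countable_S: "countable S"
    and one_S: "1 \<in> S"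
    and mult_S: "s \<in> S \<Longrightarrow> t \<in> S \<Longrightarrow> s * t \<in> S"
    and torsion_free_ring: "s \<in> S \<Longrightarrow> s * x = 0 \<Longrightarrow> x = 0"
    and reduced_ring: "(\<And>s. s \<in> S \<Longrightarrow> s dvd x) \<Longrightarrow> x = 0"
begin

text \<open>\<open>S\<close> need not be a chain, but each of its elements divides
  \<open>sfac n\<close> for all large \<open>n\<close>. Taking products twice makes not only
  \<open>q n\<close> but also the quotient of \<open>q (Suc n)\<close> by \<open>q n\<close>
  divisible by any prescribed element of \<open>S\<close> from some point on.\<close>

definition sfac :: "nat \<Rightarrow> 'r" where
  "sfac n = (\<Prod>i\<le>n. from_nat_into S i)"

definition q :: "nat \<Rightarrow> 'r" where
  "q n = (\<Prod>i<n. sfac i)"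

lemma prod_S: "finite F \<Longrightarrow> (\<And>i. i \<in> F \<Longrightarrow> f i \<in> S) \<Longrightarrow> prod f F \<in> S"
  by (induction F rule: finite_induct) (auto simp: one_S mult_S)

lemma from_nat_S: "from_nat_into S i \<in> S"
  using one_S by (intro from_nat_into) auto

lemma sfac_S: "sfac n \<in> S"
  unfolding sfac_def by (intro prod_S) (auto simp: from_nat_S)

lemma q_S [simp]: "q n \<in> S"
  unfolding q_def by (intro prod_S) (auto simp: sfac_S)

lemma q_0 [simp]: "q 0 = 1"
  by (simp add: q_def)

lemma q_Suc: "q (Suc n) = q n * sfac n"
  by (simp add: q_def)

lemma q_dvd_mono: "m \<le> n \<Longrightarrow> q m dvd q n"
  by (induction n rule: dec_induct) (auto simp: q_Suc)

lemma dvd_sfac: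
  assumes "t \<in> S" shows "\<exists>N. \<forall>n\<ge>N. t dvd sfac n"
proof -
  obtain i where i: "t = from_nat_into S i"
    using assms countable_S by (metis from_nat_into_surj)
  have "t dvd sfac n" if "n \<ge> i" for n
    unfolding sfac_def i using that by (intro dvd_prodI) auto
  then show ?thesis by blast
qed

lemma dvd_q:
  assumes "t \<in> S" shows "\<exists>n\<ge>m. t dvd q n"
proof -
  obtain N where "\<forall>n\<ge>N. t dvd sfac n" using dvd_sfac[OF assms] by blast
  then have "t dvd q (Suc (max N m))" by (simp add: q_Suc)
  then show ?thesis by (meson le_SucI max.cobounded2)
qed

text \<open>In a finite ring the injective multiplication by \<open>s\<close> would be onto, so all
  of \<open>S\<close> would consist of units and divide 1, against reducedness.\<close>

lemma infinite_UNIV_R: "infinite (UNIV :: 'r set)"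
proof
  assume fin: "finite (UNIV :: 'r set)"
  have "s dvd 1" if s: "s \<in> S" for s
  proof -
    have "inj ((*) s)"
    proof (rule injI)
      fix x y assume "s * x = s * y"
      then have "s * (x - y) = 0" by (simp add: algebra_simps)
      then show "x = y" using torsion_free_ring[OF s] by fastforce
    qed
    then have "surj ((*) s)" using fin finite_UNIV_inj_surj by blast
    then show ?thesis by (metis dvdI surjD)
  qed
  then have "(1::'r) = 0" by (intro reduced_ring) auto
  then show False by simp
qed

text \<open>Partial sums of the series attached to \<open>X\<close>. The strict bound
  \<open>i < n\<close> leaves a tail divisible by \<open>q n\<close>.\<close>

definition wseq :: "nat set \<Rightarrow> nat \<Rightarrow> 'r" where
  "wseq X n = (\<Sum>i<n. if i \<in> X then q i else 0)"

lemma wseq_coherent: "m \<le> n \<Longrightarrow> q m dvd wseq X n - wseq X m"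
proof (induction n rule: dec_induct)
  case (step n)
  have "wseq X (Suc n) - wseq X m = (wseq X n - wseq X m) + (if n \<in> X then q n else 0)"
    by (simp add: wseq_def algebra_simps)
  moreover have "q m dvd (if n \<in> X then q n else 0)"
    using q_dvd_mono[OF step(1)] by simp
  ultimately show ?case using step by (metis dvd_add)
qed simp

text \<open>Differences of two \<open>wseq\<close> are, up to a factor in \<open>S\<close>, units of order two modulo \<open>q l\<close>; this
  property is stable under products.\<close>

definition quasi_unit :: "nat \<Rightarrow> (nat \<Rightarrow> 'r) \<Rightarrow> bool" where
  "quasi_unit l d \<longleftrightarrow> (\<exists>s\<in>S. \<exists>n0. \<forall>n\<ge>n0. \<exists>v. d n = s * v \<and> q l dvd v * v - 1)"

lemma quasi_unit_mult:
  assumes "quasi_unit l d" "quasi_unit l d'"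
  shows "quasi_unit l (\<lambda>n. d n * d' n)"
proof -
  obtain s n0 where s: "s \<in> S" "\<forall>n\<ge>n0. \<exists>v. d n = s * v \<and> q l dvd v * v - 1"
    using assms(1) unfolding quasi_unit_def by blast
  obtain s' n0' where s': "s' \<in> S" "\<forall>n\<ge>n0'. \<exists>v. d' n = s' * v \<and> q l dvd v * v - 1"
    using assms(2) unfolding quasi_unit_def by blast
  have "\<exists>v. d n * d' n = (s * s') * v \<and> q l dvd v * v - 1" if n: "n \<ge> max n0 n0'" for n
  proof -
    obtain v where v: "d n = s * v" "q l dvd v * v - 1" using s n by auto
    obtain v' where v': "d' n = s' * v'" "q l dvd v' * v' - 1" using s' n by auto
    have "(v * v') * (v * v') - 1 = (v * v - 1) * (v' * v') + (v' * v' - 1)"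
      by (simp add: algebra_simps)
    then have "q l dvd (v * v') * (v * v') - 1" using v v' by (metis dvd_add dvd_mult2)
    then show ?thesis using v v' by (intro exI[of _ "v * v'"]) (auto simp: algebra_simps)
  qed
  then show ?thesis unfolding quasi_unit_def using mult_S[OF s(1) s'(1)] by blast
qed

lemma quasi_unit_wseq_diff:
  assumes N: "\<forall>m\<ge>N. q l dvd sfac m" and eq: "X \<inter> {..<N} = Y \<inter> {..<N}" and ne: "X \<noteq> Y"
  shows "quasi_unit l (\<lambda>n. wseq X n - wseq Y n)"
proof -
  define m where "m = (LEAST i. (i \<in> X) \<noteq> (i \<in> Y))"
  have ex: "\<exists>i. (i \<in> X) \<noteq> (i \<in> Y)" using ne by blast
  then have m: "(m \<in> X) \<noteq> (m \<in> Y)" unfolding m_def by (rule LeastI_ex)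
  have less: "(i \<in> X) = (i \<in> Y)" if "i < m" for i
    using not_less_Least[OF that[unfolded m_def]] by blast
  have "m \<ge> N" using m eq by (metis IntD1 IntI lessThan_iff not_less)
  then obtain b where b: "sfac m = q l * b" using N by (auto elim: dvdE)
  \<comment> \<open>All terms after the first difference carry the factor
    \<open>q (Suc m) = q m * sfac m\<close>, and \<open>q l\<close> divides \<open>sfac m\<close>.
    Hence \<open>q m\<close> splits off and leaves the sign \<open>e\<close> modulo
    \<open>q l\<close>.\<close>
  define e :: 'r where "e = (if m \<in> X then 1 else -1)"
  have base: "wseq X m = wseq Y m"
    unfolding wseq_def using less by (intro sum.cong) auto
  have "\<exists>c. wseq X n - wseq Y n = q m * (e + q l * c)" if "n \<ge> Suc m" for n
    using that
  proof (induction n rule: dec_induct)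
    case base
    have "wseq X (Suc m) - wseq Y (Suc m) = q m * e"
      using \<open>wseq X m = wseq Y m\<close> m by (cases "m \<in> X") (simp_all add: wseq_def e_def)
    then show ?case by (intro exI[of _ 0]) auto
  next
    case (step n)
    then obtain c where c: "wseq X n - wseq Y n = q m * (e + q l * c)" by blast
    define d :: 'r where "d = (if n \<in> X then 1 else 0) - (if n \<in> Y then 1 else 0)"
    obtain g where g: "q n = q (Suc m) * g" using step q_dvd_mono by (metis dvdE)
    have "wseq X (Suc n) - wseq Y (Suc n) = (wseq X n - wseq Y n) + q n * d"
      by (simp add: wseq_def d_def)
    also have "\<dots> = q m * (e + q l * (c + b * g * d))"
      unfolding c g by (simp add: q_Suc b algebra_simps)
    finally show ?case by blast
  qed
  moreover have "q l dvd (e + q l * c) * (e + q l * c) - 1" for c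
  proof -
    have "(e + q l * c) * (e + q l * c) - 1 = q l * (2 * e * c + q l * c * c)"
      by (simp add: e_def algebra_simps)
    then show ?thesis by simp
  qed
  ultimately show ?thesis
    unfolding quasi_unit_def using q_S by blast
qed

end

locale adic_module = adic_ring S + module sc
  for S :: "'r::comm_ring_1 set" and sc :: "'r \<Rightarrow> 'a::ab_group_add \<Rightarrow> 'a" +
  fixes A :: "'a set"
  assumes subspace_A: "subspace A"
    and torsion_free_A: "s \<in> S \<Longrightarrow> x \<in> A \<Longrightarrow> sc s x = 0 \<Longrightarrow> x = 0"
    and reduced_A: "x \<in> A \<Longrightarrow> (\<And>s. s \<in> S \<Longrightarrow> \<exists>y\<in>A. x = sc s y) \<Longrightarrow> x = 0"
begin

definition qA :: "nat \<Rightarrow> 'a set" where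
  "qA n = sc (q n) ` A"

text \<open>A coherent sequence stands for an element of the completion of \<open>A\<close>, its
  \<open>n\<close>-th term giving the residue modulo \<open>q n\<close>. Sequences with
  \<open>nul\<close> stand for zero, so the completion is never formed as a quotient.\<close>

definition coh :: "(nat \<Rightarrow> 'a) \<Rightarrow> bool" where
  "coh x \<longleftrightarrow> (\<forall>n. x n \<in> A) \<and> (\<forall>n. x (Suc n) - x n \<in> qA n)"

definition nul :: "(nat \<Rightarrow> 'a) \<Rightarrow> bool" where
  "nul x \<longleftrightarrow> (\<forall>n. x n \<in> qA n)"

lemmas A_0 = subspace_0[OF subspace_A]
lemmas A_add = subspace_add[OF subspace_A]
lemmas A_scale = subspace_scale[OF subspace_A]
lemmas A_diff = subspace_diff[OF subspace_A]

lemma subspace_qA: "subspace (qA n)"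
proof (rule subspaceI)
  show "0 \<in> qA n" unfolding qA_def using A_0 by force
  show "x + y \<in> qA n" if xy: "x \<in> qA n" "y \<in> qA n" for x y
  proof -
    obtain a b where "a \<in> A" "b \<in> A" "x = sc (q n) a" "y = sc (q n) b"
      using xy unfolding qA_def by blast
    then show ?thesis
      unfolding qA_def by (intro image_eqI[of _ _ "a + b"]) (auto simp: A_add scale_right_distrib)
  qed
  show "sc c x \<in> qA n" if x: "x \<in> qA n" for c x
  proof -
    obtain a where "a \<in> A" "x = sc (q n) a" using x unfolding qA_def by blast
    then show ?thesis
      unfolding qA_def by (intro image_eqI[of _ _ "sc c a"]) (auto simp: A_scale mult.commute)
  qed
qed

lemmas qA_0 [simp] = subspace_0[OF subspace_qA]
lemmas qA_add = subspace_add[OF subspace_qA]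
lemmas qA_scale = subspace_scale[OF subspace_qA]
lemmas qA_diff = subspace_diff[OF subspace_qA]
lemmas qA_neg = subspace_neg[OF subspace_qA]

lemma qA_A: "x \<in> qA n \<Longrightarrow> x \<in> A"
  unfolding qA_def using A_scale by auto

lemma dvd_qA: "q n dvd r \<Longrightarrow> a \<in> A \<Longrightarrow> sc r a \<in> qA n"
  unfolding qA_def by (elim dvdE) (metis A_scale image_eqI scale_scale)

lemma qA_mono: "m \<le> n \<Longrightarrow> x \<in> qA n \<Longrightarrow> x \<in> qA m"
  using dvd_qA[OF q_dvd_mono] by (auto simp: qA_def)

lemma coh_le: "m \<le> n \<Longrightarrow> coh x \<Longrightarrow> x n - x m \<in> qA m"
proof (induction n rule: dec_induct)
  case (step n)
  have "x (Suc n) - x m = (x (Suc n) - x n) + (x n - x m)" by simp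
  moreover have "x (Suc n) - x n \<in> qA m"
    using step by (auto simp: coh_def intro: qA_mono)
  ultimately show ?case using step qA_add by metis
qed simp

lemma coh_A: "coh x \<Longrightarrow> x n \<in> A"
  by (simp add: coh_def)

lemma coh_qA_iff: "coh x \<Longrightarrow> m \<le> n \<Longrightarrow> x n \<in> qA m \<longleftrightarrow> x m \<in> qA m"
  using coh_le[of m n x] qA_diff[of "x n" m "x n - x m"] qA_add[of "x n - x m" m "x m"] by auto

lemma cancel_S:
  assumes "s \<in> S" "a \<in> A" "b \<in> A" "sc s a = sc s b" shows "a = b"
  using torsion_free_A[OF assms(1) A_diff[OF assms(2,3)]] assms(4)
  by (simp add: scale_right_diff_distrib)

lemma cancel_qA:
  assumes "s \<in> S" "a \<in> A" "s * q l dvd q n" "sc s a \<in> qA n"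
  shows "a \<in> qA l"
proof -
  obtain c where c: "q n = s * q l * c" using assms(3) by (auto elim: dvdE)
  obtain b where b: "b \<in> A" "sc s a = sc (q n) b" using assms(4) by (auto simp: qA_def)
  have "sc s a = sc s (sc (q l) (sc c b))" using b c by (simp add: mult.assoc)
  then have "a = sc (q l) (sc c b)"
    using cancel_S[OF assms(1,2) A_scale[OF A_scale[OF b(1)]]] by blast
  then show ?thesis unfolding qA_def using b A_scale by blast
qed

text \<open>The factor \<open>s\<close> is cancelled at an index \<open>n\<close> with
  \<open>s * q l\<close> dividing \<open>q n\<close>, at the price of passing from
  \<open>q n\<close> to \<open>q l\<close>; the remaining \<open>v\<close> is its own inverse modulo
  \<open>q l\<close>.\<close>

lemma coh_quasi_unit:
  assumes "coh x" "quasi_unit l d" "nul (\<lambda>n. sc (d n) (x n))"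
  shows "x l \<in> qA l"
proof -
  obtain s n0 where s: "s \<in> S" and n0: "\<And>n. n \<ge> n0 \<Longrightarrow> \<exists>v. d n = s * v \<and> q l dvd v * v - 1"
    using assms(2) unfolding quasi_unit_def by blast
  obtain n where n: "n \<ge> max n0 l" "s * q l dvd q n"
    using dvd_q[OF mult_S[OF s q_S]] by blast
  then obtain v where v: "d n = s * v" "q l dvd v * v - 1" using n0 by (meson max.bounded_iff)
  have xA: "x n \<in> A" using assms coh_A by auto
  have "sc s (sc v (x n)) \<in> qA n" using assms(3) v by (auto simp: nul_def dest: spec[of _ n])
  then have "sc v (x n) \<in> qA l" using cancel_qA[OF s A_scale[OF xA] n(2)] by blast
  then have "sc (v * v) (x n) \<in> qA l" using qA_scale[of _ l v] by fastforce
  moreover have "sc (v * v - 1) (x n) \<in> qA l" using v xA dvd_qA by blast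
  ultimately have "sc (v * v) (x n) - sc (v * v - 1) (x n) \<in> qA l" using qA_diff by blast
  then have "x n \<in> qA l" by (simp add: scale_left_diff_distrib)
  then show ?thesis using coh_qA_iff[OF assms(1), of l n] n by simp
qed

lemma nul_diff: "nul x \<Longrightarrow> nul y \<Longrightarrow> nul (\<lambda>n. x n - y n)"
  by (simp add: nul_def qA_diff)

lemma nul_scale: "nul x \<Longrightarrow> nul (\<lambda>n. sc (r n) (x n))"
  by (simp add: nul_def qA_scale)

text \<open>Subtracting the relations of two roots eliminates \<open>z\<close> and leaves a
  quasi-unit times \<open>y\<close>. This forces \<open>y\<close> to be zero modulo
  \<open>q l\<close>, and \<open>l\<close> is chosen where it is not.\<close>

lemma finite_linear_roots:
  assumes y: "coh y" "\<not> nul y"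
  shows "finite {X. nul (\<lambda>n. sc (wseq X n) (y n) + z n)}" (is "finite ?B")
proof (rule ccontr)
  assume "infinite ?B"
  obtain l where l: "y l \<notin> qA l" using y by (auto simp: nul_def)
  obtain N where N: "\<forall>m\<ge>N. q l dvd sfac m" using dvd_sfac[OF q_S] by blast
  obtain C where C: "infinite C" "C \<subseteq> ?B" "\<forall>X\<in>C. \<forall>Y\<in>C. X \<inter> {..<N} = Y \<inter> {..<N}"
    using finite_prefix_fibres[OF \<open>infinite ?B\<close>, of N] by (elim exE conjE)
  obtain X where X: "X \<in> C" using C(1) by (metis ex_in_conv finite.emptyI)
  obtain Y where Y: "Y \<in> C" "Y \<noteq> X" using C(1) finite_subset[of C "{X}"] by blast
  have "nul (\<lambda>n. (sc (wseq X n) (y n) + z n) - (sc (wseq Y n) (y n) + z n))"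
    using X Y C(2) by (intro nul_diff) auto
  then have "nul (\<lambda>n. sc (wseq X n - wseq Y n) (y n))"
    by (simp add: scale_left_diff_distrib)
  moreover have "quasi_unit l (\<lambda>n. wseq X n - wseq Y n)"
    using C(3) X Y by (intro quasi_unit_wseq_diff[OF N]) blast+
  ultimately show False using coh_quasi_unit[OF y(1)] l by blast
qed

text \<open>Expansion of a 3 by 3 determinant along the column of values of a quadratic: the columns
  of the two lower coefficients drop out and the leading coefficient times the Vandermonde product
  remains.\<close>

lemma quadratic_vandermonde:
  "sc (b - c) (sc (a * a) x + sc a y + z) - sc (a - c) (sc (b * b) x + sc b y + z)
     + sc (a - b) (sc (c * c) x + sc c y + z) = sc ((a - b) * ((a - c) * (b - c))) x"
proof -
  have "sc (b - c) (sc (a * a) x + sc a y + z) - sc (a - c) (sc (b * b) x + sc b y + z)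
     + sc (a - b) (sc (c * c) x + sc c y + z)
    = sc ((b - c) * (a * a) - (a - c) * (b * b) + (a - b) * (c * c)) x
      + sc ((b - c) * a - (a - c) * b + (a - b) * c) y + sc ((b - c) - (a - c) + (a - b)) z"
    by (simp only: scale_right_distrib scale_left_distrib scale_left_diff_distrib scale_scale)
      (simp add: add.commute add.left_commute)
  also have "(b - c) * a - (a - c) * b + (a - b) * c = 0" by (simp add: algebra_simps)
  also have "(b - c) * (a * a) - (a - c) * (b * b) + (a - b) * (c * c)
      = (a - b) * ((a - c) * (b - c))"
    by (simp add: algebra_simps)
  finally show ?thesis by simp
qed

text \<open>The Vandermonde product of three roots is a product of quasi-units, hence again a
  quasi-unit, and so can be cancelled although \<open>R\<close> may have zero divisors.\<close>

lemma finite_quadratic_roots: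
  assumes x: "coh x" "\<not> nul x"
  shows "finite {X. nul (\<lambda>n. sc (wseq X n * wseq X n) (x n) + sc (wseq X n) (y n) + z n)}"
    (is "finite ?B")
proof (rule ccontr)
  assume "infinite ?B"
  obtain l where l: "x l \<notin> qA l" using x by (auto simp: nul_def)
  obtain N where N: "\<forall>m\<ge>N. q l dvd sfac m" using dvd_sfac[OF q_S] by blast
  obtain C where C: "infinite C" "C \<subseteq> ?B" "\<forall>X\<in>C. \<forall>Y\<in>C. X \<inter> {..<N} = Y \<inter> {..<N}"
    using finite_prefix_fibres[OF \<open>infinite ?B\<close>, of N] by (elim exE conjE)
  obtain T where T: "T \<subseteq> C" "card T = 3" using infinite_arbitrarily_large[OF C(1)] by blast
  obtain X Y Z where "T = {X, Y, Z}" "X \<noteq> Y" "X \<noteq> Z" "Y \<noteq> Z"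
    using card_3_iff[THEN iffD1, OF T(2)] by metis
  then have XYZ: "X \<in> C" "Y \<in> C" "Z \<in> C" "X \<noteq> Y" "X \<noteq> Z" "Y \<noteq> Z"
    using T(1) by simp_all
  let ?p = "\<lambda>X n. sc (wseq X n * wseq X n) (x n) + sc (wseq X n) (y n) + z n"
  let ?a = "wseq X" and ?b = "wseq Y" and ?c = "wseq Z"
  have "nul (?p X)" "nul (?p Y)" "nul (?p Z)" using XYZ C(2) by auto
  then have "nul (\<lambda>n. sc (?b n - ?c n) (?p X n) - sc (?a n - ?c n) (?p Y n) + sc (?a n - ?b n) (?p Z n))"
    by (simp add: nul_def qA_add qA_diff qA_scale)
  moreover have "sc (?b n - ?c n) (?p X n) - sc (?a n - ?c n) (?p Y n) + sc (?a n - ?b n) (?p Z n)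
     = sc ((?a n - ?b n) * ((?a n - ?c n) * (?b n - ?c n))) (x n)" for n
    by (rule quadratic_vandermonde)
  ultimately have "nul (\<lambda>n. sc ((?a n - ?b n) * ((?a n - ?c n) * (?b n - ?c n))) (x n))"
    by simp
  moreover have "quasi_unit l (\<lambda>n. (?a n - ?b n) * ((?a n - ?c n) * (?b n - ?c n)))"
    using C(3) XYZ by (intro quasi_unit_mult quasi_unit_wseq_diff[OF N]) blast+
  ultimately show False using coh_quasi_unit[OF x(1)] l by blast
qed

text \<open>\<open>z\<close> carries no coherence condition, so a later use can put there an
  expression such as \<open>w * \<beta> - z\<close> in which another series multiplies a
  coefficient.\<close>

lemma exists_generic:
  assumes D: "|D| <o |UNIV :: nat set set|"
    and coh: "\<And>x y z. (x, y, z) \<in> D \<Longrightarrow> coh x \<and> coh y"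
  shows "\<exists>X. \<forall>(x, y, z)\<in>D. nul (\<lambda>n. sc (wseq X n * wseq X n) (x n) + sc (wseq X n) (y n) + z n)
            \<longrightarrow> nul x \<and> nul y"
proof -
  let ?p = "\<lambda>x y z X n. sc (wseq X n * wseq X n) (x n) + sc (wseq X n) (y n) + z n"
  define B where "B = (\<lambda>(x, y, z). {X. nul (?p x y z X) \<and> \<not> (nul x \<and> nul y)})"
  have "finite (B (x, y, z))" if d: "(x, y, z) \<in> D" for x y z
  proof (cases "nul x")
    case False
    then show ?thesis
      using finite_subset[OF _ finite_quadratic_roots[of x y z]] coh[OF d] by (auto simp: B_def)
  next
    case True
    show ?thesis
    proof (cases "nul y")
      case False
      have "B (x, y, z) \<subseteq> {X. nul (\<lambda>n. sc (wseq X n) (y n) + z n)}"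
      proof
        fix X assume "X \<in> B (x, y, z)"
        then have "nul (\<lambda>n. ?p x y z X n - sc (wseq X n * wseq X n) (x n))"
          using nul_scale[OF True, of "\<lambda>n. wseq X n * wseq X n"] by (intro nul_diff) (auto simp: B_def)
        then show "X \<in> {X. nul (\<lambda>n. sc (wseq X n) (y n) + z n)}"
          by (simp add: algebra_simps)
      qed
      then show ?thesis
        using finite_subset[OF _ finite_linear_roots[of y z]] coh[OF d] False by auto
    next
      case True
      then show ?thesis using \<open>nul x\<close> by (simp add: B_def)
    qed
  qed
  then have "\<exists>X. \<forall>d\<in>D. X \<notin> B d"
    by (intro exists_avoiding_finite_sets[OF D]) auto
  then show ?thesis by (fastforce simp: B_def)
qed

end

section \<open>Presentations of modules\<close>

text \<open>An explicit-carrier module seen as \<open>P\<close> modulo \<open>N\<close> through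
  \<open>h\<close>. Calculations take place on representatives, where type-class algebra is
  available.\<close>

locale presentation = module sc
  for sc :: "'r::comm_ring_1 \<Rightarrow> 'p::ab_group_add \<Rightarrow> 'p" +
  fixes P N :: "'p set" and h :: "'p \<Rightarrow> 'g" and M :: "('r, 'g) rmod"
  assumes subspace_P: "subspace P"
    and subspace_N: "subspace N"
    and N_P: "N \<subseteq> P"
    and carrier: "mcarrier M = h ` P"
    and zero: "mzero M = h 0"
    and add: "x \<in> P \<Longrightarrow> y \<in> P \<Longrightarrow> madd M (h x) (h y) = h (x + y)"
    and smul: "x \<in> P \<Longrightarrow> msmul M r (h x) = h (sc r x)"
    and eq_iff: "x \<in> P \<Longrightarrow> y \<in> P \<Longrightarrow> h x = h y \<longleftrightarrow> x - y \<in> N"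
begin

lemmas P_0 = subspace_0[OF subspace_P]
lemmas P_add = subspace_add[OF subspace_P]
lemmas P_diff = subspace_diff[OF subspace_P]
lemmas P_scale = subspace_scale[OF subspace_P]

lemma h_carrier: "x \<in> P \<Longrightarrow> h x \<in> mcarrier M"
  by (simp add: carrier)

lemma eq_zero_iff: "x \<in> P \<Longrightarrow> h x = mzero M \<longleftrightarrow> x \<in> N"
  using eq_iff[of x 0] P_0 by (simp add: zero)

lemma is_module: "is_module M"
proof -
  have "\<exists>y\<in>P. h (x + y) = h 0" if "x \<in> P" for x
    using P_diff[OF P_0 that] by (intro bexI[of _ "0 - x"]) auto
  then show ?thesis
    unfolding is_module_def
    by (auto simp: carrier zero add smul P_0 P_add P_scale algebra_simps)
qed

lemma coset_h:
  assumes "N' \<subseteq> P" "x \<in> P"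
  shows "coset M (h ` N') (h x) = {h (x + n) | n. n \<in> N'}"
proof -
  have "madd M (h x) (h n) = h (x + n)" if "n \<in> N'" for n
    using that assms add by blast
  then have "(\<lambda>n. madd M (h x) (h n)) ` N' = (\<lambda>n. h (x + n)) ` N'" by simp
  then show ?thesis unfolding coset_def by blast
qed

lemma quotient:
  assumes sub: "subspace N'" and NN': "N \<subseteq> N'" and N'P: "N' \<subseteq> P"
  shows "presentation sc P N' (\<lambda>x. coset M (h ` N') (h x)) (quot_mod M (h ` N'))"
proof -
  let ?c = "\<lambda>x. coset M (h ` N') (h x)"
  have eq: "?c x = ?c y \<longleftrightarrow> x - y \<in> N'" if xy: "x \<in> P" "y \<in> P" for x y
  proof
    assume "?c x = ?c y"
    moreover have "h x \<in> ?c x"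
      using coset_h[OF N'P xy(1)] subspace_0[OF sub] by force
    ultimately have "\<exists>n\<in>N'. h x = h (y + n)"
      using coset_h[OF N'P xy(2)] by force
    then obtain n where n: "n \<in> N'" "h x = h (y + n)" by blast
    then have "x - (y + n) \<in> N'"
      using eq_iff[of x "y + n"] xy N'P NN' P_add by blast
    then show "x - y \<in> N'" using subspace_add[OF sub _ n(1)] by fastforce
  next
    have *: "?c x \<subseteq> ?c y" if xy: "x \<in> P" "y \<in> P" and d: "x - y \<in> N'" for x y
    proof
      fix g assume "g \<in> ?c x"
      then obtain n where n: "n \<in> N'" "g = h (x + n)" using coset_h[OF N'P xy(1)] by blast
      then have "g = h (y + ((x - y) + n))" by simp
      moreover have "(x - y) + n \<in> N'" using subspace_add[OF sub d n(1)] .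
      ultimately show "g \<in> ?c y" using coset_h[OF N'P xy(2)] by blast
    qed
    assume d: "x - y \<in> N'"
    then have "y - x \<in> N'" using subspace_neg[OF sub d] by simp
    then show "?c x = ?c y" using * d xy by blast
  qed
  \<comment> \<open>\<open>rep\<close> is an arbitrary choice from the coset, so the quotient
    operations act on some \<open>x'\<close> that agrees with \<open>x\<close> only modulo
    \<open>N'\<close>.\<close>
  have rep: "\<exists>x'\<in>P. rep (?c x) = h x' \<and> x' - x \<in> N'" if x: "x \<in> P" for x
  proof -
    have "h x \<in> ?c x"
      using coset_h[OF N'P x] subspace_0[OF sub] by force
    then have "rep (?c x) \<in> ?c x" unfolding rep_def by (rule someI)
    then obtain n where "n \<in> N'" "rep (?c x) = h (x + n)" using coset_h[OF N'P x] by blast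
    then show ?thesis using N'P P_add x by (intro bexI[of _ "x + n"]) auto
  qed
  show ?thesis
  proof
    show "subspace P" by (rule subspace_P)
    show "subspace N'" by (rule sub)
    show "N' \<subseteq> P" by (rule N'P)
    show "mcarrier (quot_mod M (h ` N')) = ?c ` P" by (auto simp: quot_mod_def carrier)
    show "mzero (quot_mod M (h ` N')) = ?c 0" by (simp add: quot_mod_def zero)
    show "madd (quot_mod M (h ` N')) (?c x) (?c y) = ?c (x + y)" if xy: "x \<in> P" "y \<in> P" for x y
    proof -
      obtain x' where x': "x' \<in> P" "rep (?c x) = h x'" "x' - x \<in> N'" using rep[OF xy(1)] by blast
      obtain y' where y': "y' \<in> P" "rep (?c y) = h y'" "y' - y \<in> N'" using rep[OF xy(2)] by blast
      have "(x' + y') - (x + y) = (x' - x) + (y' - y)" by simp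
      then have "(x' + y') - (x + y) \<in> N'" using subspace_add[OF sub x'(3) y'(3)] by (simp only:)
      then have "?c (x' + y') = ?c (x + y)" using eq[OF P_add[OF x'(1) y'(1)] P_add[OF xy]] by blast
      then show ?thesis using x' y' by (simp add: quot_mod_def add)
    qed
    show "msmul (quot_mod M (h ` N')) r (?c x) = ?c (sc r x)" if x: "x \<in> P" for x r
    proof -
      obtain x' where x': "x' \<in> P" "rep (?c x) = h x'" "x' - x \<in> N'" using rep[OF x] by blast
      have "sc r x' - sc r x \<in> N'"
        using subspace_scale[OF sub x'(3), of r] by (simp add: scale_right_diff_distrib)
      then have "?c (sc r x') = ?c (sc r x)" using eq[OF P_scale[OF x'(1)] P_scale[OF x]] by blast
      then show ?thesis using x' by (simp add: quot_mod_def smul)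
    qed
    show "?c x = ?c y \<longleftrightarrow> x - y \<in> N'" if "x \<in> P" "y \<in> P" for x y
      using eq that by blast
  qed
qed

text \<open>The lift picks a representative of each value, which makes it additive and homogeneous
  only modulo \<open>N'\<close>. The error terms in \<open>nhom\<close> below come from
  here.\<close>

lemma lin_map_lift:
  assumes pres': "presentation sc' P' N' h' M'" and f: "lin_map M M' f"
  obtains \<phi> where "\<And>x. x \<in> P \<Longrightarrow> \<phi> x \<in> P'" "\<And>x. x \<in> P \<Longrightarrow> f (h x) = h' (\<phi> x)"
    "\<And>x y. x \<in> P \<Longrightarrow> y \<in> P \<Longrightarrow> \<phi> (x + y) - (\<phi> x + \<phi> y) \<in> N'"
    "\<And>r x. x \<in> P \<Longrightarrow> \<phi> (sc r x) - sc' r (\<phi> x) \<in> N'"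
    "\<And>x. x \<in> N \<Longrightarrow> \<phi> x \<in> N'"
proof -
  interpret p': presentation sc' P' N' h' M' by (rule pres')
  have "\<exists>y\<in>P'. f (h x) = h' y" if "x \<in> P" for x
    using f that unfolding lin_map_def p'.carrier carrier by blast
  then obtain \<phi> where \<phi>: "\<And>x. x \<in> P \<Longrightarrow> \<phi> x \<in> P'" "\<And>x. x \<in> P \<Longrightarrow> f (h x) = h' (\<phi> x)"
    by metis
  have A: "\<phi> (x + y) - (\<phi> x + \<phi> y) \<in> N'" if xy: "x \<in> P" "y \<in> P" for x y
  proof -
    have "h' (\<phi> (x + y)) = f (madd M (h x) (h y))" using \<phi> add xy P_add by simp
    also have "\<dots> = madd M' (f (h x)) (f (h y))"
      using f xy h_carrier unfolding lin_map_def by blast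
    also have "\<dots> = h' (\<phi> x + \<phi> y)" using \<phi> xy p'.add by simp
    finally show ?thesis
      using p'.eq_iff[OF \<phi>(1)[OF P_add[OF xy]] p'.P_add[OF \<phi>(1)[OF xy(1)] \<phi>(1)[OF xy(2)]]]
      by blast
  qed
  have B: "\<phi> (sc r x) - sc' r (\<phi> x) \<in> N'" if x: "x \<in> P" for x r
  proof -
    have "h' (\<phi> (sc r x)) = f (msmul M r (h x))" using \<phi> smul x P_scale by simp
    also have "\<dots> = msmul M' r (f (h x))"
      using f x h_carrier unfolding lin_map_def by blast
    also have "\<dots> = h' (sc' r (\<phi> x))" using \<phi> x p'.smul by simp
    finally show ?thesis
      using p'.eq_iff[OF \<phi>(1)[OF P_scale[OF x]] p'.P_scale[OF \<phi>(1)[OF x]]] by blast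
  qed
  have C: "\<phi> x \<in> N'" if x: "x \<in> N" for x
  proof -
    have xP: "x \<in> P" using x N_P by blast
    have "h' (\<phi> x) = f (h x)" using \<phi> xP by simp
    also have "h x = h (sc 0 x)" using eq_iff[OF xP P_scale[OF xP], of 0] x by simp
    also have "f (h (sc 0 x)) = h' (\<phi> (sc 0 x))" using \<phi>(2)[OF P_scale[OF xP]] .
    also have "\<dots> = h' (sc' 0 (\<phi> x))"
      using B[OF xP, of 0] p'.eq_iff[OF \<phi>(1)[OF P_scale[OF xP]] p'.P_scale[OF \<phi>(1)[OF xP]]] by blast
    finally have "h' (\<phi> x) = h' 0" by simp
    then show ?thesis using p'.eq_iff[of "\<phi> x" 0] \<phi>[OF xP] p'.P_0 by simp
  qed
  show ?thesis using that \<phi> A B C by blast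
qed

lemma lin_map_of_lift:
  assumes pres': "presentation sc' P' N' h' M'"
    and \<phi>: "\<And>x. x \<in> P \<Longrightarrow> \<phi> x \<in> P'" "\<And>x. x \<in> P \<Longrightarrow> f (h x) = h' (\<phi> x)"
    and add': "\<And>x y. x \<in> P \<Longrightarrow> y \<in> P \<Longrightarrow> \<phi> (x + y) = \<phi> x + \<phi> y"
    and scale': "\<And>r x. x \<in> P \<Longrightarrow> \<phi> (sc r x) = sc' r (\<phi> x)"
  shows "lin_map M M' f"
proof -
  interpret p': presentation sc' P' N' h' M' by (rule pres')
  show ?thesis
    unfolding lin_map_def
    by (auto simp: carrier p'.carrier \<phi> add smul P_add P_scale p'.add p'.smul add' scale')
qed

lemma lin_comb_h:
  assumes "\<And>i. i \<in> set is \<Longrightarrow> e i \<in> P"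
  shows "lin_comb M (\<lambda>i. h (e i)) c is = h (\<Sum>i\<leftarrow>is. sc (c i) (e i))"
    and "(\<Sum>i\<leftarrow>is. sc (c i) (e i)) \<in> P"
  using assms unfolding lin_comb_def
  by (induction "is") (auto simp: zero add smul P_0 P_add P_scale)

end

text \<open>Structure is transported along a map whose fibres are the classes modulo
  \<open>N\<close>, so a module can live on any type large enough to receive those classes.\<close>

lemma presentation_exists:
  assumes "module sc" and P: "module.subspace sc P" and N: "module.subspace sc N" "N \<subseteq> P"
    and eq: "\<And>x y. x \<in> P \<Longrightarrow> y \<in> P \<Longrightarrow> h x = h y \<longleftrightarrow> x - y \<in> N"
  shows "\<exists>M. presentation sc P N h M"
proof -
  interpret module sc by fact
  have inv: "inv_into P h (h x) \<in> P" "inv_into P h (h x) - x \<in> N" if "x \<in> P" for x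
    using that eq[of "inv_into P h (h x)" x] by (auto simp: inv_into_into f_inv_into_f)
  define M where "M = \<lparr>mcarrier = h ` P, madd = (\<lambda>a b. h (inv_into P h a + inv_into P h b)),
     mzero = h 0, msmul = (\<lambda>r a. h (sc r (inv_into P h a)))\<rparr>"
  have "presentation sc P N h M"
  proof
    show "madd M (h x) (h y) = h (x + y)" if xy: "x \<in> P" "y \<in> P" for x y
    proof -
      let ?i = "inv_into P h"
      have "(?i (h x) + ?i (h y)) - (x + y) = (?i (h x) - x) + (?i (h y) - y)" by simp
      then have "(?i (h x) + ?i (h y)) - (x + y) \<in> N"
        using subspace_add[OF N(1) inv(2)[OF xy(1)] inv(2)[OF xy(2)]] by (simp only:)
      then show ?thesis
        using eq[OF subspace_add[OF P inv(1)[OF xy(1)] inv(1)[OF xy(2)]] subspace_add[OF P xy]]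
        by (simp add: M_def)
    qed
    show "msmul M r (h x) = h (sc r x)" if x: "x \<in> P" for x r
    proof -
      have "sc r (inv_into P h (h x)) - sc r x \<in> N"
        using subspace_scale[OF N(1) inv(2)[OF x], of r] by (simp add: scale_right_diff_distrib)
      then show ?thesis
        using eq[OF subspace_scale[OF P inv(1)[OF x]] subspace_scale[OF P x]]
        by (simp add: M_def)
    qed
  qed (use P N eq in \<open>auto simp: M_def\<close>)
  then show ?thesis ..
qed

section \<open>Explicit-carrier modules inside a type-class module\<close>

lemma is_module_simps:
  assumes "is_module M"
  shows "mzero M \<in> mcarrier M"
    and "x \<in> mcarrier M \<Longrightarrow> y \<in> mcarrier M \<Longrightarrow> madd M x y \<in> mcarrier M"
    and "x \<in> mcarrier M \<Longrightarrow> msmul M r x \<in> mcarrier M"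
    and "x \<in> mcarrier M \<Longrightarrow> y \<in> mcarrier M \<Longrightarrow> z \<in> mcarrier M \<Longrightarrow>
      madd M (madd M x y) z = madd M x (madd M y z)"
    and "x \<in> mcarrier M \<Longrightarrow> madd M (mzero M) x = x"
    and "x \<in> mcarrier M \<Longrightarrow> y \<in> mcarrier M \<Longrightarrow>
      msmul M r (madd M x y) = madd M (msmul M r x) (msmul M r y)"
    and "x \<in> mcarrier M \<Longrightarrow> msmul M (r + s) x = madd M (msmul M r x) (msmul M s x)"
    and "x \<in> mcarrier M \<Longrightarrow> msmul M (r * s) x = msmul M r (msmul M s x)"
    and "x \<in> mcarrier M \<Longrightarrow> msmul M 1 x = x"
  by (insert assms[unfolded is_module_def], elim conjE, metis)+

lemma is_module_comm:
  "is_module M \<Longrightarrow> x \<in> mcarrier M \<Longrightarrow> y \<in> mcarrier M \<Longrightarrow> madd M x y = madd M y x"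
  unfolding is_module_def by blast

text \<open>Any explicit-carrier module is a submodule of the product of all modules on its type. The
  product is a type, which makes type-class algebra available for the elements of the module.\<close>

typedef (overloaded) ('r, 'm) modprod =
  "{f :: ('r::comm_ring_1, 'm) rmod \<Rightarrow> 'm. \<forall>M. if is_module M then f M \<in> mcarrier M else f M = undefined}"
  by (rule exI[of _ "\<lambda>M. if is_module M then mzero M else undefined"]) (simp add: is_module_simps)

setup_lifting type_definition_modprod

definition mneg :: "('r::comm_ring_1, 'm) rmod \<Rightarrow> 'm \<Rightarrow> 'm" where
  "mneg M x = (SOME y. y \<in> mcarrier M \<and> madd M x y = mzero M)"

lemma mneg: "is_module M \<Longrightarrow> x \<in> mcarrier M \<Longrightarrow> mneg M x \<in> mcarrier M \<and> madd M x (mneg M x) = mzero M"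
  unfolding mneg_def by (rule someI_ex) (auto simp: is_module_def)

instantiation modprod :: (comm_ring_1, type) ab_group_add
begin

lift_definition zero_modprod :: "('a, 'b) modprod" is
  "\<lambda>M. if is_module M then mzero M else undefined"
  by (simp add: is_module_simps)

lift_definition plus_modprod :: "('a, 'b) modprod \<Rightarrow> ('a, 'b) modprod \<Rightarrow> ('a, 'b) modprod" is
  "\<lambda>f g M. if is_module M then madd M (f M) (g M) else undefined"
  by (simp add: is_module_simps)

lift_definition uminus_modprod :: "('a, 'b) modprod \<Rightarrow> ('a, 'b) modprod" is
  "\<lambda>f M. if is_module M then mneg M (f M) else undefined"
  by (simp add: mneg)

definition minus_modprod :: "('a, 'b) modprod \<Rightarrow> ('a, 'b) modprod \<Rightarrow> ('a, 'b) modprod" where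
  "minus_modprod f g = f + - g"

instance
proof
  fix a b c :: "('a, 'b) modprod"
  show "a + b + c = a + (b + c)"
    by transfer (rule ext, simp add: is_module_simps)
  show ab: "a + b = b + a" for a b :: "('a, 'b) modprod"
    by transfer (rule ext, simp add: is_module_comm)
  show "0 + a = a"
    by transfer (rule ext, simp add: is_module_simps)
  have "a + - a = 0"
    by transfer (rule ext, simp add: mneg)
  then show "- a + a = 0" by (simp add: ab)
  show "a - b = a + - b" by (rule minus_modprod_def)
qed

end

lift_definition modprod_scale :: "'r::comm_ring_1 \<Rightarrow> ('r, 'm) modprod \<Rightarrow> ('r, 'm) modprod" is
  "\<lambda>r f M. if is_module M then msmul M r (f M) else undefined"
  by (simp add: is_module_simps)

lemma module_modprod_scale: "module (modprod_scale :: 'r::comm_ring_1 \<Rightarrow> ('r, 'm) modprod \<Rightarrow> _)"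
proof
  fix a b :: 'r and x y :: "('r, 'm) modprod"
  show "modprod_scale a (x + y) = modprod_scale a x + modprod_scale a y"
    by transfer (rule ext, simp add: is_module_simps)
  show "modprod_scale (a + b) x = modprod_scale a x + modprod_scale b x"
    by transfer (rule ext, simp add: is_module_simps)
  show "modprod_scale a (modprod_scale b x) = modprod_scale (a * b) x"
    by transfer (rule ext, simp add: is_module_simps)
  show "modprod_scale 1 x = x"
    by transfer (rule ext, simp add: is_module_simps)
qed

lemma is_module_presentation:
  assumes "is_module (K :: ('r::comm_ring_1, 'm) rmod)"
  shows "\<exists>P. presentation modprod_scale P {0} (\<lambda>f. Rep_modprod f K) K"
proof -
  interpret module "modprod_scale :: 'r \<Rightarrow> ('r, 'm) modprod \<Rightarrow> _" by (rule module_modprod_scale)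
  \<comment> \<open>The copy of \<open>K\<close> in the product: families that are zero in every
    factor except \<open>K\<close>. Such a family is determined by its value at \<open>K\<close>, so
    the relations are \<open>{0}\<close>.\<close>
  define P where "P = {f :: ('r, 'm) modprod. \<forall>M. M \<noteq> K \<longrightarrow> Rep_modprod f M = Rep_modprod 0 M}"
  have add: "Rep_modprod (f + g) M = (if is_module M then madd M (Rep_modprod f M) (Rep_modprod g M) else undefined)"
    for f g :: "('r, 'm) modprod" and M by transfer simp
  have scale: "Rep_modprod (modprod_scale r f) M = (if is_module M then msmul M r (Rep_modprod f M) else undefined)"
    for f :: "('r, 'm) modprod" and M r by transfer simp
  have zero: "Rep_modprod (0 :: ('r, 'm) modprod) M = (if is_module M then mzero M else undefined)" for M
    by transfer simp
  have mem: "Rep_modprod f K \<in> mcarrier K" for f :: "('r, 'm) modprod"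
    using Rep_modprod[of f] assms by auto
  have sub: "subspace P"
  proof (rule subspaceI)
    show "0 \<in> P" by (simp add: P_def)
    show "f + g \<in> P" if "f \<in> P" "g \<in> P" for f g
    proof -
      have "Rep_modprod (f + g) M = Rep_modprod (0 + 0) M" if "M \<noteq> K" for M
        using \<open>f \<in> P\<close> \<open>g \<in> P\<close> that by (simp only: add P_def mem_Collect_eq) simp
      then show ?thesis by (simp add: P_def)
    qed
    show "modprod_scale r f \<in> P" if "f \<in> P" for r f
    proof -
      have "Rep_modprod (modprod_scale r f) M = Rep_modprod (modprod_scale r 0) M" if "M \<noteq> K" for M
        using \<open>f \<in> P\<close> that by (simp only: scale P_def mem_Collect_eq) simp
      then show ?thesis by (simp add: P_def)
    qed
  qed
  have "presentation modprod_scale P {0} (\<lambda>f. Rep_modprod f K) K"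
  proof
    show "mcarrier K = (\<lambda>f. Rep_modprod f K) ` P"
    proof
      show "(\<lambda>f. Rep_modprod f K) ` P \<subseteq> mcarrier K" using mem by auto
      show "mcarrier K \<subseteq> (\<lambda>f. Rep_modprod f K) ` P"
      proof
        fix k assume k: "k \<in> mcarrier K"
        define g where "g = (Rep_modprod 0)(K := k)"
        have "if is_module M then g M \<in> mcarrier M else g M = undefined" for M
          using zero[of M] is_module_simps(1)[of M] k assms by (auto simp: g_def)
        then have g: "Rep_modprod (Abs_modprod g) = g"
          by (intro Abs_modprod_inverse) simp
        then have "Abs_modprod g \<in> P" by (simp add: P_def g_def)
        moreover have "k = Rep_modprod (Abs_modprod g) K" using g by (simp add: g_def)
        ultimately show "k \<in> (\<lambda>f. Rep_modprod f K) ` P" by blast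
      qed
    qed
    show "Rep_modprod x K = Rep_modprod y K \<longleftrightarrow> x - y \<in> {0}" if "x \<in> P" "y \<in> P" for x y
    proof
      assume "Rep_modprod x K = Rep_modprod y K"
      then have "Rep_modprod x = Rep_modprod y"
        using that by (auto simp: P_def fun_eq_iff) metis
      then show "x - y \<in> {0}" by (simp add: Rep_modprod_inject)
    qed simp
  qed (use sub assms in \<open>auto simp: add scale zero subspace_0\<close>)
  then show ?thesis ..
qed

section \<open>Divisibility in the completion of a module\<close>

context adic_module begin

definition ssc :: "'r \<Rightarrow> (nat \<Rightarrow> 'a) \<Rightarrow> nat \<Rightarrow> 'a" where
  "ssc r x = (\<lambda>n. sc r (x n))"

lemma ssc_apply [simp]: "ssc r x n = sc r (x n)"
  by (simp add: ssc_def)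

lemma module_ssc: "module ssc"
  by standard (auto simp: fun_eq_iff scale_right_distrib scale_left_distrib)

lemma nul_zero: "nul 0"
  by (simp add: nul_def)

lemma nul_plus: "nul x \<Longrightarrow> nul y \<Longrightarrow> nul (x + y)"
  by (simp add: nul_def qA_add)

lemma nul_minus: "nul x \<Longrightarrow> nul y \<Longrightarrow> nul (x - y)"
  by (simp add: nul_def qA_diff)

lemma nul_ssc: "nul x \<Longrightarrow> nul (ssc r x)"
  by (simp add: nul_def qA_scale)

lemma nul_coh: "nul x \<Longrightarrow> coh x"
  unfolding coh_def nul_def by (meson lessI less_imp_le qA_A qA_diff qA_mono)

lemma coh_zero: "coh 0"
  by (intro nul_coh nul_zero)

lemma coh_plus: "coh x \<Longrightarrow> coh y \<Longrightarrow> coh (x + y)"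
  unfolding coh_def using qA_add[of "x (Suc n) - x n" n "y (Suc n) - y n" for n]
  by (simp add: A_add algebra_simps)

lemma coh_ssc: "coh x \<Longrightarrow> coh (ssc r x)"
  unfolding coh_def using qA_scale[of "x (Suc n) - x n" n r for n]
  by (simp add: A_scale scale_right_diff_distrib)

lemma coh_minus: "coh x \<Longrightarrow> coh y \<Longrightarrow> coh (x - y)"
  using coh_plus[OF _ coh_ssc[of y "- 1"], of x] by (simp add: ssc_def fun_diff_def plus_fun_def)

lemma coh_const: "a \<in> A \<Longrightarrow> coh (\<lambda>_. a)"
  by (simp add: coh_def)

lemma coh_wseq: "a \<in> A \<Longrightarrow> coh (\<lambda>n. sc (wseq X n) a)"
  unfolding coh_def using dvd_qA[OF wseq_coherent[OF le_SucI[OF order_refl]], of a]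
  by (simp add: A_scale scale_left_diff_distrib)

text \<open>Reducedness says exactly that \<open>A\<close> embeds into its completion.\<close>

lemma nul_const:
  assumes "a \<in> A" "nul (\<lambda>_. a)" shows "a = 0"
proof (rule reduced_A[OF assms(1)])
  fix s assume "s \<in> S"
  then obtain n where "s dvd q n" using dvd_q by blast
  then obtain c where c: "q n = s * c" by (auto elim: dvdE)
  have "a \<in> qA n" using assms by (simp add: nul_def)
  then obtain b where "b \<in> A" "a = sc (q n) b" unfolding qA_def by blast
  then show "\<exists>y\<in>A. a = sc s y" using c A_scale by (intro bexI[of _ "sc c b"]) auto
qed

text \<open>Torsion-freeness passes to the completion: at an index \<open>m\<close> with
  \<open>t * q n\<close> dividing \<open>q m\<close>, cancelling \<open>t\<close> still leaves
  divisibility by \<open>q n\<close>.\<close>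

lemma nul_cancel:
  assumes "t \<in> S" "coh x" "nul (ssc t x)" shows "nul x"
  unfolding nul_def
proof
  fix n
  obtain m where m: "m \<ge> n" "t * q n dvd q m" using dvd_q[OF mult_S[OF assms(1) q_S]] by blast
  have "sc t (x m) \<in> qA m" using assms(3) by (simp add: nul_def)
  then have "x m \<in> qA n" using cancel_qA[OF assms(1) coh_A[OF assms(2)] m(2)] by blast
  then show "x n \<in> qA n" using coh_qA_iff[OF assms(2) m(1)] by blast
qed

text \<open>Purity of \<open>A\<close> in its completion. At an index with \<open>t\<close> dividing
  \<open>q n\<close> the error in \<open>q n A\<close> is itself a multiple of \<open>t\<close> and
  can be moved into the quotient, which gives \<open>b\<close>.\<close>

lemma coh_divide_const:
  assumes t: "t \<in> S" and x: "coh x" and a: "a \<in> A" and nul: "nul (ssc t x - (\<lambda>_. a))"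
  shows "\<exists>b\<in>A. a = sc t b \<and> nul (x - (\<lambda>_. b))"
proof -
  obtain n where "t dvd q n" using dvd_q[OF t] by blast
  then obtain c where c: "q n = t * c" by (auto elim: dvdE)
  have "sc t (x n) - a \<in> qA n" using nul by (simp add: nul_def)
  then obtain d where d: "d \<in> A" "sc t (x n) - a = sc (q n) d" unfolding qA_def by blast
  define b where "b = x n - sc c d"
  have b: "b \<in> A" unfolding b_def using coh_A[OF x] d A_scale A_diff by blast
  have ab: "a = sc t b"
    using d(2) c by (simp add: b_def scale_right_diff_distrib algebra_simps)
  have "ssc t (x - (\<lambda>_. b)) = ssc t x - (\<lambda>_. a)"
    by (simp add: fun_eq_iff ab scale_right_diff_distrib)
  then have "nul (x - (\<lambda>_. b))"
    using nul_cancel[OF t coh_minus[OF x coh_const[OF b]]] nul by simp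
  then show ?thesis using b ab by blast
qed

text \<open>A single vanishing residue makes the element itself divisible in the completion.
  Continuity of homomorphisms rests on this.\<close>

lemma coh_divide:
  assumes x: "coh x" and n: "x n \<in> qA n"
  shows "\<exists>g. coh g \<and> nul (x - ssc (q n) g)"
proof -
  \<comment> \<open>Division by \<open>q n\<close> loses precision, so the quotient is read off
    along a subsequence \<open>f\<close> with \<open>q n * q m\<close> dividing
    \<open>q (f m)\<close>.\<close>
  have "\<exists>m'\<ge>max m n. q n * q m dvd q m'" for m
    using dvd_q[OF mult_S[OF q_S q_S]] by blast
  then obtain f where f: "\<And>m. f m \<ge> max m n" "\<And>m. q n * q m dvd q (f m)" by metis
  have "x (f m) \<in> qA n" for m using coh_qA_iff[OF x, of n "f m"] n f(1)[of m] by simp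
  then have "\<exists>g\<in>A. x (f m) = sc (q n) g" for m unfolding qA_def by blast
  then obtain g where g: "\<And>m. g m \<in> A" "\<And>m. x (f m) = sc (q n) (g m)" by metis
  have "g (Suc m) - g m \<in> qA m" for m
  proof -
    define l where "l = min (f m) (f (Suc m))"
    have "q n * q m dvd q n * q (Suc m)" by (intro mult_dvd_mono q_dvd_mono) auto
    then have "q n * q m dvd q l" using f(2)[of m] f(2)[of "Suc m"] by (auto simp: l_def min_def intro: dvd_trans)
    moreover have "x (f (Suc m)) - x l \<in> qA l" "x (f m) - x l \<in> qA l"
      using coh_le[OF _ x] by (auto simp: l_def)
    then have "(x (f (Suc m)) - x l) - (x (f m) - x l) \<in> qA l" using qA_diff by blast
    then have "sc (q n) (g (Suc m) - g m) \<in> qA l" by (simp add: g scale_right_diff_distrib)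
    ultimately show ?thesis using cancel_qA[OF q_S A_diff[OF g(1) g(1)]] by blast
  qed
  then have "coh g" using g by (simp add: coh_def)
  moreover have "x m - sc (q n) (g m) \<in> qA m" for m
    using qA_neg[OF coh_le[OF _ x, of m "f m"]] f(1)[of m] by (simp add: g)
  ultimately show ?thesis by (auto simp: nul_def)
qed

end

text \<open>Linear combinations are lists of pairs in which an index may recur, so that
  concatenation adds them; the coefficient of an index then has to be collected.\<close>

definition coef :: "('r::comm_ring_1 \<times> 'j) list \<Rightarrow> 'j \<Rightarrow> 'r" where
  "coef l j = (\<Sum>p\<leftarrow>filter (\<lambda>p. snd p = j) l. fst p)"

lemma coef_Nil [simp]: "coef [] j = 0"
  by (simp add: coef_def)

lemma coef_Cons [simp]: "coef (p # l) j = (if snd p = j then fst p + coef l j else coef l j)"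
  by (simp add: coef_def)

lemma coef_filter: "j \<noteq> i \<Longrightarrow> coef (filter (\<lambda>p. snd p \<noteq> i) l) j = coef l j"
  by (induction l) auto

lemma coef_notin: "l \<in> lists (UNIV \<times> J) \<Longrightarrow> j \<notin> J \<Longrightarrow> coef l j = 0"
  by (induction l) auto

lemma coef_distinct: "distinct is \<Longrightarrow> i \<in> set is \<Longrightarrow> coef (map (\<lambda>i. (c i, i)) is) i = c i"
proof (induction "is")
  case (Cons a "is")
  have "i \<notin> set is \<Longrightarrow> coef (map (\<lambda>i. (c i, i)) is) i = 0" by (rule coef_notin[of _ "set is"]) auto
  then show ?case using Cons by auto
qed simp

lemma coef_map_inj:
  "inj_on f J \<Longrightarrow> l \<in> lists (UNIV \<times> J) \<Longrightarrow> j \<in> J \<Longrightarrow> coef (map (\<lambda>(c, i). (c, f i)) l) (f j) = coef l j"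
  by (induction l) (auto simp: inj_on_eq_iff)

lemma filter_lists: "l \<in> lists (UNIV \<times> J) \<Longrightarrow> filter (\<lambda>p. snd p \<noteq> i) l \<in> lists (UNIV \<times> (J - {i}))"
  by (induction l) auto

lemma (in module) sum_list_split:
  "(\<Sum>(c, j)\<leftarrow>l. scale c (g j)) = scale (coef l i) (g i) + (\<Sum>(c, j)\<leftarrow>filter (\<lambda>p. snd p \<noteq> i) l. scale c (g j))"
  by (induction l) (auto simp: scale_left_distrib algebra_simps)

lemma (in module) sum_list_coef_zero:
  "(\<And>j. coef l j = 0) \<Longrightarrow> (\<Sum>(c, j)\<leftarrow>l. scale c (g j)) = 0"
proof (induction "length l" arbitrary: l rule: less_induct)
  case less
  show ?case
  proof (cases l)
    case (Cons p l')
    \<comment> \<open>All entries with the index of the head go at once; their total coefficient is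
      0, so the sum does not change.\<close>
    let ?l = "filter (\<lambda>p'. snd p' \<noteq> snd p) l"
    have "length ?l < length l" using Cons by (simp add: le_imp_less_Suc)
    moreover have "coef ?l j = 0" for j
    proof (cases "j = snd p")
      case True
      have "coef ?l (snd p) = 0" by (induction l) auto
      then show ?thesis using True by simp
    qed (simp add: coef_filter less.prems)
    ultimately have "(\<Sum>(c, j)\<leftarrow>?l. scale c (g j)) = 0" by (rule less.hyps)
    then show ?thesis using sum_list_split[where l = l and g = g and i = "snd p"] less.prems by simp
  qed simp
qed

section \<open>Independent elements of the completion\<close>

locale adic_kernel = adic_ring S + K: module scale
  for S :: "'r::comm_ring_1 set" and scale :: "'r \<Rightarrow> 'u::ab_group_add \<Rightarrow> 'u" +
  fixes K :: "'u set"
  assumes subspace_K: "K.subspace K"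
    and torsion_free_K: "s \<in> S \<Longrightarrow> x \<in> K \<Longrightarrow> scale s x = 0 \<Longrightarrow> x = 0"
    and reduced_K: "x \<in> K \<Longrightarrow> (\<And>s. s \<in> S \<Longrightarrow> \<exists>y\<in>K. x = scale s y) \<Longrightarrow> x = 0"
    and card_K: "|K| <o |UNIV :: nat set set|"
    and card_R: "|UNIV :: 'r set| <o |UNIV :: nat set set|"
begin

definition psc :: "'r \<Rightarrow> 'u \<times> 'r \<Rightarrow> 'u \<times> 'r" where
  "psc r p = (scale r (fst p), r * snd p)"

lemma psc_simps [simp]: "psc r (k, b) = (scale r k, r * b)" "fst (psc r p) = scale r (fst p)"
    "snd (psc r p) = r * snd p"
  by (simp_all add: psc_def)

lemmas K_0 = K.subspace_0[OF subspace_K]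
lemmas K_add = K.subspace_add[OF subspace_K]
lemmas K_scale = K.subspace_scale[OF subspace_K]

text \<open>The completion of the direct sum of \<open>K\<close> and \<open>R\<close> is the ambient
  module from which \<open>G\<close> will be cut out.\<close>

sublocale adic_module S psc "K \<times> UNIV"
proof (intro adic_module.intro adic_module_axioms.intro)
  show "adic_ring S" by unfold_locales
  show mod: "module psc"
    by standard (auto simp: prod_eq_iff K.scale_right_distrib K.scale_left_distrib algebra_simps)
  interpret module psc by (rule mod)
  show "subspace (K \<times> UNIV)"
    by (rule subspaceI) (auto simp: zero_prod_def K_0 K_add K_scale)
  show "x = 0" if "s \<in> S" "x \<in> K \<times> UNIV" "psc s x = 0" for s x
    using that torsion_free_K torsion_free_ring by (auto simp: prod_eq_iff)
  show "x = 0" if x: "x \<in> K \<times> UNIV" "\<And>s. s \<in> S \<Longrightarrow> \<exists>y\<in>K \<times> UNIV. x = psc s y" for x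
  proof -
    have "fst x = 0"
    proof (rule reduced_K)
      show "\<exists>y\<in>K. fst x = scale s y" if s: "s \<in> S" for s
        using x(2)[OF s] by auto
    qed (use x in auto)
    moreover have "snd x = 0"
    proof (rule reduced_ring)
      show "s dvd snd x" if s: "s \<in> S" for s
        using x(2)[OF s] by auto
    qed
    ultimately show ?thesis by (simp add: prod_eq_iff)
  qed
qed

lemma nul_snd: "nul x \<Longrightarrow> q n dvd snd (x n)"
  by (auto simp: nul_def qA_def dest!: spec[of _ n])

lemma nul_Pair_iff: "nul (\<lambda>n. (0, z n)) \<longleftrightarrow> (\<forall>n. q n dvd z n)"
proof
  show "nul (\<lambda>n. (0, z n)) \<Longrightarrow> \<forall>n. q n dvd z n" using nul_snd by fastforce
  show "nul (\<lambda>n. (0, z n))" if z: "\<forall>n. q n dvd z n"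
    unfolding nul_def
  proof
    fix n
    obtain c where "z n = q n * c" using z by (meson dvdE)
    then show "(0, z n) \<in> qA n" unfolding qA_def using K_0 by (intro image_eqI[of _ _ "(0, c)"]) auto
  qed
qed

definition wsum :: "('j \<Rightarrow> nat set) \<Rightarrow> ('r \<times> 'j) list \<Rightarrow> nat \<Rightarrow> 'r" where
  "wsum W l n = (\<Sum>(c, j)\<leftarrow>l. c * wseq (W j) n)"

definition elem :: "('j \<Rightarrow> nat set) \<Rightarrow> 'u \<Rightarrow> 'r \<Rightarrow> ('r \<times> 'j) list \<Rightarrow> nat \<Rightarrow> 'u \<times> 'r" where
  "elem W k b l = (\<lambda>n. (k, b + wsum W l n))"

text \<open>The direct sum of \<open>K\<close> with the \<open>R\<close>-module generated by 1 and
  the series over \<open>J\<close>. Up to a factor in \<open>S\<close> it contains the values of all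
  homomorphisms to be studied.\<close>

definition Cset :: "('j \<Rightarrow> nat set) \<Rightarrow> 'j set \<Rightarrow> (nat \<Rightarrow> 'u \<times> 'r) set" where
  "Cset W J = {elem W k b l | k b l. k \<in> K \<and> l \<in> lists (UNIV \<times> J)}"

lemma CsetI: "k \<in> K \<Longrightarrow> l \<in> lists (UNIV \<times> J) \<Longrightarrow> elem W k b l \<in> Cset W J"
  by (auto simp: Cset_def)

lemma wsum_simps [simp]: "wsum W [] n = 0" "wsum W ((c, j) # l) n = c * wseq (W j) n + wsum W l n"
    "wsum W (l @ l') n = wsum W l n + wsum W l' n"
  by (simp_all add: wsum_def)

lemma wsum_scale: "wsum W (map (\<lambda>(c, j). (r * c, j)) l) n = r * wsum W l n"
  by (induction l) (auto simp: algebra_simps)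

lemma wsum_cong: "l \<in> lists (UNIV \<times> J) \<Longrightarrow> (\<And>j. j \<in> J \<Longrightarrow> W j = W' j) \<Longrightarrow> wsum W l n = wsum W' l n"
  by (induction l) auto

lemma wsum_split:
  "wsum W l n = coef l i * wseq (W i) n + wsum W (filter (\<lambda>p. snd p \<noteq> i) l) n"
  by (induction l) (auto simp: algebra_simps)

lemma Cset_cong: "(\<And>j. j \<in> J \<Longrightarrow> W j = W' j) \<Longrightarrow> Cset W J = Cset W' J"
  unfolding Cset_def elem_def using wsum_cong[of _ J W W'] by (intro Collect_cong) metis

lemma Cset_plus:
  assumes "x \<in> Cset W J" "y \<in> Cset W J" shows "x + y \<in> Cset W J"
proof -
  obtain k b l k' b' l' where "x = elem W k b l" "k \<in> K" "l \<in> lists (UNIV \<times> J)"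
    "y = elem W k' b' l'" "k' \<in> K" "l' \<in> lists (UNIV \<times> J)"
    using assms unfolding Cset_def by blast
  then show ?thesis
    using CsetI[of "k + k'" "l @ l'" J W "b + b'"] K_add
    by (simp add: elem_def plus_fun_def algebra_simps)
qed

lemma Cset_ssc:
  assumes "x \<in> Cset W J" shows "ssc r x \<in> Cset W J"
proof -
  obtain k b l where x: "x = elem W k b l" "k \<in> K" "l \<in> lists (UNIV \<times> J)"
    using assms unfolding Cset_def by blast
  then have "map (\<lambda>(c, j). (r * c, j)) l \<in> lists (UNIV \<times> J)" by auto
  then show ?thesis
    using CsetI[of "scale r k" "map (\<lambda>(c, j). (r * c, j)) l" J W "r * b"] K_scale x
    by (simp add: elem_def ssc_def wsum_scale distrib_left)
qed

lemma Cset_minus: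
  assumes "x \<in> Cset W J" "y \<in> Cset W J" shows "x - y \<in> Cset W J"
proof -
  have "x - y = x + ssc (- 1) y" by (auto simp: fun_eq_iff prod_eq_iff)
  then show ?thesis using Cset_plus[OF assms(1) Cset_ssc[OF assms(2), of "- 1"]] by (simp only:)
qed

lemma Cset_const: "k \<in> K \<Longrightarrow> (\<lambda>_. (k, b)) \<in> Cset W J"
  using CsetI[of k "[]" J W b] by (simp add: elem_def)

lemma Cset_wseq: "j \<in> J \<Longrightarrow> (\<lambda>n. (0, wseq (W j) n)) \<in> Cset W J"
  using CsetI[of 0 "[(1, j)]" J W 0] by (simp add: elem_def K_0)

lemma Cset_coh: "x \<in> Cset W J \<Longrightarrow> coh x"
proof -
  have wsum: "q n dvd wsum W l (Suc n) - wsum W l n" for l n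
  proof (induction l)
    case (Cons p l)
    obtain c j where p: "p = (c, j)" by fastforce
    have "wsum W (p # l) (Suc n) - wsum W (p # l) n
      = c * (wseq (W j) (Suc n) - wseq (W j) n) + (wsum W l (Suc n) - wsum W l n)"
      by (simp add: p algebra_simps)
    then show ?case using Cons wseq_coherent[of n "Suc n" "W j"] by (metis dvd_add dvd_mult le_SucI order_refl)
  qed simp
  show "coh x" if "x \<in> Cset W J"
  proof -
    obtain k b l where x: "x = elem W k b l" "k \<in> K" using \<open>x \<in> Cset W J\<close> unfolding Cset_def by blast
    have "nul (\<lambda>n. (0, wsum W l (Suc n) - wsum W l n))" using wsum by (simp add: nul_Pair_iff)
    then show ?thesis using x by (simp add: coh_def elem_def nul_def)
  qed
qed

lemma card_parameters:
  assumes inf: "infinite Z" and "|K| \<le>o |Z|" "|UNIV :: 'r set| \<le>o |Z|" "|J| \<le>o |Z|"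
  shows "|K \<times> (UNIV :: 'r set) \<times> lists ((UNIV :: 'r set) \<times> J)| \<le>o |Z|"
  using assms
  by (intro card_of_Times_ordLeq_infinite_Field card_of_lists_ordLeq_infinite)
    (simp_all add: card_of_card_order_on Field_card_of)

lemma card_Cset:
  assumes J: "|J| <o |UNIV :: nat set set|"
  shows "|Cset W J| <o |UNIV :: nat set set|"
proof -
  define Z where "Z = K <+> ((UNIV :: 'r set) <+> J)"
  have Z: "|Z| <o |UNIV :: nat set set|"
    unfolding Z_def using card_K card_R J
    by (intro card_of_Plus_ordLess_infinite[OF infinite_UNIV_nat_set])
  have "Cset W J \<subseteq> (\<lambda>(k, b, l). elem W k b l) ` (K \<times> UNIV \<times> lists (UNIV \<times> J))"
    by (force simp: Cset_def)
  then have "|Cset W J| \<le>o |K \<times> (UNIV :: 'r set) \<times> lists ((UNIV :: 'r set) \<times> J)|"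
    by (meson card_of_image card_of_mono1 ordLeq_transitive)
  moreover have "|K \<times> (UNIV :: 'r set) \<times> lists ((UNIV :: 'r set) \<times> J)| \<le>o |Z|"
  proof (rule card_parameters)
    show "infinite Z" unfolding Z_def using infinite_UNIV_R by simp
    show "|K| \<le>o |Z|" "|UNIV :: 'r set| \<le>o |Z|" "|J| \<le>o |Z|"
      unfolding Z_def by (meson card_of_Plus1 card_of_Plus2 ordLeq_transitive)+
  qed
  ultimately show ?thesis using Z ordLeq_ordLess_trans ordLeq_transitive by blast
qed

text \<open>Transcendence of the series over \<open>C\<close>, truncated at degree two.\<close>

definition generic :: "nat set \<Rightarrow> (nat \<Rightarrow> 'u \<times> 'r) set \<Rightarrow> bool" where
  "generic X C \<longleftrightarrow> (\<forall>x\<in>C. \<forall>y\<in>C. \<forall>z\<in>C.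
     nul (\<lambda>n. psc (wseq X n * wseq X n) (x n) + psc (wseq X n) (y n) + z n) \<longrightarrow> nul x \<and> nul y)"

lemma genericD:
  assumes "generic X C" "x \<in> C" "y \<in> C" "z \<in> C"
    and "nul (\<lambda>n. psc (wseq X n * wseq X n) (x n) + psc (wseq X n) (y n) + z n)"
  shows "nul x" "nul y"
  using assms unfolding generic_def by blast+

lemma exists_generic_Cset:
  assumes "|J| <o |UNIV :: nat set set|"
  shows "\<exists>X. generic X (Cset W J)"
  using exists_generic[of "Cset W J \<times> Cset W J \<times> Cset W J"] card_Cset[OF assms] Cset_coh
  unfolding generic_def by (fastforce intro: card_of_Times_ordLess_nat_set)

text \<open>Linear independence of 1 and the series: once the \<open>coef\<close> vanish,
  \<open>b\<close> vanishes by reducedness of the ring.\<close>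

definition indep :: "('j \<Rightarrow> nat set) \<Rightarrow> 'j set \<Rightarrow> bool" where
  "indep W J \<longleftrightarrow> (\<forall>b. \<forall>l\<in>lists (UNIV \<times> J). (\<forall>n. q n dvd b + wsum W l n) \<longrightarrow> (\<forall>j. coef l j = 0))"

lemma nul_const_ring: "nul (\<lambda>_. (0, b)) \<Longrightarrow> b = 0"
  using nul_const[of "(0, b)"] K_0 by (simp add: zero_prod_def)

text \<open>Splitting off the terms with index \<open>i\<close> gives a relation for the series of
  \<open>i\<close> whose quadratic coefficient is zero, so genericity kills
  \<open>coef l i\<close>.\<close>

lemma indep_insert:
  assumes ind: "indep W J" and gen: "generic (W i) (Cset W J)" and i: "i \<notin> J"
  shows "indep W (insert i J)"
  unfolding indep_def
proof (intro allI ballI impI)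
  fix b l j assume l: "l \<in> lists (UNIV \<times> insert i J)" and dvd: "\<forall>n. q n dvd b + wsum W l n"
  let ?l = "filter (\<lambda>p. snd p \<noteq> i) l"
  have l': "?l \<in> lists (UNIV \<times> J)" using filter_lists[OF l, of i] i by (auto simp: in_lists_conv_set)
  have "nul (\<lambda>n. (0, b + wsum W l n))" using dvd by (simp add: nul_Pair_iff)
  moreover have "(0, b + wsum W l n) = psc (wseq (W i) n * wseq (W i) n) (0, 0)
      + psc (wseq (W i) n) (0, coef l i) + elem W 0 b ?l n" for n
    using wsum_split[of W l n i] by (simp add: elem_def algebra_simps)
  ultimately have "nul (\<lambda>n. psc (wseq (W i) n * wseq (W i) n) (0, 0)
      + psc (wseq (W i) n) (0, coef l i) + elem W 0 b ?l n)" by simp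
  then have "nul (\<lambda>_. (0, coef l i))"
    by (rule genericD(2)[OF gen Cset_const[OF K_0] Cset_const[OF K_0] CsetI[OF K_0 l']])
  then have ci: "coef l i = 0" by (rule nul_const_ring)
  then have "\<forall>n. q n dvd b + wsum W ?l n" using dvd wsum_split[of W l _ i] by simp
  then have "coef ?l j = 0" using ind l' unfolding indep_def by blast
  then show "coef l j = 0" using ci coef_filter by metis
qed

text \<open>Zorn's lemma is applied to sets of subsets of the naturals, each serving as its own
  index. By genericity a maximal independent one is not smaller than the continuum, so
  \<open>J\<close> embeds into it.\<close>

lemma exists_indep:
  fixes J :: "'j set"
  assumes J: "|J| <o |UNIV :: nat set set|"
  shows "\<exists>W. indep W J"
proof -
  define \<A> where "\<A> = {B :: nat set set. indep (\<lambda>X. X) B}"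
  have "\<exists>B\<in>\<A>. \<forall>X\<in>\<A>. B \<subseteq> X \<longrightarrow> X = B"
  proof (rule subset_Zorn')
    fix \<C> assume C: "subset.chain \<A> \<C>"
    show "\<Union>\<C> \<in> \<A>"
      unfolding \<A>_def indep_def mem_Collect_eq
    proof (intro allI ballI impI)
      fix b l j assume l: "l \<in> lists (UNIV \<times> \<Union>\<C>)" and dvd: "\<forall>n. q n dvd b + wsum (\<lambda>X. X) l n"
      show "coef l j = 0"
      proof (cases "\<C> = {}")
        case True
        then show ?thesis using l by (cases l) auto
      next
        case False
        have "snd ` set l \<subseteq> \<Union>\<C>" using l by (fastforce simp: in_lists_conv_set)
        then obtain B where B: "B \<in> \<C>" "snd ` set l \<subseteq> B"
          using finite_subset_Union_chain[OF _ _ False C, of "snd ` set l"] by blast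
        then have "l \<in> lists (UNIV \<times> B)" by (fastforce simp: in_lists_conv_set)
        moreover have "indep (\<lambda>X. X) B" using B C by (auto simp: \<A>_def subset.chain_def)
        ultimately show ?thesis using dvd unfolding indep_def by blast
      qed
    qed
  qed
  then obtain B where B: "indep (\<lambda>X. X) B" and max: "\<And>X. indep (\<lambda>X. X) X \<Longrightarrow> B \<subseteq> X \<Longrightarrow> X = B"
    unfolding \<A>_def by blast
  have "\<not> |B| <o |UNIV :: nat set set|"
  proof
    assume "|B| <o |UNIV :: nat set set|"
    then obtain X where X: "generic X (Cset (\<lambda>X. X) B)" using exists_generic_Cset by blast
    \<comment> \<open>Otherwise \<open>w - w = 0\<close> would be a nontrivial relation for the
      series \<open>w\<close> of \<open>X\<close> over a module containing \<open>w\<close>.\<close>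
    have "X \<notin> B"
    proof
      assume "X \<in> B"
      then have "ssc (- 1) (\<lambda>n. (0, wseq X n)) \<in> Cset (\<lambda>X. X) B" 
        using Cset_ssc[OF Cset_wseq[of X B "\<lambda>X. X"]] by simp
      moreover have "nul (\<lambda>n. psc (wseq X n * wseq X n) (0, 0) + psc (wseq X n) (0, 1)
        + ssc (- 1) (\<lambda>n. (0, wseq X n)) n)"
        by (simp add: nul_def zero_prod_def[symmetric])
      ultimately have "nul (\<lambda>_. (0, 1))"
        by (rule genericD(2)[OF X Cset_const[OF K_0] Cset_const[OF K_0]])
      then show False using nul_const_ring[of 1] by simp
    qed
    moreover from this have "indep (\<lambda>X. X) (insert X B)" using indep_insert[OF B X] by simp
    then have "insert X B = B" using max[of "insert X B"] by blast
    ultimately show False by blast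
  qed
  then have "|UNIV :: nat set set| \<le>o |B|"
    using not_ordLess_iff_ordLeq card_of_Well_order by blast
  then have "|J| \<le>o |B|" using J ordLess_imp_ordLeq ordLeq_transitive by blast
  then obtain f where f: "inj_on f J" "f ` J \<subseteq> B" using card_of_ordLeq[of J B] by blast
  have "indep f J"
    unfolding indep_def
  proof (intro allI ballI impI)
    fix b l j assume l: "l \<in> lists (UNIV \<times> J)" and dvd: "\<forall>n. q n dvd b + wsum f l n"
    let ?l = "map (\<lambda>(c, i). (c, f i)) l"
    have "?l \<in> lists (UNIV \<times> B)" using l f(2) by (fastforce simp: in_lists_conv_set)
    moreover have "wsum (\<lambda>X. X) ?l n = wsum f l n" for n by (induction l) auto
    ultimately have "coef ?l (f j) = 0" using B dvd unfolding indep_def by simp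
    then show "coef l j = 0" using coef_map_inj[OF f(1) l] coef_notin[OF l] by (cases "j \<in> J") auto
  qed
  then show ?thesis by blast
qed

text \<open>One series is made generic to degree two over the others, which are merely linearly
  independent.\<close>

lemma exists_family:
  fixes J :: "'j set"
  assumes J: "|J| <o |UNIV :: nat set set|" and i: "i \<in> J"
  shows "\<exists>W. indep W J \<and> generic (W i) (Cset W (J - {i}))"
proof -
  have J': "|J - {i}| <o |UNIV :: nat set set|"
    using J card_of_mono1[of "J - {i}" J] ordLeq_ordLess_trans by blast
  obtain W where W: "indep W (J - {i})" using exists_indep[OF J'] by blast
  obtain X where X: "generic X (Cset W (J - {i}))" using exists_generic_Cset[OF J'] by blast
  let ?W = "W(i := X)"
  have "Cset ?W (J - {i}) = Cset W (J - {i})" by (rule Cset_cong) auto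
  then have gen: "generic (?W i) (Cset ?W (J - {i}))" using X by simp
  have "wsum ?W l n = wsum W l n" if "l \<in> lists (UNIV \<times> (J - {i}))" for l n
    using that by (rule wsum_cong) auto
  then have "indep ?W (J - {i})" using W unfolding indep_def by simp
  then have "indep ?W (insert i (J - {i}))" using gen by (rule indep_insert) simp
  moreover have "insert i (J - {i}) = J" using i by blast
  ultimately show ?thesis using gen by metis
qed

text \<open>The relation is the image under a homomorphism of \<open>v j = y e + w u\<close> with
  denominators cleared. As \<open>\<beta>\<close> is multiplied by the series of \<open>j\<close>,
  the term free of \<open>Y\<close> varies with \<open>j\<close> too.\<close>

lemma exists_linear_generic:
  assumes J: "|J| <o |UNIV :: nat set set|"
  shows "\<exists>Y. \<forall>\<alpha>\<in>Cset W J. \<forall>\<beta>\<in>Cset W J. \<forall>z\<in>Cset W J. \<forall>j\<in>J.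
    nul (\<lambda>n. psc (wseq Y n) (\<alpha> n) + (psc (wseq (W j) n) (\<beta> n) - z n)) \<longrightarrow> nul \<alpha>"
proof -
  define f where "f = (\<lambda>(\<alpha>, \<beta>, z, j). (0 :: nat \<Rightarrow> 'u \<times> 'r, \<alpha> :: nat \<Rightarrow> 'u \<times> 'r,
    (\<lambda>n. psc (wseq (W j) n) (\<beta> n) - z n) :: nat \<Rightarrow> 'u \<times> 'r))"
  let ?D = "f ` (Cset W J \<times> Cset W J \<times> Cset W J \<times> J)"
  have "|?D| <o |UNIV :: nat set set|"
    by (rule ordLeq_ordLess_trans[OF card_of_image]) (intro card_of_Times_ordLess_nat_set card_Cset J)
  moreover have "coh x \<and> coh y" if "(x, y, z) \<in> ?D" for x y z
    using that coh_zero by (auto simp: f_def dest: Cset_coh)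
  ultimately obtain Y where Y: "\<forall>(x, y, z)\<in>?D. nul (\<lambda>n. psc (wseq Y n * wseq Y n) (x n) + psc (wseq Y n) (y n) + z n)
            \<longrightarrow> nul x \<and> nul y"
    using exists_generic[of ?D] by blast
  show ?thesis
  proof (intro exI[of _ Y] ballI impI)
    fix \<alpha> \<beta> z j
    assume m: "\<alpha> \<in> Cset W J" "\<beta> \<in> Cset W J" "z \<in> Cset W J" "j \<in> J"
      and nul: "nul (\<lambda>n. psc (wseq Y n) (\<alpha> n) + (psc (wseq (W j) n) (\<beta> n) - z n))"
    have "f (\<alpha>, \<beta>, z, j) \<in> ?D" using m by blast
    from bspec[OF Y this] nul show "nul \<alpha>" by (simp add: f_def)
  qed
qed

end

section \<open>The construction\<close>

text \<open>The \<open>e i\<close> generate \<open>K\<close> up to torsion, which admits an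
  enumeration of all of \<open>K\<close>. \<open>ib\<close> tells which \<open>e i\<close> occurs in
  \<open>v j\<close>; its surjectivity lets the relations for the \<open>v j\<close> reach every
  \<open>e i\<close>.\<close>

locale cellular_construction = adic_kernel S scale K
  for S :: "'r::comm_ring_1 set" and scale :: "'r \<Rightarrow> 'u::ab_group_add \<Rightarrow> 'u" and K :: "'u set" +
  fixes I :: "'i set" and e :: "'i \<Rightarrow> 'u" and J :: "'j set" and ib :: "'j \<Rightarrow> 'i" and j0 :: 'j
    and W :: "'j \<Rightarrow> nat set" and Y :: "nat set"
  assumes e_K: "i \<in> I \<Longrightarrow> e i \<in> K"
    and e_gen: "k \<in> K \<Longrightarrow> \<exists>t\<in>S. \<exists>l\<in>lists (UNIV \<times> I). scale t k = (\<Sum>(c, i)\<leftarrow>l. scale c (e i))"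
    and ib_I: "j \<in> J \<Longrightarrow> ib j \<in> I"
    and ib_surj: "i \<in> I \<Longrightarrow> \<exists>j\<in>J. ib j = i"
    and j0: "j0 \<in> J"
    and indep_W: "indep W J"
    and generic_W: "generic (W j0) (Cset W (J - {j0}))"
    and generic_Y: "\<alpha> \<in> Cset W J \<Longrightarrow> \<beta> \<in> Cset W J \<Longrightarrow> z \<in> Cset W J \<Longrightarrow> j \<in> J \<Longrightarrow>
      nul (\<lambda>n. psc (wseq Y n) (\<alpha> n) + (psc (wseq (W j) n) (\<beta> n) - z n)) \<Longrightarrow> nul \<alpha>"
begin

sublocale seq: module ssc
  by (rule module_ssc)

abbreviation E :: "'i \<Rightarrow> nat \<Rightarrow> 'u \<times> 'r" where
  "E i \<equiv> \<lambda>_. (e i, 0)"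

abbreviation U :: "nat \<Rightarrow> 'u \<times> 'r" where
  "U \<equiv> \<lambda>_. (0, 1)"

definition v :: "'j \<Rightarrow> nat \<Rightarrow> 'u \<times> 'r" where
  "v j = (\<lambda>n. (scale (wseq Y n) (e (ib j)), wseq (W j) n))"

definition vsum :: "('r \<times> 'j) list \<Rightarrow> nat \<Rightarrow> 'u \<times> 'r" where
  "vsum l = (\<Sum>(c, j)\<leftarrow>l. ssc c (v j))"

definition lc :: "'u \<times> 'r \<Rightarrow> ('r \<times> 'j) list \<Rightarrow> nat \<Rightarrow> 'u \<times> 'r" where
  "lc a l = (\<lambda>_. a) + vsum l"

text \<open>\<open>G\<close> is \<open>P\<close> modulo null sequences; the denominator
  \<open>t\<close> makes it the pure closure of the submodule generated by \<open>K\<close>,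
  \<open>U\<close> and the \<open>v j\<close>.\<close>

definition P :: "(nat \<Rightarrow> 'u \<times> 'r) set" where
  "P = {x. coh x \<and> (\<exists>t\<in>S. \<exists>a\<in>K \<times> UNIV. \<exists>l\<in>lists (UNIV \<times> J). nul (ssc t x - lc a l))}"

lemma vsum_simps [simp]: "vsum [] = 0" "vsum ((c, j) # l) = ssc c (v j) + vsum l"
    "vsum (l @ l') = vsum l + vsum l'"
  by (simp_all add: vsum_def)

lemma vsum_scale: "vsum (map (\<lambda>(c, j). (r * c, j)) l) = ssc r (vsum l)"
proof (induction l)
  case (Cons p l)
  then show ?case
    by (cases p) (simp add: seq.scale_right_distrib[of r "ssc (fst p) (v (snd p))" "vsum l"] fun_eq_iff scale_right_distrib)
qed (simp add: fun_eq_iff)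

lemma snd_vsum: "snd (vsum l n) = wsum W l n"
  by (induction l) (auto simp: v_def)

lemma lc_plus: "lc a l + lc a' l' = lc (a + a') (l @ l')"
  by (simp add: lc_def fun_eq_iff)

lemma lc_scale: "ssc r (lc a l) = lc (psc r a) (map (\<lambda>(c, j). (r * c, j)) l)"
  unfolding lc_def vsum_scale seq.scale_right_distrib by (simp add: ssc_def)

lemma v_coh: "j \<in> J \<Longrightarrow> coh (v j)"
proof -
  assume "j \<in> J"
  then have "coh ((\<lambda>n. psc (wseq Y n) (e (ib j), 0)) + (\<lambda>n. psc (wseq (W j) n) (0, 1)))"
    using e_K ib_I K_0 by (intro coh_plus coh_wseq) auto
  then show ?thesis by (simp add: v_def plus_fun_def)
qed

lemma P_coh: "x \<in> P \<Longrightarrow> coh x"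
  by (simp add: P_def)

lemma P_I:
  "coh x \<Longrightarrow> t \<in> S \<Longrightarrow> a \<in> K \<times> UNIV \<Longrightarrow> l \<in> lists (UNIV \<times> J) \<Longrightarrow> nul (ssc t x - lc a l) \<Longrightarrow> x \<in> P"
  unfolding P_def by blast

lemma P_E:
  assumes "x \<in> P"
  obtains t a l where "t \<in> S" "a \<in> K \<times> UNIV" "l \<in> lists (UNIV \<times> J)" "nul (ssc t x - lc a l)"
  using assms unfolding P_def by blast

lemma map_scale_lists: "l \<in> lists (UNIV \<times> J) \<Longrightarrow> map (\<lambda>(c, j). (r * c, j)) l \<in> lists (UNIV \<times> J)"
  by (induction l) auto

lemma P_add:
  assumes "x \<in> P" "y \<in> P" shows "x + y \<in> P"
proof -
  obtain t a l where x: "t \<in> S" "a \<in> K \<times> UNIV" "l \<in> lists (UNIV \<times> J)" "nul (ssc t x - lc a l)"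
    using assms(1) by (rule P_E)
  obtain t' a' l' where y: "t' \<in> S" "a' \<in> K \<times> UNIV" "l' \<in> lists (UNIV \<times> J)" "nul (ssc t' y - lc a' l')"
    using assms(2) by (rule P_E)
  let ?l = "map (\<lambda>(c, j). (t' * c, j)) l @ map (\<lambda>(c, j). (t * c, j)) l'"
  have "ssc (t * t') (x + y) - lc (psc t' a + psc t a') ?l
    = ssc t' (ssc t x - lc a l) + ssc t (ssc t' y - lc a' l')"
    unfolding lc_plus[symmetric] lc_scale[symmetric] by (simp add: algebra_simps)
  moreover have "nul (ssc t' (ssc t x - lc a l) + ssc t (ssc t' y - lc a' l'))"
    using x y by (intro nul_plus nul_ssc)
  moreover have "?l \<in> lists (UNIV \<times> J)" 
    using map_scale_lists[OF x(3), of t'] map_scale_lists[OF y(3), of t]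
    by (simp only: append_in_lists_conv simp_thms)
  ultimately show ?thesis
    using P_I[OF coh_plus[OF P_coh[OF assms(1)] P_coh[OF assms(2)]] mult_S[OF x(1) y(1)]
        A_add[OF A_scale[OF x(2), of t'] A_scale[OF y(2), of t]], of ?l]
    by (simp only:)
qed

lemma P_ssc:
  assumes "x \<in> P" shows "ssc r x \<in> P"
proof -
  obtain t a l where x: "t \<in> S" "a \<in> K \<times> UNIV" "l \<in> lists (UNIV \<times> J)" "nul (ssc t x - lc a l)"
    using assms(1) by (rule P_E)
  let ?l = "map (\<lambda>(c, j). (r * c, j)) l"
  have "ssc t (ssc r x) - lc (psc r a) ?l = ssc r (ssc t x - lc a l)"
    unfolding lc_scale[symmetric] by (simp add: algebra_simps)
  then have "nul (ssc t (ssc r x) - lc (psc r a) ?l)" using nul_ssc[OF x(4), of r] by simp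
  then show ?thesis
    using coh_ssc[OF P_coh[OF assms]] x(1) A_scale[OF x(2)] map_scale_lists[OF x(3)] by (intro P_I)
qed

lemma P_const: "a \<in> K \<times> UNIV \<Longrightarrow> (\<lambda>_. a) \<in> P"
  by (rule P_I[of _ 1 a "[]"]) (auto intro: coh_const one_S simp: lc_def nul_zero)

lemma P_v: "j \<in> J \<Longrightarrow> v j \<in> P"
proof (rule P_I[of _ 1 0 "[(1, j)]"])
  have "ssc 1 (v j) - lc 0 [(1, j)] = 0" by (simp add: lc_def fun_eq_iff)
  then show "nul (ssc 1 (v j) - lc 0 [(1, j)])" using nul_zero by simp
qed (auto intro: v_coh one_S simp: K_0 zero_prod_def)

lemma nul_P: "nul x \<Longrightarrow> x \<in> P"
  using P_I[OF nul_coh one_S A_0 lists.Nil, of x] by (simp add: lc_def zero_fun_def[symmetric])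

lemma subspace_P: "seq.subspace P"
  by (rule seq.subspaceI) (auto simp del: plus_fun_apply intro: P_add P_ssc nul_P nul_zero)

lemma subspace_nul: "seq.subspace {x. nul x}"
  by (rule seq.subspaceI) (auto simp del: plus_fun_apply intro: nul_plus nul_ssc nul_zero)

lemma P_minus: "x \<in> P \<Longrightarrow> y \<in> P \<Longrightarrow> x - y \<in> P"
  by (rule seq.subspace_diff[OF subspace_P])

lemma P_E_I: "i \<in> I \<Longrightarrow> E i \<in> P"
  using e_K by (intro P_const) auto

lemma P_U: "U \<in> P"
  using K_0 by (intro P_const) auto

text \<open>Purity in the form that continuity uses: a quotient by an element of \<open>S\<close>
  stays in the domain of the homomorphisms.\<close>

lemma P_cancel:
  assumes "x \<in> P" "coh g" "t \<in> S" "nul (x - ssc t g)"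
  shows "g \<in> P"
proof -
  obtain s a l where x: "s \<in> S" "a \<in> K \<times> UNIV" "l \<in> lists (UNIV \<times> J)" "nul (ssc s x - lc a l)"
    using assms(1) by (rule P_E)
  have "ssc (s * t) g - lc a l = (ssc s x - lc a l) - ssc s (x - ssc t g)"
    by (simp add: algebra_simps)
  moreover have "nul ((ssc s x - lc a l) - ssc s (x - ssc t g))"
    by (rule nul_minus[OF x(4) nul_ssc[OF assms(4)]])
  ultimately show ?thesis using P_I[OF assms(2) mult_S[OF x(1) assms(3)] x(2,3)] by (simp only:)
qed

text \<open>Lifts of homomorphisms from \<open>G\<close> into the whole completion. Maps into
  \<open>K\<close>, maps into \<open>G/K\<close> followed by \<open>prj 1\<close>, and differences
  of endomorphisms all have this form.\<close>

definition nhom :: "((nat \<Rightarrow> 'u \<times> 'r) \<Rightarrow> nat \<Rightarrow> 'u \<times> 'r) \<Rightarrow> bool" where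
  "nhom \<phi> \<longleftrightarrow> (\<forall>x\<in>P. coh (\<phi> x)) \<and>
     (\<forall>x\<in>P. \<forall>y\<in>P. nul (\<phi> (x + y) - (\<phi> x + \<phi> y))) \<and>
     (\<forall>r. \<forall>x\<in>P. nul (\<phi> (ssc r x) - ssc r (\<phi> x))) \<and>
     (\<forall>x. nul x \<longrightarrow> nul (\<phi> x))"

context
  fixes \<phi> assumes \<phi>: "nhom \<phi>"
begin

lemma nhom_coh: "x \<in> P \<Longrightarrow> coh (\<phi> x)"
  and nhom_add: "x \<in> P \<Longrightarrow> y \<in> P \<Longrightarrow> nul (\<phi> (x + y) - (\<phi> x + \<phi> y))"
  and nhom_scale: "x \<in> P \<Longrightarrow> nul (\<phi> (ssc r x) - ssc r (\<phi> x))"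
  and nhom_nul: "nul x \<Longrightarrow> nul (\<phi> x)"
  using \<phi> unfolding nhom_def by blast+

lemma nhom_axpy:
  assumes "x \<in> P" "y \<in> P" shows "nul (\<phi> (ssc r x + y) - (ssc r (\<phi> x) + \<phi> y))"
proof -
  have "\<phi> (ssc r x + y) - (ssc r (\<phi> x) + \<phi> y)
    = (\<phi> (ssc r x + y) - (\<phi> (ssc r x) + \<phi> y)) + (\<phi> (ssc r x) - ssc r (\<phi> x))"
    by (simp add: algebra_simps)
  then show ?thesis
    using nul_plus[OF nhom_add[OF P_ssc[OF assms(1)] assms(2)] nhom_scale[OF assms(1)]]
    by (simp only:)
qed

lemma nhom_zero_axpy:
  assumes "x \<in> P" "y \<in> P" "nul (\<phi> x)" "nul (\<phi> y)" shows "nul (\<phi> (ssc r x + y))"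
  using nul_plus[OF nhom_axpy[OF assms(1,2), of r] nul_plus[OF nul_ssc[OF assms(3)] assms(4)], of r]
  by simp

lemma nhom_zero_cong:
  assumes "x \<in> P" "y \<in> P" "nul (x - y)" "nul (\<phi> y)" shows "nul (\<phi> x)"
  using nhom_zero_axpy[OF assms(2) P_minus[OF assms(1,2)] assms(4) nhom_nul[OF assms(3)], of 1]
  by simp

lemma nhom_zero_cancel:
  assumes "x \<in> P" "t \<in> S" "nul (\<phi> (ssc t x))" shows "nul (\<phi> x)"
  using nul_cancel[OF assms(2) nhom_coh[OF assms(1)]] nul_minus[OF assms(3) nhom_scale[OF assms(1)], of t]
  by simp

text \<open>Denominators occur twice, in generating \<open>K\<close> by the \<open>e i\<close> and
  in the definition of \<open>P\<close>; both are cancelled among the values, which lie in a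
  torsion-free module.\<close>

lemma nhom_zeroI:
  assumes E: "\<And>i. i \<in> I \<Longrightarrow> nul (\<phi> (E i))" and U: "nul (\<phi> U)"
    and v: "\<And>j. j \<in> J \<Longrightarrow> nul (\<phi> (v j))" and x: "x \<in> P"
  shows "nul (\<phi> x)"
proof -
  have zero: "nul (\<phi> 0)" by (rule nhom_nul[OF nul_zero])
  have k: "nul (\<phi> (\<lambda>_. (k, 0)))" if "k \<in> K" for k
  proof -
    obtain t l where t: "t \<in> S" "l \<in> lists (UNIV \<times> I)" "scale t k = (\<Sum>(c, i)\<leftarrow>l. scale c (e i))"
      using e_gen[OF \<open>k \<in> K\<close>] by blast
    have "(\<Sum>(c, i)\<leftarrow>l. scale c (e i)) \<in> K \<and> nul (\<phi> (\<lambda>_. (\<Sum>(c, i)\<leftarrow>l. scale c (e i), 0)))"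
      using t(2)
    proof (induction l)
      case Nil
      then show ?case using zero K_0 by (simp add: zero_fun_def zero_prod_def)
    next
      case (Cons p l)
      obtain c i where p: "p = (c, i)" "i \<in> I" using Cons by auto
      let ?k = "\<Sum>(c, i)\<leftarrow>l. scale c (e i)"
      have "(\<lambda>_. (\<Sum>(c, i)\<leftarrow>p # l. scale c (e i), 0)) = ssc c (E i) + (\<lambda>_. (?k, 0))"
        by (simp add: p fun_eq_iff)
      moreover have "nul (\<phi> (ssc c (E i) + (\<lambda>_. (?k, 0))))"
        using Cons p(2) by (intro nhom_zero_axpy[OF P_E_I P_const E]) auto
      moreover have "(\<Sum>(c, i)\<leftarrow>p # l. scale c (e i)) \<in> K"
        using Cons p K_add K_scale e_K by auto
      ultimately show ?case by simp
    qed
    then have "nul (\<phi> (ssc t (\<lambda>_. (k, 0))))" using t(3) by (simp add: ssc_def)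
    then show ?thesis using \<open>k \<in> K\<close> by (intro nhom_zero_cancel[OF P_const t(1)]) auto
  qed
  have vsum: "nul (\<phi> (vsum l)) \<and> vsum l \<in> P" if "l \<in> lists (UNIV \<times> J)" for l
    using that
  proof (induction l)
    case Nil
    then show ?case using zero nul_P[OF nul_zero] by (simp add: zero_fun_def)
  next
    case (Cons p l)
    obtain c j where p: "p = (c, j)" "j \<in> J" using Cons by auto
    then have IH: "nul (\<phi> (vsum l))" "vsum l \<in> P" using Cons by auto
    show ?case
      using nhom_zero_axpy[OF P_v IH(2) v IH(1), OF p(2) p(2), of c] P_add[OF P_ssc[OF P_v[OF p(2)]] IH(2), of c]
      by (simp only: p vsum_simps simp_thms)
  qed
  obtain t a l where x': "t \<in> S" "a \<in> K \<times> UNIV" "l \<in> lists (UNIV \<times> J)" "nul (ssc t x - lc a l)"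
    using x by (rule P_E)
  have "(\<lambda>_. a) = ssc (snd a) U + (\<lambda>_. (fst a, 0))" by (simp add: fun_eq_iff prod_eq_iff)
  moreover have "nul (\<phi> (ssc (snd a) U + (\<lambda>_. (fst a, 0))))"
    using x'(2) k by (intro nhom_zero_axpy[OF P_U P_const U]) auto
  ultimately have "nul (\<phi> (ssc 1 (\<lambda>_. a) + vsum l))"
    using vsum[OF x'(3)] by (intro nhom_zero_axpy[OF P_const[OF x'(2)]]) (simp_all only:)
  then have "nul (\<phi> (lc a l))" by (simp add: lc_def)
  moreover have "lc a l \<in> P" using P_add[OF P_const[OF x'(2)]] vsum[OF x'(3)] by (simp add: lc_def)
  ultimately have "nul (\<phi> (ssc t x))" using nhom_zero_cong[OF P_ssc[OF x] _ x'(4)] by blast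
  then show ?thesis by (rule nhom_zero_cancel[OF x x'(1)])
qed

text \<open>Modulo \<open>q n\<close>, the element \<open>v j\<close> coincides with a linear combination of \<open>E (ib j)\<close> and \<open>U\<close>.\<close>

lemma nhom_v:
  assumes j: "j \<in> J"
  shows "nul (\<phi> (v j) - (\<lambda>n. psc (wseq Y n) (\<phi> (E (ib j)) n) + psc (wseq (W j) n) (\<phi> U n)))"
  unfolding nul_def
proof
  fix n
  let ?E = "E (ib j)"
  have EP: "?E \<in> P" using P_E_I ib_I j by blast
  \<comment> \<open>\<open>x\<close> vanishes at \<open>n\<close>, hence up to a null sequence is
    \<open>q n\<close> times some \<open>g\<close>, which lies in \<open>P\<close> by purity. So
    \<open>\<phi>\<close> sends it to zero modulo \<open>q n\<close>.\<close>
  define x where "x = v j - (\<lambda>_. v j n)"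
  have "(\<lambda>_. v j n) \<in> P" using coh_A[OF v_coh[OF j]] by (intro P_const)
  then have xP: "x \<in> P" unfolding x_def using P_v[OF j] P_minus by blast
  have "x n \<in> qA n" by (simp add: x_def)
  then obtain g where g: "coh g" "nul (x - ssc (q n) g)" using coh_divide[OF P_coh[OF xP]] by blast
  have gP: "g \<in> P" using P_cancel[OF xP g(1) q_S g(2)] .
  let ?r = "x - ssc (q n) g"
  let ?x2 = "ssc (q n) g + ?r" let ?x1 = "ssc (wseq (W j) n) U + ?x2"
  have P2: "?x2 \<in> P" using P_add[OF P_ssc[OF gP] nul_P[OF g(2)]] .
  have P1: "?x1 \<in> P" using P_add[OF P_ssc[OF P_U] P2] .
  have v: "v j = ssc (wseq Y n) ?E + ?x1"
    by (simp add: x_def fun_eq_iff) (simp add: v_def zero_prod_def)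
  have *: "(\<phi> (v j) n - (psc (wseq Y n) (\<phi> ?E n) + \<phi> ?x1 n)) \<in> qA n"
    using nhom_axpy[OF EP P1, of "wseq Y n"] unfolding v[symmetric] by (simp add: nul_def)
  moreover have "\<phi> ?x1 n - (psc (wseq (W j) n) (\<phi> U n) + \<phi> ?x2 n) \<in> qA n"
    using nhom_axpy[OF P_U P2, of "wseq (W j) n"] unfolding nul_def by (auto dest: spec[of _ n])
  moreover have "\<phi> ?x2 n - (psc (q n) (\<phi> g n) + \<phi> ?r n) \<in> qA n"
    using nhom_axpy[OF gP nul_P[OF g(2)], of "q n"] unfolding nul_def by (auto dest: spec[of _ n])
  moreover have "\<phi> ?r n \<in> qA n" using nhom_nul[OF g(2)] unfolding nul_def by blast
  moreover have "psc (q n) (\<phi> g n) \<in> qA n"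
    using dvd_qA[OF dvd_refl coh_A[OF nhom_coh[OF gP]]] .
  ultimately have "(\<phi> (v j) n - (psc (wseq Y n) (\<phi> ?E n) + \<phi> ?x1 n))
    + ((\<phi> ?x1 n - (psc (wseq (W j) n) (\<phi> U n) + \<phi> ?x2 n))
      + ((\<phi> ?x2 n - (psc (q n) (\<phi> g n) + \<phi> ?r n)) + (\<phi> ?r n + psc (q n) (\<phi> g n)))) \<in> qA n"
    by (intro qA_add)
  then show "(\<phi> (v j) - (\<lambda>n. psc (wseq Y n) (\<phi> ?E n) + psc (wseq (W j) n) (\<phi> U n))) n \<in> qA n"
    by (simp add: algebra_simps)
qed

end

end

section \<open>Homomorphisms act as scalars\<close>

context cellular_construction begin

text \<open>With common denominators, \<open>nhom_v\<close> becomes a relation linear in the series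
  of \<open>Y\<close>. Genericity of \<open>Y\<close> kills the coefficient \<open>\<alpha>\<close>,
  and what is left ties \<open>\<beta>\<close> to \<open>z\<close> through
  \<open>W j\<close>.\<close>

lemma nhom_relation:
  assumes \<phi>: "nhom \<phi>" and val: "\<And>x. x \<in> P \<Longrightarrow> \<exists>t\<in>S. \<exists>\<alpha>\<in>Cset W J. nul (ssc t (\<phi> x) - \<alpha>)"
    and j: "j \<in> J"
  shows "nul (\<phi> (E (ib j)))"
    and "\<exists>t\<in>S. \<exists>\<beta>\<in>Cset W J. \<exists>z\<in>Cset W J.
      nul (ssc t (\<phi> U) - \<beta>) \<and> nul (\<lambda>n. psc (wseq (W j) n) (\<beta> n) - z n)"
proof -
  let ?E = "E (ib j)"
  have EP: "?E \<in> P" using P_E_I ib_I j by blast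
  obtain t1 \<alpha>1 where 1: "t1 \<in> S" "\<alpha>1 \<in> Cset W J" "nul (ssc t1 (\<phi> ?E) - \<alpha>1)" using val[OF EP] by blast
  obtain t2 \<beta>1 where 2: "t2 \<in> S" "\<beta>1 \<in> Cset W J" "nul (ssc t2 (\<phi> U) - \<beta>1)" using val[OF P_U] by blast
  obtain t3 z1 where 3: "t3 \<in> S" "z1 \<in> Cset W J" "nul (ssc t3 (\<phi> (v j)) - z1)" using val[OF P_v[OF j]] by blast
  define t where "t = t1 * t2 * t3"
  define \<alpha> where "\<alpha> = ssc (t2 * t3) \<alpha>1"
  define \<beta> where "\<beta> = ssc (t1 * t3) \<beta>1"
  define z where "z = ssc (t1 * t2) z1"
  have t: "t \<in> S" unfolding t_def using 1 2 3 by (intro mult_S)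
  have C: "\<alpha> \<in> Cset W J" "\<beta> \<in> Cset W J" "z \<in> Cset W J"
    unfolding \<alpha>_def \<beta>_def z_def using 1 2 3 by (auto intro: Cset_ssc)
  have "ssc t (\<phi> ?E) - \<alpha> = ssc (t2 * t3) (ssc t1 (\<phi> ?E) - \<alpha>1)"
    by (simp add: t_def \<alpha>_def seq.scale_right_diff_distrib mult_ac)
  then have n1: "nul (ssc t (\<phi> ?E) - \<alpha>)" using nul_ssc[OF 1(3)] by metis
  have "ssc t (\<phi> U) - \<beta> = ssc (t1 * t3) (ssc t2 (\<phi> U) - \<beta>1)"
    by (simp add: t_def \<beta>_def seq.scale_right_diff_distrib mult_ac)
  then have n2: "nul (ssc t (\<phi> U) - \<beta>)" using nul_ssc[OF 2(3)] by metis
  have "ssc t (\<phi> (v j)) - z = ssc (t1 * t2) (ssc t3 (\<phi> (v j)) - z1)"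
    by (simp add: t_def z_def seq.scale_right_diff_distrib mult_ac)
  then have n3: "nul (ssc t (\<phi> (v j)) - z)" using nul_ssc[OF 3(3)] by metis
  have rel: "nul (\<lambda>n. psc (wseq Y n) (\<alpha> n) + (psc (wseq (W j) n) (\<beta> n) - z n))"
    unfolding nul_def
  proof
    fix n
    let ?y = "wseq Y n" and ?w = "wseq (W j) n"
    have a: "psc t (\<phi> ?E n) - \<alpha> n \<in> qA n" "psc t (\<phi> U n) - \<beta> n \<in> qA n" "psc t (\<phi> (v j) n) - z n \<in> qA n"
      using n1 n2 n3 by (simp_all add: nul_def)
    have b: "\<phi> (v j) n - (psc ?y (\<phi> ?E n) + psc ?w (\<phi> U n)) \<in> qA n"
      using nhom_v[OF \<phi> j] by (simp add: nul_def)
    have "psc ?y (\<alpha> n) + (psc ?w (\<beta> n) - z n)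
      = psc t (\<phi> (v j) n) - z n - psc ?y (psc t (\<phi> ?E n) - \<alpha> n) - psc ?w (psc t (\<phi> U n) - \<beta> n)
        - psc t (\<phi> (v j) n - (psc ?y (\<phi> ?E n) + psc ?w (\<phi> U n)))"
      by (simp only: scale_right_diff_distrib scale_right_distrib scale_scale mult.commute[of t])
        (simp add: algebra_simps)
    moreover have "psc t (\<phi> (v j) n) - z n - psc ?y (psc t (\<phi> ?E n) - \<alpha> n) - psc ?w (psc t (\<phi> U n) - \<beta> n)
        - psc t (\<phi> (v j) n - (psc ?y (\<phi> ?E n) + psc ?w (\<phi> U n))) \<in> qA n"
      by (intro qA_diff[OF qA_diff[OF qA_diff[OF a(3)]]] qA_scale a b)
    ultimately show "psc ?y (\<alpha> n) + (psc ?w (\<beta> n) - z n) \<in> qA n" by (simp only:)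
  qed
  then have \<alpha>: "nul \<alpha>" using generic_Y[OF C j] by blast
  have "nul (ssc t (\<phi> ?E))" using nul_plus[OF n1 \<alpha>] by simp
  then show "nul (\<phi> ?E)" using nul_cancel[OF t nhom_coh[OF \<phi> EP]] by blast
  have "nul (\<lambda>n. (psc (wseq Y n) (\<alpha> n) + (psc (wseq (W j) n) (\<beta> n) - z n)) - psc (wseq Y n) (\<alpha> n))"
    by (intro nul_diff rel nul_scale \<alpha>)
  then have "nul (\<lambda>n. psc (wseq (W j) n) (\<beta> n) - z n)" by simp
  then show "\<exists>t\<in>S. \<exists>\<beta>\<in>Cset W J. \<exists>z\<in>Cset W J.
      nul (ssc t (\<phi> U) - \<beta>) \<and> nul (\<lambda>n. psc (wseq (W j) n) (\<beta> n) - z n)"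
    using t C n2 by blast
qed

text \<open>Separating the \<open>j0\<close>-terms of \<open>\<beta>\<close> and \<open>z\<close>
  gives a quadratic relation over the other series. Its leading coefficient is the
  \<open>j0\<close>-coefficient of \<open>\<beta>\<close>, which therefore vanishes; the vanishing
  linear coefficient then says that \<open>\<beta>\<close> is a scalar.\<close>

lemma nhom_U:
  assumes \<phi>: "nhom \<phi>" and val: "\<And>x. x \<in> P \<Longrightarrow> \<exists>t\<in>S. \<exists>\<alpha>\<in>Cset W J. nul (ssc t (\<phi> x) - \<alpha>)"
  shows "\<exists>r. nul (\<phi> U - (\<lambda>_. (0, r)))"
proof -
  obtain t \<beta> z where t: "t \<in> S" and \<beta>: "\<beta> \<in> Cset W J" and z: "z \<in> Cset W J"
    and n1: "nul (ssc t (\<phi> U) - \<beta>)" and n2: "nul (\<lambda>n. psc (wseq (W j0) n) (\<beta> n) - z n)"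
    using nhom_relation(2)[OF \<phi> val j0] by blast
  obtain k b l where b: "\<beta> = elem W k b l" "k \<in> K" "l \<in> lists (UNIV \<times> J)"
    using \<beta> unfolding Cset_def by blast
  obtain k' b' l' where z': "z = elem W k' b' l'" "k' \<in> K" "l' \<in> lists (UNIV \<times> J)"
    using z unfolding Cset_def by blast
  let ?l = "filter (\<lambda>p. snd p \<noteq> j0) l" and ?l' = "filter (\<lambda>p. snd p \<noteq> j0) l'"
  let ?C = "Cset W (J - {j0})"
  let ?c = "coef l j0" and ?c' = "coef l' j0"
  have m: "elem W k b ?l - (\<lambda>_. (0, ?c')) \<in> ?C" "ssc (- 1) (elem W k' b' ?l') \<in> ?C"
    by (intro Cset_minus Cset_ssc CsetI Cset_const filter_lists b z' K_0)+
  have "psc (wseq (W j0) n) (\<beta> n) - z n = psc (wseq (W j0) n * wseq (W j0) n) (0, ?c)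
      + psc (wseq (W j0) n) ((elem W k b ?l - (\<lambda>_. (0, ?c'))) n) + ssc (- 1) (elem W k' b' ?l') n" for n
    using wsum_split[of W l n j0] wsum_split[of W l' n j0]
    by (simp add: b z' elem_def algebra_simps)
  then have n3: "nul (\<lambda>n. psc (wseq (W j0) n * wseq (W j0) n) (0, ?c)
      + psc (wseq (W j0) n) ((elem W k b ?l - (\<lambda>_. (0, ?c'))) n) + ssc (- 1) (elem W k' b' ?l') n)"
    using n2 by simp
  have "nul (\<lambda>_. (0, ?c))"
    by (rule genericD(1)[OF generic_W Cset_const[OF K_0] m n3])
  then have "?c = 0" by (rule nul_const_ring)
  then have "\<beta> = elem W k b ?l" using wsum_split[of W l _ j0] by (simp add: b elem_def)
  moreover have "nul (elem W k b ?l - (\<lambda>_. (0, ?c')))"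
    by (rule genericD(2)[OF generic_W Cset_const[OF K_0] m n3])
  ultimately have "nul ((ssc t (\<phi> U) - \<beta>) + (\<beta> - (\<lambda>_. (0, ?c'))))"
    using n1 by (intro nul_plus) auto
  then have "nul (ssc t (\<phi> U) - (\<lambda>_. (0, ?c')))" by (simp add: algebra_simps)
  \<comment> \<open>Purity passes from the scalar for \<open>t \<phi>(U)\<close> to a constant for
    \<open>\<phi>(U)\<close> itself; the component of that constant in \<open>K\<close> is
    annihilated by \<open>t\<close>, hence 0.\<close>
  then obtain a where a: "a \<in> K \<times> UNIV" "(0, ?c') = psc t a" "nul (\<phi> U - (\<lambda>_. a))"
    using coh_divide_const[OF t nhom_coh[OF \<phi> P_U], of "(0, ?c')"] K_0 by auto
  have "fst a = 0" using a torsion_free_K[OF t, of "fst a"] by (simp add: psc_def) auto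
  then show ?thesis using a(3) by (intro exI[of _ "snd a"]) (metis prod.collapse)
qed

text \<open>On \<open>G\<close> the kernel of \<open>prj 1\<close> is \<open>K\<close>, so
  \<open>prj 1\<close> embeds \<open>G/K\<close> in the completion of \<open>R\<close>;
  \<open>prj r\<close> is this embedding followed by multiplication by \<open>r\<close>.\<close>

definition prj :: "'r \<Rightarrow> (nat \<Rightarrow> 'u \<times> 'r) \<Rightarrow> nat \<Rightarrow> 'u \<times> 'r" where
  "prj r x = (\<lambda>n. (0, r * snd (x n)))"

lemma nul_prj_iff: "nul (prj 1 x) \<longleftrightarrow> (\<forall>n. q n dvd snd (x n))"
  unfolding prj_def by (simp add: nul_Pair_iff)

lemma nul_prj: "nul x \<Longrightarrow> nul (prj r x)"
  unfolding prj_def using nul_snd[of x] by (simp add: nul_Pair_iff)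

lemma coh_prj: "coh x \<Longrightarrow> coh (prj r x)"
proof -
  assume x: "coh x"
  have "nul (\<lambda>n. x (Suc n) - x n)" using x by (simp add: coh_def nul_def)
  then have "nul (prj r (\<lambda>n. x (Suc n) - x n))" by (rule nul_prj)
  then show ?thesis using K_0 by (simp add: coh_def nul_def prj_def right_diff_distrib)
qed

lemma prj_linear: "prj r (x + y) = prj r x + prj r y" "prj r (x - y) = prj r x - prj r y"
    "prj r (ssc c x) = ssc c (prj r x)" "prj r x = ssc r (prj 1 x)"
  by (simp_all add: prj_def fun_eq_iff distrib_left right_diff_distrib mult.left_commute)

text \<open>Subtracting \<open>prj r\<close>, with \<open>r\<close> read off at \<open>U\<close>,
  leaves a map that vanishes on all generators; on \<open>v j\<close> because \<open>nhom_v\<close>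
  computes that value from those at \<open>E\<close> and \<open>U\<close>.\<close>

lemma nhom_scalar:
  assumes \<phi>: "nhom \<phi>" and val: "\<And>x. x \<in> P \<Longrightarrow> \<exists>t\<in>S. \<exists>\<alpha>\<in>Cset W J. nul (ssc t (\<phi> x) - \<alpha>)"
  shows "\<exists>r. \<forall>x\<in>P. nul (\<phi> x - prj r x)"
proof -
  obtain r where r: "nul (\<phi> U - (\<lambda>_. (0, r)))" using nhom_U[OF \<phi> val] by blast
  have E: "nul (\<phi> (E i))" if "i \<in> I" for i
    using nhom_relation(1)[OF \<phi> val] ib_surj[OF that] by blast
  define \<delta> where "\<delta> x = \<phi> x - prj r x" for x
  have "nhom \<delta>"
    unfolding nhom_def
  proof (intro conjI ballI allI impI)
    show "coh (\<delta> x)" if "x \<in> P" for x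
      unfolding \<delta>_def using that by (intro coh_minus coh_prj nhom_coh[OF \<phi>] P_coh)
    show "nul (\<delta> (x + y) - (\<delta> x + \<delta> y))" if "x \<in> P" "y \<in> P" for x y
      using nhom_add[OF \<phi> that] by (simp add: \<delta>_def prj_linear(1) algebra_simps)
    show "nul (\<delta> (ssc c x) - ssc c (\<delta> x))" if "x \<in> P" for x c
      using nhom_scale[OF \<phi> that, of c] by (simp add: \<delta>_def prj_linear(3) seq.scale_right_diff_distrib)
    show "nul (\<delta> x)" if "nul x" for x
      unfolding \<delta>_def using that by (intro nul_minus nul_prj nhom_nul[OF \<phi>])
  qed
  moreover have "nul (\<delta> (E i))" if "i \<in> I" for i
  proof -
    have "prj r (E i) = 0" by (simp add: prj_def fun_eq_iff zero_prod_def)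
    then show ?thesis using E[OF that] by (simp add: \<delta>_def)
  qed
  moreover have "nul (\<delta> U)" using r by (simp add: \<delta>_def prj_def)
  moreover have "nul (\<delta> (v j))" if j: "j \<in> J" for j
    unfolding nul_def
  proof
    fix n
    let ?y = "wseq Y n" and ?w = "wseq (W j) n" and ?E = "E (ib j)"
    have "\<phi> (v j) n - (psc ?y (\<phi> ?E n) + psc ?w (\<phi> U n)) \<in> qA n"
      using nhom_v[OF \<phi> j] by (simp add: nul_def)
    moreover have "psc ?y (\<phi> ?E n) \<in> qA n" using E[OF ib_I[OF j]] by (simp add: nul_def qA_scale)
    moreover have "psc ?w (\<phi> U n - (0, r)) \<in> qA n" using r by (simp add: nul_def qA_scale)
    ultimately have "(\<phi> (v j) n - (psc ?y (\<phi> ?E n) + psc ?w (\<phi> U n))) + (psc ?y (\<phi> ?E n) + psc ?w (\<phi> U n - (0, r))) \<in> qA n"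
      by (intro qA_add)
    moreover have "(\<phi> (v j) n - (psc ?y (\<phi> ?E n) + psc ?w (\<phi> U n))) + (psc ?y (\<phi> ?E n) + psc ?w (\<phi> U n - (0, r)))
        = \<phi> (v j) n - psc ?w (0, r)"
      by (simp only: scale_right_diff_distrib) (simp only: algebra_simps)
    moreover have "psc ?w (0, r) = prj r (v j) n" by (simp add: prj_def v_def mult.commute)
    ultimately show "\<delta> (v j) n \<in> qA n"
      by (simp add: \<delta>_def)
  qed
  ultimately have "\<forall>x\<in>P. nul (\<delta> x)" using nhom_zeroI[of \<delta>] by blast
  then show ?thesis by (auto simp: \<delta>_def)
qed

text \<open>The scalar is read off at \<open>U\<close>, whose image lies in \<open>K\<close> and so
  has second coordinate 0. This serves both for \<open>Hom(G,K) = 0\<close> and for uniqueness of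
  lifts along the projection.\<close>

lemma nhom_kernel_zero:
  assumes \<phi>: "nhom \<phi>" and val: "\<And>x. x \<in> P \<Longrightarrow> \<exists>k\<in>K. nul (\<phi> x - (\<lambda>_. (k, 0)))"
    and x: "x \<in> P"
  shows "nul (\<phi> x)"
proof -
  have "\<exists>t\<in>S. \<exists>\<alpha>\<in>Cset W J. nul (ssc t (\<phi> x) - \<alpha>)" if x: "x \<in> P" for x
  proof -
    obtain k where k: "k \<in> K" "nul (\<phi> x - (\<lambda>_. (k, 0)))" using val[OF x] by blast
    show ?thesis
      by (rule bexI[OF _ one_S], rule bexI[OF _ Cset_const[OF k(1), of 0]]) (use k(2) in simp)
  qed
  then obtain r where r: "\<forall>x\<in>P. nul (\<phi> x - prj r x)" using nhom_scalar[OF \<phi>] by blast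
  obtain k where k: "k \<in> K" "nul (\<phi> U - (\<lambda>_. (k, 0)))" using val[OF P_U] by blast
  have "nul ((\<phi> U - (\<lambda>_. (k, 0))) - (\<phi> U - prj r U))" using nul_minus[OF k(2)] r P_U by blast
  then have "q n dvd r" for n using nul_snd[of _ n] by (fastforce simp: prj_def)
  then have "r = 0" using nul_const_ring[of r] by (simp add: nul_Pair_iff)
  then have "prj r x = 0" by (simp add: prj_def fun_eq_iff zero_prod_def)
  then show ?thesis using r x by fastforce
qed

text \<open>The second coordinate of \<open>v j\<close> is the series of \<open>W j\<close>, so
  independence of the series collapses the combination to its constant.\<close>

lemma lc_independent:
  assumes a: "a \<in> K \<times> UNIV" and l: "l \<in> lists (UNIV \<times> J)" and d: "\<And>n. q n dvd snd (lc a l n)"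
  shows "coef l j = 0" and "lc a l = (\<lambda>_. a)" and "snd a = 0"
proof -
  have "snd (lc a l n) = snd a + wsum W l n" for n by (simp add: lc_def snd_vsum)
  then have c: "coef l j = 0" for j using d indep_W l unfolding indep_def by metis
  then show "coef l j = 0" .
  show lc: "lc a l = (\<lambda>_. a)" using seq.sum_list_coef_zero[OF c, of v] by (simp add: lc_def vsum_def)
  show "snd a = 0" using d nul_const_ring[of "snd a"] by (simp add: lc nul_Pair_iff)
qed

text \<open>Up to null sequences this is \<open>K\<close> itself, by \<open>kernel_const\<close>, so
  \<open>P\<close> modulo \<open>N\<close> presents \<open>G/K\<close>.\<close>

definition N where
  "N = {x \<in> P. \<forall>n. q n dvd snd (x n)}"

lemma kernel_const:
  assumes x: "x \<in> N" shows "\<exists>k\<in>K. nul (x - (\<lambda>_. (k, 0)))"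
proof -
  have xP: "x \<in> P" and xd: "\<And>n. q n dvd snd (x n)" using x by (auto simp: N_def)
  obtain t a l where t: "t \<in> S" "a \<in> K \<times> UNIV" "l \<in> lists (UNIV \<times> J)" "nul (ssc t x - lc a l)"
    using xP by (rule P_E)
  have "q n dvd snd (lc a l n)" for n
  proof -
    have "q n dvd t * snd (x n) - snd (lc a l n)" using nul_snd[OF t(4), of n] by simp
    then show ?thesis using xd[of n] by (metis dvd_diff_commute dvd_diffD1 dvd_mult dvd_diff diff_diff_eq2 add_diff_cancel_left')
  qed
  note lci = lc_independent[OF t(2,3) this]
  have "nul (ssc t x - (\<lambda>_. a))" using t(4) lci(2) by simp
  then obtain b where b: "b \<in> K \<times> UNIV" "a = psc t b" "nul (x - (\<lambda>_. b))"
    using coh_divide_const[OF t(1) P_coh[OF xP] t(2)] by blast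
  have "snd b = 0" using b(2) lci(3) torsion_free_ring[OF t(1)] by simp
  then have "b = (fst b, 0)" by (simp add: prod_eq_iff)
  then show ?thesis using b by (metis mem_Times_iff)
qed

lemma nul_N: "nul x \<Longrightarrow> x \<in> N"
  using nul_snd nul_P by (auto simp: N_def)

lemma const_N: "k \<in> K \<Longrightarrow> (\<lambda>_. (k, 0)) \<in> N"
  by (auto simp: N_def intro: P_const)

lemma N_P: "N \<subseteq> P"
  by (auto simp: N_def)

lemma subspace_N: "seq.subspace N"
  by (rule seq.subspaceI) (auto simp: N_def intro: nul_P nul_zero P_add P_ssc)

lemma N_iff_prj: "x \<in> P \<Longrightarrow> x \<in> N \<longleftrightarrow> nul (prj 1 x)"
  by (simp add: N_def nul_prj_iff)

lemma prj_val:
  assumes "x \<in> P" shows "\<exists>t\<in>S. \<exists>\<alpha>\<in>Cset W J. nul (ssc t (prj 1 x) - \<alpha>)"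
proof -
  obtain t a l where t: "t \<in> S" "a \<in> K \<times> UNIV" "l \<in> lists (UNIV \<times> J)" "nul (ssc t x - lc a l)"
    using assms by (rule P_E)
  have "prj 1 (lc a l) = elem W 0 (snd a) l" by (simp add: prj_def elem_def lc_def snd_vsum)
  moreover have "nul (prj 1 (ssc t x - lc a l))" using nul_prj[OF t(4)] .
  ultimately have "nul (ssc t (prj 1 x) - elem W 0 (snd a) l)" by (simp only: prj_linear(2,3))
  then show ?thesis using t(1) CsetI[OF K_0 t(3), of W "snd a"] by blast
qed

text \<open>A class is determined by its data \<open>t\<close>, \<open>a\<close>, \<open>l\<close>,
  since \<open>t\<close> cancels in the completion. \<open>Z\<close> will be the carrier of
  \<open>K\<close> or the ring, whichever is larger.\<close>

lemma card_classes:
  assumes inf: "infinite Z" and Z: "|K| \<le>o |Z|" "|UNIV :: 'r set| \<le>o |Z|" "|J| \<le>o |Z|"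
  shows "|(\<lambda>x. {y. nul (y - x)}) ` P| \<le>o |Z|"
proof -
  let ?T = "S \<times> (K \<times> (UNIV :: 'r set) \<times> lists ((UNIV :: 'r set) \<times> J))"
  define F where "F = (\<lambda>(t, k, b, l). {y. nul (y - (SOME x. x \<in> P \<and> nul (ssc t x - lc (k, b) l)))})"
  have "(\<lambda>x. {y. nul (y - x)}) ` P \<subseteq> F ` ?T"
  proof
    fix c assume "c \<in> (\<lambda>x. {y. nul (y - x)}) ` P"
    then obtain x where x: "x \<in> P" "c = {y. nul (y - x)}" by blast
    obtain t a l where t: "t \<in> S" "a \<in> K \<times> UNIV" "l \<in> lists (UNIV \<times> J)" "nul (ssc t x - lc a l)"
      using x(1) by (rule P_E)
    define x' where "x' = (SOME x. x \<in> P \<and> nul (ssc t x - lc a l))"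
    have x': "x' \<in> P \<and> nul (ssc t x' - lc a l)" unfolding x'_def by (rule someI[of _ x]) (intro conjI x(1) t(4))
    have "nul ((ssc t x - lc a l) - (ssc t x' - lc a l))" using x' t(4) nul_minus by blast
    then have "nul (ssc t (x - x'))" by (simp add: seq.scale_right_diff_distrib)
    then have n: "nul (x - x')" using nul_cancel[OF t(1) coh_minus] x x' P_coh by blast
    have "nul (y - x) \<longleftrightarrow> nul (y - x')" for y
      using nul_plus[OF _ n, of "y - x"] nul_minus[OF _ n, of "y - x'"] by auto
    then have "c = F (t, fst a, snd a, l)" using x(2) by (simp add: F_def x'_def)
    then show "c \<in> F ` ?T" using t by (intro image_eqI[of _ _ "(t, fst a, snd a, l)"]) auto
  qed
  then have "|(\<lambda>x. {y. nul (y - x)}) ` P| \<le>o |?T|"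
    by (meson card_of_image card_of_mono1 ordLeq_transitive)
  also have "|?T| \<le>o |Z|"
  proof (rule card_of_Times_ordLeq_infinite_Field)
    show "|S| \<le>o |Z|" using Z(2) card_of_mono1[of S UNIV] ordLeq_transitive by blast
    show "|K \<times> (UNIV :: 'r set) \<times> lists ((UNIV :: 'r set) \<times> J)| \<le>o |Z|"
      by (rule card_parameters[OF inf Z])
  qed (use inf in \<open>simp_all add: card_of_card_order_on Field_card_of\<close>)
  finally show ?thesis .
qed

lemma exists_presentation:
  assumes "|(\<lambda>x. {y. nul (y - x)}) ` P| \<le>o |UNIV :: 'g set|"
  shows "\<exists>h (G :: ('r, 'g) rmod). presentation ssc P {x. nul x} h G \<and>
    |mcarrier G| \<le>o |(\<lambda>x. {y. nul (y - x)}) ` P|"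
proof -
  let ?c = "\<lambda>x. {y. nul (y - x)}"
  obtain f :: "_ \<Rightarrow> 'g" where f: "inj_on f (?c ` P)"
    using assms card_of_ordLeq[of "?c ` P" "UNIV :: 'g set"] by blast
  have "f (?c x) = f (?c y) \<longleftrightarrow> x - y \<in> {x. nul x}" if "x \<in> P" "y \<in> P" for x y
  proof -
    have "f (?c x) = f (?c y) \<longleftrightarrow> ?c x = ?c y" using f that by (simp add: inj_on_eq_iff)
    also have "\<dots> \<longleftrightarrow> nul (x - y)"
    proof
      assume "?c x = ?c y"
      moreover have "x \<in> ?c x" using nul_zero by simp
      ultimately show "nul (x - y)" by blast
    next
      assume n: "nul (x - y)"
      have "nul (z - x) \<longleftrightarrow> nul (z - y)" for z
        using nul_plus[OF _ n, of "z - x"] nul_minus[OF _ n, of "z - y"] by auto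
      then show "?c x = ?c y" by simp
    qed
    finally show ?thesis by simp
  qed
  then have "\<exists>G. presentation ssc P {x. nul x} (\<lambda>x. f (?c x)) G"
    using nul_P by (intro presentation_exists module_ssc subspace_P subspace_nul) auto
  then obtain G where G: "presentation ssc P {x. nul x} (\<lambda>x. f (?c x)) G" by blast
  then have "mcarrier G = f ` ?c ` P" by (simp add: presentation.carrier image_image)
  then show ?thesis using G card_of_image[of f "?c ` P"] by metis
qed

end

section \<open>The completion of the ring as a module\<close>

context adic_ring begin

lemma cauchy_mult:
  assumes "sadic_cauchy S x" "sadic_cauchy S y"
  shows "sadic_cauchy S (\<lambda>n. x n * y n)"
  unfolding sadic_cauchy_def
proof
  fix s assume s: "s \<in> S"
  obtain N1 where N1: "\<forall>n\<ge>N1. \<forall>m\<ge>N1. s dvd x n - x m" using assms(1) s unfolding sadic_cauchy_def by blast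
  obtain N2 where N2: "\<forall>n\<ge>N2. \<forall>m\<ge>N2. s dvd y n - y m" using assms(2) s unfolding sadic_cauchy_def by blast
  have "s dvd x n * y n - x m * y m" if nm: "n \<ge> max N1 N2" "m \<ge> max N1 N2" for n m
  proof -
    have "x n * y n - x m * y m = x n * (y n - y m) + y m * (x n - x m)" by (simp add: algebra_simps)
    then show ?thesis using N1 N2 nm by (metis dvd_add dvd_mult max.bounded_iff)
  qed
  then show "\<exists>N. \<forall>n\<ge>N. \<forall>m\<ge>N. s dvd x n * y n - x m * y m" by blast
qed

text \<open>The tail of the series divided by \<open>q n\<close> is again in the completion of
  \<open>R\<close>, so the series differs from its \<open>n\<close>-th partial sum by a multiple of
  \<open>q n\<close> within that module.\<close>

lemma wseq_quotient_cauchy: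
  assumes d: "\<And>m. m \<ge> n \<Longrightarrow> wseq X m - wseq X n = q n * d m"
  shows "sadic_cauchy S d"
  unfolding sadic_cauchy_def
proof
  fix s assume s: "s \<in> S"
  obtain N where N: "N \<ge> n" "q n * s dvd q N" using dvd_q[OF mult_S[OF q_S s]] by blast
  have "s dvd d m - d m'" if mm: "m \<ge> N" "m' \<ge> N" for m m'
  proof -
    have "q n * (d m - d m') = (wseq X m - wseq X n) - (wseq X m' - wseq X n)"
      using d[of m] d[of m'] mm N(1) by (simp add: right_diff_distrib)
    also have "\<dots> = (wseq X m - wseq X N) - (wseq X m' - wseq X N)" by simp
    finally have "q N dvd q n * (d m - d m')"
      using wseq_coherent[OF mm(1), of X] wseq_coherent[OF mm(2), of X] by (metis dvd_diff)
    then obtain c where "q n * (d m - d m') = q n * s * c" using N(2) dvd_trans by (metis dvdE)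
    then have "q n * ((d m - d m') - s * c) = 0" by (simp add: algebra_simps)
    then have "d m - d m' - s * c = 0" by (rule torsion_free_ring[OF q_S])
    then show ?thesis by simp
  qed
  then show "\<exists>N. \<forall>n\<ge>N. \<forall>m\<ge>N. s dvd d n - d m" by blast
qed

lemma wseq_cauchy: "sadic_cauchy S (wseq X)"
  by (rule wseq_quotient_cauchy[of 0 X]) (simp add: wseq_def)

lemma module_pointwise: "module (\<lambda>r x n. r * x n :: 'r)"
  by standard (auto simp: fun_eq_iff algebra_simps)

lemma presentation_completion:
  "presentation (\<lambda>r x n. r * x n) {x. sadic_cauchy S x} {x. sadic_null S x}
    (coset (cauchy_mod S) {x. sadic_null S x}) (completion S)"
proof -
  interpret module "\<lambda>r x n. r * x n :: 'r" by (rule module_pointwise)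
  have c: "subspace {x. sadic_cauchy S x}"
  proof (rule subspaceI)
    show "x + y \<in> {x. sadic_cauchy S x}" if xy: "x \<in> {x. sadic_cauchy S x}" "y \<in> {x. sadic_cauchy S x}" for x y
      unfolding mem_Collect_eq sadic_cauchy_def
    proof
      fix s assume s: "s \<in> S"
      obtain N1 where N1: "\<forall>n\<ge>N1. \<forall>m\<ge>N1. s dvd x n - x m" using xy s unfolding sadic_cauchy_def by blast
      obtain N2 where N2: "\<forall>n\<ge>N2. \<forall>m\<ge>N2. s dvd y n - y m" using xy s unfolding sadic_cauchy_def by blast
      have "s dvd (x + y) n - (x + y) m" if nm: "n \<ge> max N1 N2" "m \<ge> max N1 N2" for n m
      proof -
        have "(x + y) n - (x + y) m = (x n - x m) + (y n - y m)" by simp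
        then show ?thesis using N1 N2 nm by (metis dvd_add max.bounded_iff)
      qed
      then show "\<exists>N. \<forall>n\<ge>N. \<forall>m\<ge>N. s dvd (x + y) n - (x + y) m" by blast
    qed
    show "(\<lambda>n. c * x n) \<in> {x. sadic_cauchy S x}" if "x \<in> {x. sadic_cauchy S x}" for c x
      using that cauchy_mult[of "\<lambda>_. c" x] by (simp add: sadic_cauchy_def)
  qed (simp add: sadic_cauchy_def)
  have n: "subspace {x. sadic_null S x}"
  proof (rule subspaceI)
    show "x + y \<in> {x. sadic_null S x}" if xy: "x \<in> {x. sadic_null S x}" "y \<in> {x. sadic_null S x}" for x y
      unfolding mem_Collect_eq sadic_null_def
    proof
      fix s assume s: "s \<in> S"
      obtain N1 where "\<forall>n\<ge>N1. s dvd x n" using xy s unfolding sadic_null_def by blast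
      moreover obtain N2 where "\<forall>n\<ge>N2. s dvd y n" using xy s unfolding sadic_null_def by blast
      ultimately have "\<forall>n\<ge>max N1 N2. s dvd (x + y) n" by simp
      then show "\<exists>N. \<forall>n\<ge>N. s dvd (x + y) n" by blast
    qed
    show "(\<lambda>n. c * x n) \<in> {x. sadic_null S x}" if "x \<in> {x. sadic_null S x}" for c x
      using that by (fastforce simp: sadic_null_def)
  qed (simp add: sadic_null_def)
  have nc: "{x. sadic_null S x} \<subseteq> {x. sadic_cauchy S x}"
    unfolding sadic_null_def sadic_cauchy_def by (fastforce intro: dvd_diff)
  interpret p: presentation "\<lambda>r x n. r * x n :: 'r" "{x. sadic_cauchy S x}" "{0}" "\<lambda>x. x" "cauchy_mod S"
  proof unfold_locales
    show "mzero (cauchy_mod S) = 0" by (simp add: cauchy_mod_def zero_fun_def)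
    show "madd (cauchy_mod S) x y = x + y" for x y by (simp add: cauchy_mod_def plus_fun_def)
  qed (use c subspace_0[OF c] in \<open>auto simp: cauchy_mod_def\<close>)
  show ?thesis
    using p.quotient[OF n _ nc] subspace_0[OF n] by (simp add: completion_def)
qed

end

section \<open>The module G and its homomorphisms\<close>

locale cellular_module = cellular_construction S scale K I e J ib j0 W Y
  for S :: "'r::comm_ring_1 set" and scale :: "'r \<Rightarrow> 'u::ab_group_add \<Rightarrow> 'u" and K :: "'u set"
    and I :: "'i set" and e :: "'i \<Rightarrow> 'u" and J :: "'j set" and ib :: "'j \<Rightarrow> 'i" and j0 :: 'j
    and W :: "'j \<Rightarrow> nat set" and Y :: "nat set" +
  fixes h :: "(nat \<Rightarrow> 'u \<times> 'r) \<Rightarrow> 'g" and G :: "('r, 'g) rmod"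
    and hK :: "'u \<Rightarrow> 'm" and KM :: "('r, 'm) rmod"
  assumes pres_G: "presentation ssc P {x. nul x} h G"
    and pres_K: "presentation scale K {0} hK KM"
    and card_G: "|mcarrier G| <o |UNIV :: nat set set|"
begin

sublocale G: presentation ssc P "{x. nul x}" h G
  by (rule pres_G)

sublocale KM: presentation scale K "{0}" hK KM
  by (rule pres_K)

abbreviation Q :: "('r, 'g set) rmod" where
  "Q \<equiv> quot_mod G (h ` N)"

abbreviation \<pi> :: "(nat \<Rightarrow> 'u \<times> 'r) \<Rightarrow> 'g set" where
  "\<pi> \<equiv> \<lambda>x. coset G (h ` N) (h x)"

sublocale Q: presentation ssc P N \<pi> Q
  by (rule G.quotient[OF subspace_N _ N_P]) (auto intro: nul_N)

definition inc :: "'m \<Rightarrow> 'g" where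
  "inc m = h (\<lambda>_. (inv_into K hK m, 0))"

lemma inj_hK: "inj_on hK K"
  using KM.eq_iff by (auto simp: inj_on_def)

lemma inc_hK [simp]: "k \<in> K \<Longrightarrow> inc (hK k) = h (\<lambda>_. (k, 0))"
  by (simp add: inc_def inv_into_f_f[OF inj_hK])

lemma const_P: "k \<in> K \<Longrightarrow> (\<lambda>_. (k, 0)) \<in> P"
  by (rule P_const) auto

lemma lin_map_inc: "lin_map KM G inc"
  by (rule KM.lin_map_of_lift[OF pres_G, of "\<lambda>k _. (k, 0)"])
    (auto simp: const_P fun_eq_iff)

lemma inj_inc: "inj_on inc (mcarrier KM)"
proof (rule inj_onI)
  fix m m' assume "m \<in> mcarrier KM" "m' \<in> mcarrier KM" and eq: "inc m = inc m'"
  then obtain k k' where k: "k \<in> K" "k' \<in> K" "m = hK k" "m' = hK k'" by (auto simp: KM.carrier)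
  then have "nul ((\<lambda>_. (k, 0)) - (\<lambda>_. (k', 0)))"
    using eq G.eq_iff[OF const_P const_P, of k k'] by simp
  then have "nul (\<lambda>_. (k - k', 0))" by (simp add: fun_diff_def)
  then have "(k - k', 0) = (0 :: 'u \<times> 'r)"
    using K.subspace_diff[OF subspace_K k(1,2)] by (intro nul_const) auto
  then show "m = m'" using k by (simp add: zero_prod_def)
qed

text \<open>By \<open>kernel_const\<close> every class from \<open>N\<close> contains a constant
  from \<open>K\<close>, so \<open>Q\<close> really is the quotient of \<open>G\<close> by the
  embedded \<open>K\<close>.\<close>

lemma image_inc: "inc ` mcarrier KM = h ` N"
proof
  show "inc ` mcarrier KM \<subseteq> h ` N" using const_N by (auto simp: KM.carrier)
  show "h ` N \<subseteq> inc ` mcarrier KM"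
  proof
    fix g assume "g \<in> h ` N"
    then obtain x where x: "x \<in> N" "g = h x" by blast
    obtain k where k: "k \<in> K" "nul (x - (\<lambda>_. (k, 0)))" using kernel_const[OF x(1)] by blast
    then have "g = h (\<lambda>_. (k, 0))" using G.eq_iff[of x "\<lambda>_. (k, 0)"] const_P x N_P by blast
    then show "g \<in> inc ` mcarrier KM" using k by (auto simp: KM.carrier image_iff intro!: bexI[of _ k])
  qed
qed

lemma hom_K_zero:
  assumes f: "lin_map G KM f" and g: "g \<in> mcarrier G" shows "f g = mzero KM"
proof -
  obtain x where x: "x \<in> P" "g = h x" using g by (auto simp: G.carrier)
  obtain \<phi> where \<phi>: "\<And>x. x \<in> P \<Longrightarrow> \<phi> x \<in> K" "\<And>x. x \<in> P \<Longrightarrow> f (h x) = hK (\<phi> x)"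
    "\<And>x y. x \<in> P \<Longrightarrow> y \<in> P \<Longrightarrow> \<phi> (x + y) - (\<phi> x + \<phi> y) \<in> {0}"
    "\<And>r x. x \<in> P \<Longrightarrow> \<phi> (ssc r x) - scale r (\<phi> x) \<in> {0}"
    "\<And>x. x \<in> {x. nul x} \<Longrightarrow> \<phi> x \<in> {0}"
    using G.lin_map_lift[OF pres_K f] by blast
  \<comment> \<open>Elements of \<open>K\<close> enter the completion as constant sequences;
    \<open>nul_const\<close> leads back at the end.\<close>
  have "nhom (\<lambda>x _. (\<phi> x, 0))"
    unfolding nhom_def
  proof (intro conjI ballI allI impI)
    show "coh (\<lambda>_. (\<phi> x, 0))" if "x \<in> P" for x using \<phi>(1)[OF that] by (intro coh_const) auto
    show "nul ((\<lambda>_. (\<phi> (x + y), 0)) - ((\<lambda>_. (\<phi> x, 0)) + (\<lambda>_. (\<phi> y, 0))))" if "x \<in> P" "y \<in> P" for x y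
      using \<phi>(3)[OF that] by (simp add: nul_def zero_prod_def[symmetric])
    show "nul ((\<lambda>_. (\<phi> (ssc r x), 0)) - ssc r (\<lambda>_. (\<phi> x, 0)))" if "x \<in> P" for r x
      using \<phi>(4)[OF that, of r] by (simp add: nul_def zero_prod_def[symmetric])
    show "nul (\<lambda>_. (\<phi> x, 0))" if "nul x" for x
      using \<phi>(5)[of x] that by (simp add: nul_def zero_prod_def[symmetric])
  qed
  then have "nul (\<lambda>_. (\<phi> x, 0))"
  proof (rule nhom_kernel_zero)
    show "\<exists>k\<in>K. nul ((\<lambda>_. (\<phi> x, 0)) - (\<lambda>_. (k, 0)))" if "x \<in> P" for x
      using \<phi>(1)[OF that] by (intro bexI[of _ "\<phi> x"]) (simp_all add: nul_zero)
  qed (rule x)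
  then have "(\<phi> x, 0) = (0 :: 'u \<times> 'r)" using \<phi>(1)[OF x(1)] by (intro nul_const) auto
  then show ?thesis using \<phi>(2)[OF x(1)] x by (simp add: KM.zero zero_prod_def)
qed

lemma nhom_prj:
  assumes \<phi>: "\<And>x. x \<in> P \<Longrightarrow> \<phi> x \<in> P"
    "\<And>x y. x \<in> P \<Longrightarrow> y \<in> P \<Longrightarrow> \<phi> (x + y) - (\<phi> x + \<phi> y) \<in> N"
    "\<And>r x. x \<in> P \<Longrightarrow> \<phi> (ssc r x) - ssc r (\<phi> x) \<in> N"
    "\<And>x. nul x \<Longrightarrow> \<phi> x \<in> N"
  shows "nhom (\<lambda>x. prj 1 (\<phi> x))"
proof -
  have n: "nul (prj 1 x)" if "x \<in> N" for x using that N_iff_prj N_P by blast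
  show ?thesis
    unfolding nhom_def
  proof (intro conjI ballI allI impI)
    show "coh (prj 1 (\<phi> x))" if "x \<in> P" for x using \<phi>(1)[OF that] P_coh coh_prj by blast
    show "nul (prj 1 (\<phi> (x + y)) - (prj 1 (\<phi> x) + prj 1 (\<phi> y)))" if "x \<in> P" "y \<in> P" for x y
      using n[OF \<phi>(2)[OF that]] by (simp only: prj_linear(1,2))
    show "nul (prj 1 (\<phi> (ssc r x)) - ssc r (prj 1 (\<phi> x)))" if "x \<in> P" for r x
      using n[OF \<phi>(3)[OF that, of r]] by (simp only: prj_linear(2,3))
    show "nul (prj 1 (\<phi> x))" if "nul x" for x using n \<phi>(4)[OF that] by blast
  qed
qed

lemma hom_Q_iff:
  "lin_map G Q f \<longleftrightarrow> (\<exists>r. \<forall>g\<in>mcarrier G. f g = msmul Q r (quot_map G (h ` N) g))"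
proof
  assume "\<exists>r. \<forall>g\<in>mcarrier G. f g = msmul Q r (quot_map G (h ` N) g)"
  then obtain r where r: "\<forall>g\<in>mcarrier G. f g = msmul Q r (quot_map G (h ` N) g)" by blast
  show "lin_map G Q f"
  proof (rule G.lin_map_of_lift[OF Q.presentation_axioms, of "ssc r"])
    show "f (h x) = \<pi> (ssc r x)" if "x \<in> P" for x
      using r that Q.smul[OF that, of r] by (simp add: G.carrier quot_map_def)
    show "ssc r (ssc s x) = ssc s (ssc r x)" for s x
      by (simp add: mult.commute)
  qed (simp_all only: P_ssc seq.scale_right_distrib)
next
  assume f: "lin_map G Q f"
  obtain \<phi> where \<phi>: "\<And>x. x \<in> P \<Longrightarrow> \<phi> x \<in> P" "\<And>x. x \<in> P \<Longrightarrow> f (h x) = \<pi> (\<phi> x)"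
    "\<And>x y. x \<in> P \<Longrightarrow> y \<in> P \<Longrightarrow> \<phi> (x + y) - (\<phi> x + \<phi> y) \<in> N"
    "\<And>r x. x \<in> P \<Longrightarrow> \<phi> (ssc r x) - ssc r (\<phi> x) \<in> N"
    "\<And>x. x \<in> {x. nul x} \<Longrightarrow> \<phi> x \<in> N"
    using G.lin_map_lift[OF Q.presentation_axioms f] by blast
  have "nhom (\<lambda>x. prj 1 (\<phi> x))" using \<phi> by (intro nhom_prj) auto
  then obtain r where r: "\<forall>x\<in>P. nul (prj 1 (\<phi> x) - prj r x)"
    using nhom_scalar[of "\<lambda>x. prj 1 (\<phi> x)"] prj_val \<phi>(1) by blast
  have "f (h x) = msmul Q r (\<pi> x)" if x: "x \<in> P" for x
  proof -
    have "nul (prj 1 (\<phi> x - ssc r x))"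
      using r x by (simp only: prj_linear(2,3) prj_linear(4)[of r])
    then have "\<phi> x - ssc r x \<in> N" using N_iff_prj P_minus \<phi>(1)[OF x] P_ssc[OF x] by blast
    then have "\<pi> (\<phi> x) = \<pi> (ssc r x)" using Q.eq_iff \<phi>(1)[OF x] P_ssc[OF x] by blast
    then show ?thesis using \<phi>(2)[OF x] Q.smul[OF x] by simp
  qed
  then show "\<exists>r. \<forall>g\<in>mcarrier G. f g = msmul Q r (quot_map G (h ` N) g)"
    by (intro exI[of _ r]) (auto simp: G.carrier quot_map_def)
qed

lemma cellular: "cellular_exact KM G Q inc (quot_map G (h ` N))"
proof -
  have lin: "lin_map G Q (quot_map G (h ` N))"
    by (rule G.lin_map_of_lift[OF Q.presentation_axioms, of "\<lambda>x. x"]) (auto simp: quot_map_def)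
  have "short_exact KM G Q inc (quot_map G (h ` N))"
    unfolding short_exact_def
  proof (intro conjI lin_map_inc inj_inc lin)
    show "quot_map G (h ` N) ` mcarrier G = mcarrier Q"
      unfolding G.carrier Q.carrier by (simp add: quot_map_def image_image)
    show "{g \<in> mcarrier G. quot_map G (h ` N) g = mzero Q} = inc ` mcarrier KM"
      unfolding image_inc
    proof (intro set_eqI iffI)
      fix g assume "g \<in> {g \<in> mcarrier G. quot_map G (h ` N) g = mzero Q}"
      then obtain x where x: "x \<in> P" "g = h x" "\<pi> x = mzero Q" by (auto simp: G.carrier quot_map_def)
      then have "x \<in> N" using Q.eq_zero_iff[OF x(1)] by simp
      then show "g \<in> h ` N" using x by blast
    next
      fix g assume "g \<in> h ` N"
      then obtain x where x: "x \<in> N" "g = h x" by blast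
      then have "\<pi> x = mzero Q" using Q.eq_zero_iff[of x] N_P by blast
      then show "g \<in> {g \<in> mcarrier G. quot_map G (h ` N) g = mzero Q}"
        using x N_P by (auto simp: G.carrier quot_map_def)
    qed
  qed
  moreover have "\<phi> g = \<psi> g"
    if \<phi>: "lin_map G G \<phi>" and \<psi>: "lin_map G G \<psi>"
      and eq: "\<forall>x\<in>mcarrier G. quot_map G (h ` N) (\<phi> x) = quot_map G (h ` N) (\<psi> x)"
      and g: "g \<in> mcarrier G" for \<phi> \<psi> g
  proof -
    obtain a where a: "\<And>x. x \<in> P \<Longrightarrow> a x \<in> P" "\<And>x. x \<in> P \<Longrightarrow> \<phi> (h x) = h (a x)"
      "\<And>x y. x \<in> P \<Longrightarrow> y \<in> P \<Longrightarrow> a (x + y) - (a x + a y) \<in> {x. nul x}"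
      "\<And>r x. x \<in> P \<Longrightarrow> a (ssc r x) - ssc r (a x) \<in> {x. nul x}"
      "\<And>x. x \<in> {x. nul x} \<Longrightarrow> a x \<in> {x. nul x}"
      using G.lin_map_lift[OF pres_G \<phi>] by blast
    obtain b where b: "\<And>x. x \<in> P \<Longrightarrow> b x \<in> P" "\<And>x. x \<in> P \<Longrightarrow> \<psi> (h x) = h (b x)"
      "\<And>x y. x \<in> P \<Longrightarrow> y \<in> P \<Longrightarrow> b (x + y) - (b x + b y) \<in> {x. nul x}"
      "\<And>r x. x \<in> P \<Longrightarrow> b (ssc r x) - ssc r (b x) \<in> {x. nul x}"
      "\<And>x. x \<in> {x. nul x} \<Longrightarrow> b x \<in> {x. nul x}"
      using G.lin_map_lift[OF pres_G \<psi>] by blast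
    \<comment> \<open>Endomorphisms with equal composites differ by a map into \<open>K\<close>, to
      which \<open>nhom_kernel_zero\<close> applies.\<close>
    define d where "d x = a x - b x" for x
    have dN: "d x \<in> N" if "x \<in> P" for x
    proof -
      have "\<pi> (a x) = \<pi> (b x)"
        using bspec[OF eq G.h_carrier[OF that]] unfolding quot_map_def a(2)[OF that] b(2)[OF that] .
      then show ?thesis using Q.eq_iff a(1) b(1) that by (simp add: d_def)
    qed
    have "nhom d"
      unfolding nhom_def
    proof (intro conjI ballI allI impI)
      show "coh (d x)" if "x \<in> P" for x using dN[OF that] N_P P_coh by blast
      show "nul (d (x + y) - (d x + d y))" if "x \<in> P" "y \<in> P" for x y
      proof -
        have "d (x + y) - (d x + d y) = (a (x + y) - (a x + a y)) - (b (x + y) - (b x + b y))"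
          by (simp add: d_def algebra_simps)
        moreover have "nul ((a (x + y) - (a x + a y)) - (b (x + y) - (b x + b y)))"
          using nul_minus a(3)[OF that] b(3)[OF that] by blast
        ultimately show ?thesis by (simp only:)
      qed
      show "nul (d (ssc r x) - ssc r (d x))" if "x \<in> P" for x r
      proof -
        have "d (ssc r x) - ssc r (d x) = (a (ssc r x) - ssc r (a x)) - (b (ssc r x) - ssc r (b x))"
          by (simp add: d_def seq.scale_right_diff_distrib)
        moreover have "nul ((a (ssc r x) - ssc r (a x)) - (b (ssc r x) - ssc r (b x)))"
          using nul_minus a(4)[OF that] b(4)[OF that] by blast
        ultimately show ?thesis by (simp only:)
      qed
      show "nul (d x)" if "nul x" for x
        unfolding d_def using a(5)[of x] b(5)[of x] that nul_minus by blast
    qed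
    then have nul: "nul (d x)" if "x \<in> P" for x
      using kernel_const[OF dN] that by (rule nhom_kernel_zero)
    obtain x where x: "x \<in> P" "g = h x" using g by (auto simp: G.carrier)
    then have "h (a x) = h (b x)" using nul[OF x(1)] G.eq_iff a(1) b(1) by (simp add: d_def)
    then show ?thesis using a(2) b(2) x by simp
  qed
  moreover have "\<exists>\<phi>. lin_map G G \<phi> \<and> (\<forall>x\<in>mcarrier G. f x = quot_map G (h ` N) (\<phi> x))"
    if f: "lin_map G Q f" for f
  proof -
    obtain r where r: "\<forall>g\<in>mcarrier G. f g = msmul Q r (quot_map G (h ` N) g)"
      using f hom_Q_iff by blast
    have "lin_map G G (msmul G r)"
      by (rule G.lin_map_of_lift[OF pres_G, of "ssc r"])
        (simp_all only: P_ssc G.smul seq.scale_right_distrib seq.scale_scale mult.commute[of r])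
    moreover have "f g = quot_map G (h ` N) (msmul G r g)" if "g \<in> mcarrier G" for g
    proof -
      obtain x where x: "x \<in> P" "g = h x" using \<open>g \<in> mcarrier G\<close> by (auto simp: G.carrier)
      then show ?thesis using r that Q.smul[OF x(1), of r] G.smul[OF x(1), of r] by (simp add: quot_map_def)
    qed
    ultimately show ?thesis by blast
  qed
  ultimately show ?thesis unfolding cellular_exact_def by blast
qed

text \<open>By continuity \<open>f\<close> sends \<open>w * a\<close> to \<open>w * f a\<close> for
  every series \<open>w\<close>, so all these products lie in \<open>G\<close>. As \<open>G\<close>
  has fewer than continuum many elements, some \<open>w\<close> satisfies no relation
  \<open>w * f a = g\<close> with \<open>g\<close> in \<open>G\<close> unless \<open>f a\<close> is
  zero.\<close>

lemma cotorsion_free_G: "cotorsion_free S G"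
  unfolding cotorsion_free_def
proof (intro allI impI ballI)
  fix f c assume f: "lin_map (completion S) G f" and c: "c \<in> mcarrier (completion S)"
  interpret R: presentation "\<lambda>r x n. r * x n" "{x. sadic_cauchy S x}" "{x. sadic_null S x}"
    "coset (cauchy_mod S) {x. sadic_null S x}" "completion S" by (rule presentation_completion)
  obtain a where a: "sadic_cauchy S a" "c = coset (cauchy_mod S) {x. sadic_null S x} a"
    using c by (auto simp: R.carrier)
  obtain \<phi> where \<phi>: "\<And>x. x \<in> {x. sadic_cauchy S x} \<Longrightarrow> \<phi> x \<in> P"
    "\<And>x. x \<in> {x. sadic_cauchy S x} \<Longrightarrow> f (coset (cauchy_mod S) {x. sadic_null S x} x) = h (\<phi> x)"
    "\<And>x y. x \<in> {x. sadic_cauchy S x} \<Longrightarrow> y \<in> {x. sadic_cauchy S x} \<Longrightarrow> \<phi> (x + y) - (\<phi> x + \<phi> y) \<in> {x. nul x}"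
    "\<And>r x. x \<in> {x. sadic_cauchy S x} \<Longrightarrow> \<phi> (\<lambda>n. r * x n) - ssc r (\<phi> x) \<in> {x. nul x}"
    "\<And>x. x \<in> {x. sadic_null S x} \<Longrightarrow> \<phi> x \<in> {x. nul x}"
    using R.lin_map_lift[OF pres_G f] by blast
  let ?D = "(\<lambda>g. (0, \<phi> a, ssc (- 1) (inv_into P h g))) ` mcarrier G"
  have "|?D| <o |UNIV :: nat set set|"
    by (rule ordLeq_ordLess_trans[OF card_of_image card_G])
  moreover have "coh x \<and> coh y" if "(x, y, z) \<in> ?D" for x y z
    using that \<phi>(1) a(1) by (auto simp: coh_zero P_coh)
  ultimately obtain X where X: "\<forall>(x, y, z)\<in>?D. nul (\<lambda>n. psc (wseq X n * wseq X n) (x n) + psc (wseq X n) (y n) + z n)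
            \<longrightarrow> nul x \<and> nul y"
    using exists_generic[of ?D] by blast
  define wa where "wa = (\<lambda>n. wseq X n * a n)"
  have wa: "sadic_cauchy S wa" unfolding wa_def by (rule cauchy_mult[OF wseq_cauchy a(1)])
  have cont: "\<phi> wa n - psc (wseq X n) (\<phi> a n) \<in> qA n" for n
  proof -
    define d where "d m = (if m \<ge> n then (SOME d. wseq X m - wseq X n = q n * d) else 0)" for m
    have d: "wseq X m - wseq X n = q n * d m" if "m \<ge> n" for m
      using someI_ex[OF wseq_coherent[OF that, of X, unfolded dvd_def]] that by (simp add: d_def)
    define b where "b = (\<lambda>m. d m * a m)"
    \<comment> \<open>\<open>wa\<close> is the partial sum times \<open>a\<close> plus
      \<open>q n\<close> times \<open>b\<close> only from index \<open>n\<close> on; the finitely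
      many earlier terms are collected in the null sequence \<open>r\<close>.\<close>
    define r where "r = wa - ((\<lambda>m. wseq X n * a m) + (\<lambda>m. q n * b m))"
    have b: "sadic_cauchy S b" unfolding b_def by (rule cauchy_mult[OF wseq_quotient_cauchy[OF d] a(1)])
    have "r m = 0" if "m \<ge> n" for m
    proof -
      have "r m = (wseq X m - wseq X n - q n * d m) * a m"
        by (simp add: r_def wa_def b_def algebra_simps)
      then show ?thesis using d[OF that] by simp
    qed
    then have rn: "sadic_null S r" unfolding sadic_null_def by (metis dvd_0_right)
    then have rc: "sadic_cauchy S r" using R.N_P by blast
    let ?x1 = "\<lambda>m. wseq X n * a m" and ?x2 = "\<lambda>m. q n * b m"
    have x1: "sadic_cauchy S ?x1" using R.P_scale[of a "wseq X n"] a(1) by simp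
    have x2: "sadic_cauchy S ?x2" using R.P_scale[of b "q n"] b by simp
    have x2r: "sadic_cauchy S (?x2 + r)" using R.P_add[of ?x2 r] x2 rc by simp
    have "wa = ?x1 + (?x2 + r)" by (simp add: r_def)
    then have "\<phi> wa n - (\<phi> ?x1 n + \<phi> (?x2 + r) n) \<in> qA n"
      using \<phi>(3)[of ?x1 "?x2 + r"] x1 x2r by (simp add: nul_def)
    moreover have "\<phi> (?x2 + r) n - (\<phi> ?x2 n + \<phi> r n) \<in> qA n"
      using \<phi>(3)[of ?x2 r] x2 rc by (simp add: nul_def)
    moreover have "\<phi> ?x1 n - psc (wseq X n) (\<phi> a n) \<in> qA n"
      using \<phi>(4)[of a "wseq X n"] a(1) by (simp add: nul_def)
    moreover have "\<phi> ?x2 n - psc (q n) (\<phi> b n) \<in> qA n"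
      using \<phi>(4)[of b "q n"] b by (simp add: nul_def)
    moreover have "psc (q n) (\<phi> b n) \<in> qA n"
      using dvd_qA[OF dvd_refl coh_A[OF P_coh[OF \<phi>(1)]]] b by blast
    moreover have "\<phi> r n \<in> qA n" using \<phi>(5)[of r] rn by (simp add: nul_def)
    ultimately have "(\<phi> wa n - (\<phi> ?x1 n + \<phi> (?x2 + r) n)) + ((\<phi> (?x2 + r) n - (\<phi> ?x2 n + \<phi> r n))
      + ((\<phi> ?x1 n - psc (wseq X n) (\<phi> a n)) + ((\<phi> ?x2 n - psc (q n) (\<phi> b n)) + (psc (q n) (\<phi> b n) + \<phi> r n)))) \<in> qA n"
      by (intro qA_add)
    moreover have "(\<phi> wa n - (\<phi> ?x1 n + \<phi> (?x2 + r) n)) + ((\<phi> (?x2 + r) n - (\<phi> ?x2 n + \<phi> r n))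
      + ((\<phi> ?x1 n - psc (wseq X n) (\<phi> a n)) + ((\<phi> ?x2 n - psc (q n) (\<phi> b n)) + (psc (q n) (\<phi> b n) + \<phi> r n))))
      = \<phi> wa n - psc (wseq X n) (\<phi> a n)"
      by (simp only: algebra_simps)
    ultimately show ?thesis by (simp only:)
  qed
  define p where "p = inv_into P h (h (\<phi> wa))"
  have wP: "\<phi> wa \<in> P" using \<phi>(1) wa by blast
  have "p \<in> P" "h p = h (\<phi> wa)" unfolding p_def using wP by (auto simp: inv_into_into f_inv_into_f)
  then have pn: "nul (p - \<phi> wa)" using G.eq_iff wP by blast
  have "nul (\<lambda>n. psc (wseq X n * wseq X n) ((0 :: nat \<Rightarrow> 'u \<times> 'r) n) + psc (wseq X n) (\<phi> a n) + ssc (- 1) p n)"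
    unfolding nul_def
  proof
    fix n
    have "p n - \<phi> wa n \<in> qA n" using pn by (simp add: nul_def)
    then have "- (\<phi> wa n - psc (wseq X n) (\<phi> a n)) - (p n - \<phi> wa n) \<in> qA n"
      using qA_diff[OF qA_neg[OF cont]] by blast
    then show "psc (wseq X n * wseq X n) ((0 :: nat \<Rightarrow> 'u \<times> 'r) n) + psc (wseq X n) (\<phi> a n) + ssc (- 1) p n \<in> qA n"
      by simp
  qed
  moreover have "(0, \<phi> a, ssc (- 1) p) \<in> ?D" unfolding p_def using G.h_carrier[OF wP] by blast
  ultimately have "nul (\<phi> a)" using X by blast
  then show "f c = mzero G" using \<phi>(1,2)[of a] a G.eq_zero_iff[of "\<phi> a"] by simp
qed

end

section \<open>The rank of G\<close>

lemma (in module) sum_list_eq_sum_coef: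
  "finite F \<Longrightarrow> snd ` set l \<subseteq> F \<Longrightarrow> (\<Sum>(c, j)\<leftarrow>l. scale c (g j)) = (\<Sum>j\<in>F. scale (coef l j) (g j))"
proof (induction l)
  case (Cons p l)
  have "(\<Sum>j\<in>F. scale (coef (p # l) j) (g j))
      = (\<Sum>j\<in>F. (if j = snd p then scale (fst p) (g (snd p)) else 0) + scale (coef l j) (g j))"
    by (intro sum.cong) (auto simp: scale_left_distrib)
  also have "\<dots> = scale (fst p) (g (snd p)) + (\<Sum>j\<in>F. scale (coef l j) (g j))"
    using Cons.prems by (simp add: sum.distrib)
  finally show ?case using Cons by (simp add: split_beta)
qed simp

text \<open>The statement prescribes the index sets, while the natural basis is indexed by a
  disjoint sum of \<open>I\<close>, \<open>J\<close> and a point.\<close>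

lemma has_rank_bij:
  fixes M :: "('r::comm_ring_1, 'm) rmod"
  assumes f: "bij_betw f B A" and A: "has_rank S M A"
  shows "has_rank S M B"
proof -
  have lc: "lin_comb M (\<lambda>b. e (f b)) c is = lin_comb M e (\<lambda>a. c (inv_into B f a)) (map f is)"
    if "set is \<subseteq> B" for e :: "_ \<Rightarrow> 'm" and c :: "_ \<Rightarrow> 'r" and "is"
  proof -
    have "map (\<lambda>b. msmul M (c b) (e (f b))) is = map (\<lambda>a. msmul M (c (inv_into B f a)) (e a)) (map f is)"
      using that f by (auto simp: bij_betw_inv_into_left subset_iff)
    then show ?thesis by (simp only: lin_comb_def)
  qed
  show ?thesis
  proof (cases "|UNIV :: 'r set| <o |mcarrier M|")
    case True
    then have "|mcarrier M| =o |A|" using A by (simp add: has_rank_def)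
    moreover have "|A| =o |B|" using f card_of_ordIsoI ordIso_symmetric by blast
    ultimately show ?thesis using True ordIso_transitive by (auto simp: has_rank_def)
  next
    case False
    then obtain e where e: "independent M e A" "\<forall>x\<in>mcarrier M. \<exists>s\<in>S. msmul M s x \<in> span M e A"
      using A by (auto simp: has_rank_def)
    have "independent M (\<lambda>b. e (f b)) B"
      unfolding independent_def
    proof (intro conjI ballI allI impI)
      fix b assume b: "b \<in> B"
      then show "e (f b) \<in> mcarrier M" using e(1) f by (auto simp: independent_def bij_betw_def)
    next
      fix c "is" i assume h: "distinct is \<and> set is \<subseteq> B \<and> lin_comb M (\<lambda>b. e (f b)) c is = mzero M"
        and i: "i \<in> set is"
      have "distinct (map f is)" using h f by (auto simp: distinct_map bij_betw_def intro: inj_on_subset)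
      moreover have "set (map f is) \<subseteq> A" using h f by (auto simp: bij_betw_def)
      moreover have "lin_comb M e (\<lambda>a. c (inv_into B f a)) (map f is) = mzero M" using h lc by metis
      ultimately have "\<forall>a\<in>set (map f is). c (inv_into B f a) = 0"
        using e(1) unfolding independent_def by blast
      then have "c (inv_into B f (f i)) = 0" using i by simp
      then show "c i = 0" using h i f bij_betw_inv_into_left by (metis subset_iff)
    qed
    moreover have "span M e A \<subseteq> span M (\<lambda>b. e (f b)) B"
    proof
      fix x assume "x \<in> span M e A"
      then obtain c "is" where x: "x = lin_comb M e c is" "set is \<subseteq> A" by (auto simp: span_def)
      let ?js = "map (inv_into B f) is"
      have js: "set ?js \<subseteq> B" using x(2) f by (auto simp: bij_betw_def inv_into_into)
      have "map f ?js = is" using x(2) f by (auto simp: bij_betw_inv_into_right subset_iff intro: map_idI)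
      moreover have "lin_comb M e (\<lambda>a. c (f (inv_into B f a))) is = lin_comb M e c is"
      proof -
        have "map (\<lambda>i. msmul M (c (f (inv_into B f i))) (e i)) is = map (\<lambda>i. msmul M (c i) (e i)) is"
          using x(2) f by (auto simp: bij_betw_inv_into_right subset_iff)
        then show ?thesis by (simp only: lin_comb_def)
      qed
      ultimately have "x = lin_comb M (\<lambda>b. e (f b)) (\<lambda>b. c (f b)) ?js"
        using lc[OF js, of e "\<lambda>b. c (f b)"] x(1) by simp
      then show "x \<in> span M (\<lambda>b. e (f b)) B" using js unfolding span_def by blast
    qed
    ultimately show ?thesis
      using False e(2) unfolding has_rank_def by (auto intro!: exI[of _ "\<lambda>b. e (f b)"]) blast
  qed
qed

context cellular_module begin

definition bas :: "('i + 'j) + unit \<Rightarrow> nat \<Rightarrow> 'u \<times> 'r" where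
  "bas t = (case t of Inl (Inl i) \<Rightarrow> E i | Inl (Inr j) \<Rightarrow> v j | Inr _ \<Rightarrow> U)"

lemma bas_P: "t \<in> (I <+> J) <+> {()} \<Longrightarrow> bas t \<in> P"
  by (auto simp: bas_def P_E_I P_v P_U)

definition fstI :: "(('i + 'j) + unit) list \<Rightarrow> 'i list" where
  "fstI ts = concat (map (\<lambda>t. case t of Inl (Inl i) \<Rightarrow> [i] | _ \<Rightarrow> []) ts)"

definition fstJ :: "(('i + 'j) + unit) list \<Rightarrow> 'j list" where
  "fstJ ts = concat (map (\<lambda>t. case t of Inl (Inr j) \<Rightarrow> [j] | _ \<Rightarrow> []) ts)"

lemma set_fst: "set (fstI ts) = {i. Inl (Inl i) \<in> set ts}" "set (fstJ ts) = {j. Inl (Inr j) \<in> set ts}"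
  by (induction ts) (auto simp: fstI_def fstJ_def split: sum.splits)

lemma distinct_fst: "distinct ts \<Longrightarrow> distinct (fstI ts)" "distinct ts \<Longrightarrow> distinct (fstJ ts)"
proof (induction ts)
  case (Cons t ts)
  { case 1 then show ?case using Cons(1) set_fst(1)[of ts] by (auto simp: fstI_def split: sum.splits) }
  { case 2 then show ?case using Cons(2) set_fst(2)[of ts] by (auto simp: fstJ_def split: sum.splits) }
qed (simp_all add: fstI_def fstJ_def)

lemma sum_unit: "distinct ts \<Longrightarrow>
    (\<Sum>t\<leftarrow>ts. case t of Inl _ \<Rightarrow> 0 | Inr _ \<Rightarrow> c t) = (if Inr () \<in> set ts then c (Inr ()) else 0 :: 'r)"
  by (induction ts) (auto split: sum.splits)

lemma sum_bas:
  "(\<Sum>t\<leftarrow>ts. ssc (c t) (bas t)) = lc (\<Sum>i\<leftarrow>fstI ts. scale (c (Inl (Inl i))) (e i),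
     \<Sum>t\<leftarrow>ts. case t of Inl _ \<Rightarrow> 0 | Inr _ \<Rightarrow> c t) (map (\<lambda>j. (c (Inl (Inr j)), j)) (fstJ ts))"
proof (induction ts)
  case Nil
  then show ?case by (simp add: fstI_def fstJ_def lc_def zero_fun_def zero_prod_def fun_eq_iff)
next
  case (Cons t ts)
  then show ?case
    by (cases t; cases "projl t")
      (simp_all add: fstI_def fstJ_def lc_def bas_def fun_eq_iff prod_eq_iff add_ac)
qed

text \<open>A vanishing combination has vanishing second coordinate, so
  \<open>lc_independent\<close> kills the coefficients of \<open>U\<close> and the
  \<open>v j\<close>; a relation among the \<open>e i\<close> remains.\<close>

lemma independent_bas:
  assumes ind: "\<And>c is i. distinct is \<Longrightarrow> set is \<subseteq> I \<Longrightarrow> (\<Sum>i\<leftarrow>is. scale (c i) (e i)) = 0 \<Longrightarrow> i \<in> set is \<Longrightarrow> c i = 0"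
  shows "Defs.independent G (\<lambda>t. h (bas t)) ((I <+> J) <+> {()})"
  unfolding Defs.independent_def
proof (intro conjI ballI allI impI)
  fix t assume "t \<in> (I <+> J) <+> {()}"
  then show "h (bas t) \<in> mcarrier G" by (intro G.h_carrier bas_P)
next
  fix c ts t
  assume *: "distinct ts \<and> set ts \<subseteq> (I <+> J) <+> {()} \<and> lin_comb G (\<lambda>t. h (bas t)) c ts = mzero G"
    and t: "t \<in> set ts"
  define k where "k = (\<Sum>i\<leftarrow>fstI ts. scale (c (Inl (Inl i))) (e i))"
  define b where "b = (\<Sum>t\<leftarrow>ts. case t of Inl _ \<Rightarrow> 0 | Inr _ \<Rightarrow> c t)"
  define l where "l = map (\<lambda>j. (c (Inl (Inr j)), j)) (fstJ ts)"
  have bP: "\<And>t. t \<in> set ts \<Longrightarrow> bas t \<in> P" using * bas_P by blast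
  have "nul (\<Sum>t\<leftarrow>ts. ssc (c t) (bas t))"
    using * G.lin_comb_h[of ts bas c, OF bP] G.eq_zero_iff by auto
  then have nul: "nul (lc (k, b) l)" unfolding sum_bas k_def b_def l_def .
  have I: "set (fstI ts) \<subseteq> I" and J: "set (fstJ ts) \<subseteq> J" using * by (auto simp: set_fst)
  have "(\<Sum>i\<leftarrow>is. scale (c (Inl (Inl i))) (e i)) \<in> K" if "set is \<subseteq> I" for "is"
    using that by (induction "is") (auto simp: K_0 K_add K_scale e_K)
  then have k: "(k, b) \<in> K \<times> UNIV" unfolding k_def using I by simp
  have l: "l \<in> lists (UNIV \<times> J)" using J by (auto simp: l_def)
  note lci = lc_independent[OF k l nul_snd[OF nul]]
  have b0: "b = 0" using lci(3) by simp
  have "nul (\<lambda>_. (k, b))" using nul lci(2) by simp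
  then have k0: "k = 0" using nul_const[OF k] by (simp add: zero_prod_def)
  show "c t = 0"
  proof (cases t)
    case (Inr u)
    then show ?thesis using b0 sum_unit[of ts c] * t by (simp add: b_def)
  next
    case (Inl s)
    show ?thesis
    proof (cases s)
      case (Inl i)
      then have "i \<in> set (fstI ts)" using t \<open>t = Inl s\<close> by (simp add: set_fst)
      then show ?thesis
        using ind[of "fstI ts" "\<lambda>i. c (Inl (Inl i))" i] I k0 * distinct_fst(1) Inl \<open>t = Inl s\<close>
        by (simp add: k_def)
    next
      case (Inr j)
      then have "j \<in> set (fstJ ts)" using t \<open>t = Inl s\<close> by (simp add: set_fst)
      then show ?thesis
        using coef_distinct[of "fstJ ts" j "\<lambda>j. c (Inl (Inr j))"] lci(1)[of j] * distinct_fst(2) Inr \<open>t = Inl s\<close>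
        by (simp add: l_def)
    qed
  qed
qed

lemma span_bas:
  assumes g: "g \<in> mcarrier G"
  shows "\<exists>s\<in>S. msmul G s g \<in> Defs.span G (\<lambda>t. h (bas t)) ((I <+> J) <+> {()})"
proof -
  let ?T = "(I <+> J) <+> {()}"
  obtain x where x: "x \<in> P" "g = h x" using g by (auto simp: G.carrier)
  obtain t a l where t: "t \<in> S" "a \<in> K \<times> UNIV" "l \<in> lists (UNIV \<times> J)" "nul (ssc t x - lc a l)"
    using x(1) by (rule P_E)
  obtain k b where a: "a = (k, b)" "k \<in> K" using t(2) by blast
  obtain t' l1 where t': "t' \<in> S" "l1 \<in> lists (UNIV \<times> I)" "scale t' k = (\<Sum>(c, i)\<leftarrow>l1. scale c (e i))"
    using e_gen[OF a(2)] by blast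
  \<comment> \<open>The denominator \<open>t'\<close> comes from expressing \<open>k\<close> by the
    \<open>e i\<close> and therefore multiplies the other coefficients as well.\<close>
  define L :: "('r \<times> (('i + 'j) + unit)) list" where
    "L = map (\<lambda>(c, i). (c, Inl (Inl i))) l1 @ map (\<lambda>(c, j). (t' * c, Inl (Inr j))) l @ [(t' * b, Inr ())]"
  have L: "snd ` set L \<subseteq> ?T" using t(3) t'(2) by (fastforce simp: L_def)
  have 1: "(\<Sum>(c, s)\<leftarrow>map (\<lambda>(c, i). (c, Inl (Inl i))) l1. ssc c (bas s)) n = (\<Sum>(c, i)\<leftarrow>l1. scale c (e i), 0)" for l1 n
    by (induction l1) (auto simp: bas_def zero_prod_def)
  have 2: "(\<Sum>(c, s)\<leftarrow>map (\<lambda>(c, j). (t' * c, Inl (Inr j))) l. ssc c (bas s)) n = psc t' (vsum l n)" for l n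
    by (induction l) (auto simp: bas_def prod_eq_iff algebra_simps K.scale_right_distrib)
  have eq: "(\<Sum>(c, s)\<leftarrow>L. ssc c (bas s)) = ssc t' (lc a l)"
  proof
    fix n
    have "(\<Sum>(c, s)\<leftarrow>L. ssc c (bas s)) n = (scale t' k, 0) + (psc t' (vsum l n) + psc (t' * b) (0, 1))"
      using 1[of l1 n] 2[of l n] by (simp add: L_def t'(3) bas_def)
    then show "(\<Sum>(c, s)\<leftarrow>L. ssc c (bas s)) n = ssc t' (lc a l) n"
      by (simp add: lc_def a prod_eq_iff K.scale_right_distrib algebra_simps)
  qed
  \<comment> \<open>\<open>lin_comb\<close> takes its coefficients from a function of the index, so
    recurring indices of \<open>L\<close> are merged by \<open>coef\<close> over a repetition-free
    list.\<close>
  let ?ts = "remdups (map snd L)"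
  have "(\<Sum>(c, s)\<leftarrow>L. ssc c (bas s)) = (\<Sum>s\<in>set ?ts. ssc (coef L s) (bas s))"
    by (rule seq.sum_list_eq_sum_coef) auto
  also have "\<dots> = (\<Sum>s\<leftarrow>?ts. ssc (coef L s) (bas s))"
    by (rule sum_list_distinct_conv_sum_set[symmetric]) simp
  finally have eq': "(\<Sum>s\<leftarrow>?ts. ssc (coef L s) (bas s)) = ssc t' (lc a l)" using eq by simp
  have ts: "set ?ts \<subseteq> ?T" using L by simp
  then have bP: "\<And>s. s \<in> set ?ts \<Longrightarrow> bas s \<in> P" using bas_P by blast
  note lch = G.lin_comb_h[of ?ts bas "coef L", OF bP]
  have "ssc (t' * t) x - ssc t' (lc a l) = ssc t' (ssc t x - lc a l)"
    by (simp add: seq.scale_right_diff_distrib)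
  then have "nul (ssc (t' * t) x - ssc t' (lc a l))" using nul_ssc[OF t(4), of t'] by (simp only:)
  then have "h (ssc (t' * t) x) = h (ssc t' (lc a l))"
    using G.eq_iff[OF P_ssc[OF x(1), of "t' * t"] lch(2)] eq' by simp
  then have "msmul G (t' * t) g = lin_comb G (\<lambda>s. h (bas s)) (coef L) ?ts"
    using lch(1) eq' x G.smul[OF x(1), of "t' * t"] by simp
  then show ?thesis using mult_S[OF t'(1) t(1)] ts unfolding Defs.span_def by blast
qed

end

section \<open>The construction applied to the given module\<close>

theorem theorem3p2:
  fixes S :: "'r::comm_ring_1 set" and K :: "('r, 'm) rmod" and I :: "'i set"
  assumes S_countable: "countable S"
    and S_one: "1 \<in> S"
    and S_mult: "\<forall>s\<in>S. \<forall>t\<in>S. s * t \<in> S"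
    and R_tf: "torsion_free S (ring_mod :: ('r, 'r) rmod)"
    and R_red: "reduced S (ring_mod :: ('r, 'r) rmod)"
    and R_card: "(card_of (UNIV :: 'r set), card_of (UNIV :: nat set set)) \<in> ordLess"
    and K_mod: "is_module K"
    and K_tf: "torsion_free S K"
    and K_red: "reduced S K"
    and K_rank: "has_rank S K I"
    and I_ne: "I \<noteq> {}"
    and I_card: "(card_of I, card_of (UNIV :: nat set set)) \<in> ordLess"
  shows "\<exists>(G :: ('r, 'm + (nat \<Rightarrow> 'r)) rmod) i.
           is_module G \<and> cotorsion_free S G \<and>
           (if (\<exists>a. I = {a}) then has_rank S G {0::nat, 1, 2}
            else has_rank S G ((I \<times> {0::nat, 1, 2}) <+> {()})) \<and>
           lin_map K G i \<and> inj_on i (mcarrier K) \<and>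
           (\<forall>f. lin_map G K f \<longrightarrow> (\<forall>x\<in>mcarrier G. f x = mzero K)) \<and>
           (\<forall>f. lin_map G (quot_mod G (i ` mcarrier K)) f \<longleftrightarrow>
                (\<exists>r. \<forall>x\<in>mcarrier G.
                   f x = msmul (quot_mod G (i ` mcarrier K)) r (quot_map G (i ` mcarrier K) x))) \<and>
           cellular_exact K G (quot_mod G (i ` mcarrier K)) i (quot_map G (i ` mcarrier K))"
proof -
  obtain Kt where pK: "presentation modprod_scale Kt {0} (\<lambda>f. Rep_modprod f K) K"
    using is_module_presentation[OF K_mod] by blast
  define hK where "hK = (\<lambda>f :: ('r, 'm) modprod. Rep_modprod f K)"
  interpret Kp: presentation modprod_scale Kt "{0}" hK K
    unfolding hK_def by (rule pK)
  have inj: "inj_on hK Kt" using Kp.eq_iff by (auto simp: inj_on_def)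
  have bij: "bij_betw hK Kt (mcarrier K)" using inj by (simp add: bij_betw_def Kp.carrier)
  have iso: "|Kt| =o |mcarrier K|" using bij card_of_ordIsoI by blast
  have cardK: "|mcarrier K| <o |UNIV :: nat set set|"
  proof (cases "|UNIV :: 'r set| <o |mcarrier K|")
    case True
    then have "|mcarrier K| =o |I|" using K_rank by (simp add: has_rank_def)
    then show ?thesis using I_card ordIso_ordLess_trans by blast
  next
    case False
    then have "|mcarrier K| \<le>o |UNIV :: 'r set|"
      by (rule not_ordLess_iff_ordLeq[OF card_of_Well_order card_of_Well_order, THEN iffD1])
    then show ?thesis using R_card ordLeq_ordLess_trans by blast
  qed
  interpret adic_kernel S modprod_scale Kt
  proof
    show "countable S" by (rule S_countable)
    show "1 \<in> S" by (rule S_one)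
    show "s * t \<in> S" if "s \<in> S" "t \<in> S" for s t using S_mult that by blast
    show "x = 0" if "s \<in> S" "s * x = 0" for s x :: 'r
      using R_tf that by (auto simp: torsion_free_def ring_mod_def)
    show "x = 0" if "\<And>s. s \<in> S \<Longrightarrow> s dvd x" for x :: 'r
      using R_red that by (auto simp: reduced_def ring_mod_def dvd_def)
    show "x = 0" if "s \<in> S" "x \<in> Kt" "modprod_scale s x = 0" for s x
    proof -
      have "msmul K s (hK x) = mzero K" using Kp.smul[OF that(2), of s] that(3) by (simp add: Kp.zero)
      then have "hK x = mzero K" using K_tf that(1) Kp.h_carrier[OF that(2)] unfolding torsion_free_def by blast
      then show ?thesis using Kp.eq_zero_iff[OF that(2)] by simp
    qed
    show "x = 0" if x: "x \<in> Kt" "\<And>s. s \<in> S \<Longrightarrow> \<exists>y\<in>Kt. x = modprod_scale s y" for x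
    proof -
      have "\<exists>y\<in>mcarrier K. hK x = msmul K s y" if "s \<in> S" for s
      proof -
        obtain y where "y \<in> Kt" "x = modprod_scale s y" using x(2)[OF \<open>s \<in> S\<close>] by blast
        then show ?thesis using Kp.smul Kp.h_carrier by (intro bexI[of _ "hK y"]) simp_all
      qed
      then have "hK x = mzero K" using K_red Kp.h_carrier[OF x(1)] unfolding reduced_def by blast
      then show ?thesis using Kp.eq_zero_iff[OF x(1)] by simp
    qed
    show "|Kt| <o |UNIV :: nat set set|" using iso cardK ordIso_ordLess_trans by blast
  qed (use Kp.subspace_P R_card in auto)

  let ?big = "|UNIV :: 'r set| <o |mcarrier K|"
  \<comment> \<open>For |K| > |R| the rank is the cardinal of \<open>K\<close>, and \<open>I\<close>
    can only enumerate \<open>K\<close>; otherwise \<open>em\<close> is the given basis.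
    Independence is recorded for the second case alone.\<close>
  obtain em where em: "\<And>i. i \<in> I \<Longrightarrow> em i \<in> mcarrier K"
    and em_span: "\<And>x. x \<in> mcarrier K \<Longrightarrow> \<exists>s\<in>S. msmul K s x \<in> Defs.span K em I"
    and em_ind: "\<not> ?big \<Longrightarrow> Defs.independent K em I"
  proof (cases ?big)
    case True
    then have "|I| =o |mcarrier K|" using K_rank ordIso_symmetric by (auto simp: has_rank_def)
    then obtain f where f: "bij_betw f I (mcarrier K)" using card_of_ordIso by blast
    have "\<exists>s\<in>S. msmul K s x \<in> Defs.span K f I" if x: "x \<in> mcarrier K" for x
    proof -
      obtain i where i: "i \<in> I" "x = f i" using f x by (auto simp: bij_betw_def)
      have "lin_comb K f (\<lambda>_. 1) [i] = madd K (msmul K 1 x) (mzero K)" using i by (simp add: lin_comb_def)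
      also have "\<dots> = msmul K 1 x"
        using is_module_simps[OF K_mod] is_module_comm[OF K_mod] x by metis
      finally have "msmul K 1 x \<in> Defs.span K f I" using i unfolding Defs.span_def
        by (auto intro!: exI[of _ "\<lambda>_. 1"] exI[of _ "[i]"])
      then show ?thesis using S_one by blast
    qed
    moreover have "f i \<in> mcarrier K" if "i \<in> I" for i using f that by (auto simp: bij_betw_def)
    ultimately show ?thesis using that True by blast
  next
    case False
    then obtain f where "Defs.independent K f I" "\<forall>x\<in>mcarrier K. \<exists>s\<in>S. msmul K s x \<in> Defs.span K f I"
      using K_rank by (auto simp: has_rank_def)
    then show ?thesis using that[of f] unfolding Defs.independent_def by blast
  qed
  define e where "e i = inv_into Kt hK (em i)" for i
  have e: "e i \<in> Kt" "hK (e i) = em i" if "i \<in> I" for i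
    using em[OF that] by (auto simp: e_def Kp.carrier inv_into_into f_inv_into_f)
  have lin: "lin_comb K em c is = hK (\<Sum>i\<leftarrow>is. modprod_scale (c i) (e i))"
    "(\<Sum>i\<leftarrow>is. modprod_scale (c i) (e i)) \<in> Kt" if "set is \<subseteq> I" for c "is"
  proof -
    have "map (\<lambda>i. msmul K (c i) (em i)) is = map (\<lambda>i. msmul K (c i) (hK (e i))) is"
      using that e by auto
    then have "lin_comb K em c is = lin_comb K (\<lambda>i. hK (e i)) c is" by (simp only: lin_comb_def)
    then show "lin_comb K em c is = hK (\<Sum>i\<leftarrow>is. modprod_scale (c i) (e i))"
      "(\<Sum>i\<leftarrow>is. modprod_scale (c i) (e i)) \<in> Kt"
      using Kp.lin_comb_h[of "is" e c] e that by auto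
  qed
  have e_gen: "\<exists>t\<in>S. \<exists>l\<in>lists (UNIV \<times> I). modprod_scale t k = (\<Sum>(c, i)\<leftarrow>l. modprod_scale c (e i))"
    if k: "k \<in> Kt" for k
  proof -
    obtain s where s: "s \<in> S" "msmul K s (hK k) \<in> Defs.span K em I" using em_span Kp.h_carrier[OF k] by blast
    then obtain c "is" where c: "msmul K s (hK k) = lin_comb K em c is" "set is \<subseteq> I"
      unfolding Defs.span_def by blast
    then have "hK (modprod_scale s k) = hK (\<Sum>i\<leftarrow>is. modprod_scale (c i) (e i))"
      using lin Kp.smul[OF k] by simp
    then have "modprod_scale s k = (\<Sum>i\<leftarrow>is. modprod_scale (c i) (e i))"
      using inj_onD[OF inj] Kp.P_scale[OF k] lin(2)[OF c(2)] by blast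
    also have "\<dots> = (\<Sum>(c, i)\<leftarrow>map (\<lambda>i. (c i, i)) is. modprod_scale c (e i))" by (simp add: o_def)
    finally show ?thesis
      using s(1) c(2) by (intro bexI[of _ s] bexI[of _ "map (\<lambda>i. (c i, i)) is"]) auto
  qed

  \<comment> \<open>A singleton \<open>I\<close> gets one \<open>v j\<close>, giving rank 1 + 1 + 1;
    otherwise each index gets two, giving kappa + 2 kappa + 1.\<close>
  define J :: "('i \<times> nat) set" where "J = (if \<exists>a. I = {a} then I \<times> {0} else I \<times> {0, 1})"
  have J_sub: "J \<subseteq> I \<times> {0, 1}" "I \<times> {0} \<subseteq> J" by (auto simp: J_def)
  obtain j0 where j0: "j0 \<in> J" using I_ne J_sub by blast
  have "|{0, 1 :: nat}| <o |UNIV :: nat set set|"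
    using finite_ordLess_infinite[OF card_of_Well_order card_of_Well_order, of "{0, 1 :: nat}" "UNIV :: nat set set"] infinite_UNIV_nat_set
    by (simp add: Field_card_of)
  then have cardJ: "|J| <o |UNIV :: nat set set|"
    using card_of_Times_ordLess_nat_set[OF I_card] card_of_mono1[OF J_sub(1)] ordLeq_ordLess_trans by blast
  obtain W where W: "indep W J" "generic (W j0) (Cset W (J - {j0}))"
    using exists_family[OF cardJ j0] by blast
  obtain Y where Y: "\<forall>\<alpha>\<in>Cset W J. \<forall>\<beta>\<in>Cset W J. \<forall>z\<in>Cset W J. \<forall>j\<in>J.
    nul (\<lambda>n. psc (wseq Y n) (\<alpha> n) + (psc (wseq (W j) n) (\<beta> n) - z n)) \<longrightarrow> nul \<alpha>"
    using exists_linear_generic[OF cardJ, of W] by blast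
  interpret cellular_construction S modprod_scale Kt I e J fst j0 W Y
  proof
    show "fst j \<in> I" if "j \<in> J" for j using that J_sub by auto
    show "\<exists>j\<in>J. fst j = i" if "i \<in> I" for i using that J_sub by (intro bexI[of _ "(i, 0)"]) auto
    show "nul \<alpha>" if "\<alpha> \<in> Cset W J" "\<beta> \<in> Cset W J" "z \<in> Cset W J" "j \<in> J"
      "nul (\<lambda>n. psc (wseq Y n) (\<alpha> n) + (psc (wseq (W j) n) (\<beta> n) - z n))" for \<alpha> \<beta> z j
      using Y that by blast
  qed (use e e_gen j0 W in auto)

  have ind: "c i = 0"
    if "\<not> ?big" "distinct is" "set is \<subseteq> I" "(\<Sum>i\<leftarrow>is. modprod_scale (c i) (e i)) = 0" "i \<in> set is" for c "is" i
    using em_ind[OF that(1)] lin(1)[OF that(3), of c] that Kp.zero unfolding Defs.independent_def by metis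
  let ?cls = "(\<lambda>x. {y. nul (y - x)}) ` P"
  have J_le: "|J| \<le>o |Z|" if "infinite Z" "|I| \<le>o |Z|" for Z :: "'z set"
  proof -
    have "|{0, 1 :: nat}| \<le>o |Z|"
      using finite_ordLess_infinite[OF card_of_Well_order card_of_Well_order, of "{0, 1 :: nat}" Z] that(1)
      by (simp add: Field_card_of ordLess_imp_ordLeq)
    then have "|I \<times> {0, 1 :: nat}| \<le>o |Z|"
      using that by (intro card_of_Times_ordLeq_infinite_Field) (simp_all add: card_of_card_order_on Field_card_of)
    then show ?thesis using card_of_mono1[OF J_sub(1)] ordLeq_transitive by blast
  qed
  have big: "|?cls| \<le>o |mcarrier K|" "infinite I" if ?big
  proof -
    have IK: "|mcarrier K| =o |I|" using K_rank that by (simp add: has_rank_def)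
    have le: "|UNIV :: 'r set| \<le>o |mcarrier K|" using that ordLess_imp_ordLeq by blast
    have inf: "infinite (mcarrier K)" using card_of_ordLeq_infinite[OF le] infinite_UNIV_R by blast
    show "infinite I" using card_of_ordIso_finite[OF IK] inf by blast
    show "|?cls| \<le>o |mcarrier K|"
    proof (rule card_classes[OF inf _ le])
      show "|Kt| \<le>o |mcarrier K|" using iso ordIso_iff_ordLeq by blast
      show "|J| \<le>o |mcarrier K|" using J_le[OF inf] IK ordIso_iff_ordLeq by blast
    qed
  qed
  have small: "|?cls| \<le>o |UNIV :: 'r set|" if "\<not> ?big"
  proof -
    have le: "|mcarrier K| \<le>o |UNIV :: 'r set|"
      using that by (rule not_ordLess_iff_ordLeq[OF card_of_Well_order card_of_Well_order, THEN iffD1])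
    then have le': "|Kt| \<le>o |UNIV :: 'r set|" using iso ordIso_ordLeq_trans by blast
    \<comment> \<open>Independence keeps the \<open>e i\<close> distinct, so \<open>I\<close>, and
      with it \<open>J\<close>, is bounded by \<open>K\<close> and hence by the ring.\<close>
    have "inj_on e I"
    proof (rule inj_onI, rule ccontr)
      fix i i' assume i: "i \<in> I" "i' \<in> I" "e i = e i'" "i \<noteq> i'"
      define c where "c = (\<lambda>j. if j = i then 1 else - 1 :: 'r)"
      have "(\<Sum>j\<leftarrow>[i, i']. modprod_scale (c j) (e j)) = 0" using i by (auto simp: c_def)
      then have "c i = 0" using ind[OF that, of "[i, i']" c i] i by auto
      then show False by (simp add: c_def)
    qed
    then have "|I| \<le>o |Kt|" using e(1) card_of_ordLeq[of I Kt] by blast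
    then have "|J| \<le>o |UNIV :: 'r set|" using J_le[OF infinite_UNIV_R] le' ordLeq_transitive by blast
    then show ?thesis by (intro card_classes infinite_UNIV_R le' card_of_mono1) auto
  qed
  \<comment> \<open>The type prescribed for \<open>G\<close> has room in both cases:
    \<open>K\<close> embeds on the left, \<open>R\<close> through constant sequences on the
    right.\<close>
  have "|mcarrier K| \<le>o |UNIV :: ('m + (nat \<Rightarrow> 'r)) set|"
    using card_of_ordLeq[of "mcarrier K" "UNIV :: ('m + (nat \<Rightarrow> 'r)) set"] inj_Inl[of "mcarrier K"] by blast
  moreover have "|UNIV :: 'r set| \<le>o |UNIV :: ('m + (nat \<Rightarrow> 'r)) set|"
  proof -
    have "inj (\<lambda>r :: 'r. Inr (\<lambda>_ :: nat. r) :: 'm + (nat \<Rightarrow> 'r))" by (auto simp: inj_def fun_eq_iff)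
    then show ?thesis using card_of_ordLeq[of "UNIV :: 'r set" "UNIV :: ('m + (nat \<Rightarrow> 'r)) set"] by blast
  qed
  ultimately have "|?cls| \<le>o |UNIV :: ('m + (nat \<Rightarrow> 'r)) set|"
    using ordLeq_transitive[OF big(1)] ordLeq_transitive[OF small] by (cases ?big) blast+
  then obtain h and G :: "('r, 'm + (nat \<Rightarrow> 'r)) rmod"
    where G: "presentation ssc P {x. nul x} h G" and G_cls: "|mcarrier G| \<le>o |?cls|"
    using exists_presentation by blast
  have cardG: "|mcarrier G| <o |UNIV :: nat set set|"
    using ordLeq_ordLess_trans[OF ordLeq_transitive[OF G_cls big(1)] cardK]
      ordLeq_ordLess_trans[OF ordLeq_transitive[OF G_cls small] R_card]
    by (cases ?big) blast+
  interpret cellular_module S modprod_scale Kt I e J fst j0 W Y h G hK K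
    by (intro cellular_module.intro cellular_module_axioms.intro cellular_construction_axioms
        G Kp.presentation_axioms cardG)

  have rank: "if \<exists>a. I = {a} then has_rank S G {0::nat, 1, 2}
            else has_rank S G ((I \<times> {0::nat, 1, 2}) <+> {()})"
  proof (cases ?big)
    case True
    \<comment> \<open>Here |G| = |K| = |I| is infinite and exceeds |R|, so the rank of
      \<open>G\<close> is its cardinal, which absorbs the factor 3 and the summand 1.\<close>
    have KG: "|mcarrier K| \<le>o |mcarrier G|"
      using inj_inc image_inc N_P G.carrier card_of_ordLeq[of "mcarrier K" "mcarrier G"] by blast
    have GK: "|mcarrier G| \<le>o |mcarrier K|" using G_cls big(1)[OF True] ordLeq_transitive by blast
    have RG: "|UNIV :: 'r set| <o |mcarrier G|" using True KG ordLess_ordLeq_trans by blast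
    have IK: "|mcarrier K| =o |I|" using K_rank True by (simp add: has_rank_def)
    have inf: "infinite I" by (rule big(2)[OF True])
    have fin: "|X| \<le>o |I|" if "finite X" for X :: "'x set"
      using finite_ordLess_infinite[OF card_of_Well_order card_of_Well_order, of X I] inf that
      by (simp add: Field_card_of ordLess_imp_ordLeq)
    have "|I \<times> {0::nat, 1, 2}| \<le>o |I|"
      using inf fin[of "{0::nat, 1, 2}"] card_of_mono1[of I I]
      by (intro card_of_Times_ordLeq_infinite_Field) (simp_all add: card_of_card_order_on Field_card_of)
    then have le: "|(I \<times> {0::nat, 1, 2}) <+> {()}| \<le>o |I|"
      using inf fin[of "{()}"] by (intro card_of_Plus_ordLeq_infinite_Field) (simp_all add: card_of_card_order_on Field_card_of)
    have "inj_on (\<lambda>i. Inl (i, 0::nat) :: ('i \<times> nat) + unit) I"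
      "(\<lambda>i. Inl (i, 0::nat) :: ('i \<times> nat) + unit) ` I \<subseteq> (I \<times> {0::nat, 1, 2}) <+> {()}"
      by (auto simp: inj_on_def)
    then have "|I| \<le>o |(I \<times> {0::nat, 1, 2}) <+> {()}|" using card_of_ordLeq by blast
    then have "|mcarrier G| =o |(I \<times> {0::nat, 1, 2}) <+> {()}|"
      using le KG GK IK by (meson ordIso_iff_ordLeq ordLeq_transitive)
    moreover have "\<not> (\<exists>a. I = {a})" using inf by auto
    ultimately show ?thesis using RG by (simp add: has_rank_def)
  next
    case False
    have "\<not> |UNIV :: 'r set| <o |mcarrier G|"
      using G_cls small[OF False] not_ordLess_ordLeq ordLeq_transitive by blast
    moreover have "Defs.independent G (\<lambda>t. h (bas t)) ((I <+> J) <+> {()})"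
      by (rule independent_bas) (rule ind[OF False])
    ultimately have T: "has_rank S G ((I <+> J) <+> {()})"
      using span_bas unfolding has_rank_def by auto
    show ?thesis
    proof (cases "\<exists>a. I = {a}")
      case True
      then obtain a where a: "I = {a}" by blast
      define f :: "nat \<Rightarrow> ('i + 'i \<times> nat) + unit" where
        "f n = (if n = 0 then Inl (Inl a) else if n = 1 then Inl (Inr (a, 0)) else Inr ())" for n
      have "bij_betw f {0, 1, 2} ((I <+> J) <+> {()})"
        unfolding bij_betw_def by (auto simp: f_def a J_def inj_on_def image_def)
      then show ?thesis using has_rank_bij[OF _ T] True by auto
    next
      case ne: False
      \<comment> \<open>\<open>(i, 0)\<close> names \<open>e i\<close>, while \<open>(i, 1)\<close>
        and \<open>(i, 2)\<close> name the two \<open>v j\<close> attached to \<open>i\<close>,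
        whose own second index is 0 or 1.\<close>
      define f :: "('i \<times> nat) + unit \<Rightarrow> ('i + 'i \<times> nat) + unit" where
        "f t = (case t of Inl (i, n) \<Rightarrow> if n = 0 then Inl (Inl i) else Inl (Inr (i, n - 1)) | Inr u \<Rightarrow> Inr u)" for t
      have J: "J = I \<times> {0, 1}" using ne by (simp add: J_def)
      have "inj_on f ((I \<times> {0::nat, 1, 2}) <+> {()})"
        by (auto simp: f_def inj_on_def)
      moreover have "f ` ((I \<times> {0::nat, 1, 2}) <+> {()}) = (I <+> J) <+> {()}"
      proof
        show "f ` ((I \<times> {0::nat, 1, 2}) <+> {()}) \<subseteq> (I <+> J) <+> {()}" by (auto simp: f_def J)
        show "(I <+> J) <+> {()} \<subseteq> f ` ((I \<times> {0::nat, 1, 2}) <+> {()})"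
        proof
          fix t assume t: "t \<in> (I <+> J) <+> {()}"
          then consider i where "t = Inl (Inl i)" "i \<in> I" | i n where "t = Inl (Inr (i, n))" "i \<in> I" "n \<in> {0, 1}"
            | "t = Inr ()" by (auto simp: J)
          then show "t \<in> f ` ((I \<times> {0::nat, 1, 2}) <+> {()})"
          proof cases
            case 1
            then show ?thesis by (intro image_eqI[of _ _ "Inl (i, 0)"]) (auto simp: f_def)
          next
            case 2
            then show ?thesis by (intro image_eqI[of _ _ "Inl (i, Suc n)"]) (auto simp: f_def)
          next
            case 3
            then show ?thesis by (intro image_eqI[of _ _ "Inr ()"]) (auto simp: f_def)
          qed
        qed
      qed
      ultimately have "bij_betw f ((I \<times> {0::nat, 1, 2}) <+> {()}) ((I <+> J) <+> {()})"
        by (simp add: bij_betw_def)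
      then show ?thesis using has_rank_bij[OF _ T] ne by auto
    qed
  qed
  show ?thesis
    using G.is_module cotorsion_free_G rank lin_map_inc inj_inc hom_K_zero hom_Q_iff cellular
    unfolding image_inc[symmetric] by (intro exI[of _ G] exI[of _ inc] conjI) blast+
qed

end
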